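(* Let $\lambda$ be a measured geodesic lamination on $\mathbb H^2$ invariant under a group $\Gamma<PSL(2,\mathbb R)$ acting freely and properly on $\mathbb H^2$, and let $\gamma\in\Gamma$ be a hyperbolic element. Then there exists $t<1$ sufficiently small such that $\rho^1_{s\lambda}(\gamma)$ is hyperbolic (loxodromic) for $s<t$. Moreover, for every $\kappa\in\{0,1,-1\}$, $$\frac{d\,\ell^\kappa_{t\lambda}([\gamma])}{dt}\Big|_{t=0}=0,\qquad\frac{d\,\mathcal M^\kappa_{t\lambda}([\gamma])}{dt}\Big|_{t=0}=\mathcal M^0_\lambda([\gamma]).$$
   Context: $\mathbb R^3$ carries $\langle v,w\rangle=-v_0w_0+v_1w_1+v_2w_2$ and $\mathbb H^2=\{v:\langle v,v\rangle=-1,v_0>0\}$, oriented by the standard orientation of $\mathbb R^3$ with the future normal first; $PSL(2,\mathbb R)\cong SO^+(2,1)$. A measured geodesic lamination $\lambda=(\mathcal L,\mu)$ on $\mathbb H^2$ is a closed set $L$ partitioned into complete geodesics (leaves) with a transverse measure $\mu$: a Radon measure $\mu_k$ with support $k\cap L$ on each rectifiable transverse arc $k$, compatible with restriction to subarcs and with homotopy through transverse arcs. $L_W$ is the union of the leaves carrying an atom; $t\lambda=(\mathcal L,t\mu)$, $t\ge0$. Fix $x_0\in\mathbb H^2\setminus L_W$. For an oriented geodesic $l$ of $\mathbb H^2$, $X(l)\in\mathfrak{sl}(2,\mathbb R)$ is the unit generator of positive translations along $l$ ($\exp(tX(l))$ has translation length $2t$). For $c\in\mathbb C$ let $E_{c\lambda}(x,y)\in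 PSL(2,\mathbb C)$ be the limit as the mesh tends to $0$ of the ordered products $\exp(cm_1X(l_1)/2)\cdots\exp(cm_rX(l_r)/2)$ over subdivisions of $[x,y]$ into consecutive intervals $c_j$ with interior subdivision points not in $L_W$, $m_j=\mu(c_j)$, $l_j$ a leaf meeting $c_j$ (if $m_j>0$) oriented as boundary of the half-plane containing $x$ (so $x$ is on its left), atoms at the endpoints counted with half their mass. Holonomies: $\rho^1_\lambda(\gamma)=E_{i\lambda}(x_0,\gamma x_0)\gamma\in PSL(2,\mathbb C)$; $\rho^{-1}_\lambda(\gamma)=(\rho_-(\gamma),\rho_+(\gamma))$ with $\rho_\pm(\gamma)=E_{\pm\lambda}(x_0,\gamma x_0)\gamma\in PSL(2,\mathbb R)$; $f_\lambda(\gamma)=\gamma+\tau_\lambda(\gamma)$ with $\tau_\lambda(\gamma)=\int_{[x_0,\gamma x_0]}v\,d\mu\in\mathbb R^3$, $v(t)$ being the unit vector tangent to $\mathbb H^2$ at $t\in L$, orthogonal to the leaf through $t$ and pointing towards $\gamma x_0$. Spectra, for $\gamma\in\Gamma$ hyperbolic with conjugacy class $[\gamma]$: $\kappa=0$: $\ell^0_\lambda([\gamma])$ is the translation length of $\gamma$, and $\mathcal M^0_\lambda([\gamma])=\langle v,\tau_\lambda(\gamma)\rangle$, where $v$ is the unit spacelike vector orthogonal to the axis of $\gamma$, pointing to the right of the axis oriented in the direction of translation of $\gamma$. $\kappa=1$: if $\rho^1_\lambda(\gamma)$ is loxodromic, $\ell^1_\lambda([\gamma])>0$ and $\mathcal M^1_\lambda([\gamma])\in[-\pi,\pi]$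 are its translation length and rotation angle, i.e. $\rho^1_\lambda(\gamma)$ is conjugate to $\pm\mathrm{diag}(e^{z/2},e^{-z/2})$ with $z=\ell^1_\lambda([\gamma])+i\mathcal M^1_\lambda([\gamma])$. $\kappa=-1$: $\rho_-(\gamma)$ and $\rho_+(\gamma)$ are hyperbolic; if $m,n$ are their translation lengths, $\ell^{-1}_\lambda([\gamma])=\frac{m+n}2$ and $\mathcal M^{-1}_\lambda([\gamma])=\frac{n-m}2$. *)

theory Defs
  imports "HOL-Analysis.Analysis" "HOL-Algebra.Coset"
begin

section \<open>The hyperboloid model\<close>

text \<open>The coordinates \<open>v\<^sub>0, v\<^sub>1, v\<^sub>2\<close> of \<open>\<real>\<^sup>3\<close> are \<open>v $ 1, v $ 2, v $ 3\<close>.\<close>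

definition mink :: "real^3 \<Rightarrow> real^3 \<Rightarrow> real" where
  "mink v w = - (v $ 1 * w $ 1) + v $ 2 * w $ 2 + v $ 3 * w $ 3"

definition H2 :: "(real^3) set" where
  "H2 = {v. mink v v = -1 \<and> v $ 1 > 0}"

definition hdist :: "real^3 \<Rightarrow> real^3 \<Rightarrow> real" where
  "hdist v w = arcosh (- mink v w)"

definition unit_tangent :: "real^3 \<Rightarrow> real^3 \<Rightarrow> bool" where
  "unit_tangent p u \<longleftrightarrow> p \<in> H2 \<and> mink p u = 0 \<and> mink u u = 1"

text \<open>The unit speed geodesic line with initial data \<open>(p, u)\<close>. An oriented geodesic is given by any
  of its unit tangent vectors \<open>(p, u)\<close>.\<close>

definition geoline :: "real^3 \<Rightarrow> real^3 \<Rightarrow> real \<Rightarrow> real^3" where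
  "geoline p u s = cosh s *\<^sub>R p + sinh s *\<^sub>R u"

definition complete_geodesic :: "(real^3) set \<Rightarrow> bool" where
  "complete_geodesic l \<longleftrightarrow> (\<exists>p u. unit_tangent p u \<and> l = range (geoline p u))"

text \<open>\<open>H2\<close> is oriented with the future normal, which at \<open>p\<close> is \<open>p\<close> itself, first: for \<open>w\<close> tangent at \<open>p\<close>
  and orthogonal to \<open>u\<close>, \<open>w\<close> points to the left of \<open>u\<close> iff \<open>(p, u, w)\<close> is a positive basis.
  The function below vanishes exactly on the geodesic; it is positive on its left,
  negative on its right.\<close>

definition side :: "real^3 \<Rightarrow> real^3 \<Rightarrow> real^3 \<Rightarrow> real" where
  "side p u q = det (vector [p, u, q] :: real^3^3)"

text \<open>The geodesic segment from \<open>x\<close> to \<open>y\<close>, parametrized by arc length on \<open>{0..hdist x y}\<close>.\<close>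

definition geoseg :: "real^3 \<Rightarrow> real^3 \<Rightarrow> real \<Rightarrow> real^3" where
  "geoseg x y s = (let d = hdist x y in geoline x ((1 / sinh d) *\<^sub>R (y - cosh d *\<^sub>R x)) s)"

definition segment :: "real^3 \<Rightarrow> real^3 \<Rightarrow> (real^3) set" where
  "segment x y = geoseg x y ` {0..hdist x y}"


section \<open>\<open>PSL(2,\<complex>)\<close> and \<open>PSL(2,\<real>)\<close>\<close>

definition SL2C :: "(complex^2^2) monoid" where
  "SL2C = \<lparr>carrier = {A. det A = 1}, mult = (**), one = mat 1\<rparr>"

definition PSL2C :: "(complex^2^2) set monoid" where
  "PSL2C = SL2C Mod {mat 1, - mat 1}"

definition psl :: "complex^2^2 \<Rightarrow> (complex^2^2) set" where
  "psl A = {mat 1, - mat 1} #>\<^bsub>SL2C\<^esub> A"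

definition real_entries :: "complex^2^2 \<Rightarrow> bool" where
  "real_entries A \<longleftrightarrow> (\<forall>i j. A $ i $ j \<in> \<real>)"

definition PSL2R :: "(complex^2^2) set set" where
  "PSL2R = {psl A | A. det A = 1 \<and> real_entries A}"

text \<open>The isomorphism \<open>PSL(2,\<real>) \<cong> SO\<^sup>+(2,1)\<close>: identify \<open>v\<close> with the symmetric matrix \<open>symm v\<close>, whose
  determinant is \<open>- mink v v\<close>, and let \<open>A\<close> act by \<open>S \<mapsto> A S A\<^sup>T\<close>. Any other
  isomorphism differs from this one by conjugation by an element of \<open>O\<^sup>+(2,1)\<close>.\<close>

definition symm :: "real^3 \<Rightarrow> complex^2^2" where
  "symm v = vector [vector [complex_of_real (v $ 1 + v $ 2), complex_of_real (v $ 3)],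
                    vector [complex_of_real (v $ 3), complex_of_real (v $ 1 - v $ 2)]]"

definition unsymm :: "complex^2^2 \<Rightarrow> real^3" where
  "unsymm S = vector [Re (S $ 1 $ 1 + S $ 2 $ 2) / 2, Re (S $ 1 $ 1 - S $ 2 $ 2) / 2, Re (S $ 1 $ 2)]"

definition mact :: "complex^2^2 \<Rightarrow> real^3 \<Rightarrow> real^3" where
  "mact A v = unsymm (A ** symm v ** transpose A)"

text \<open>\<open>mact A = mact (- A)\<close>, so the choice of representative is immaterial.\<close>

definition act :: "(complex^2^2) set \<Rightarrow> real^3 \<Rightarrow> real^3" where
  "act P v = mact (SOME A. A \<in> P) v"

definition cscale :: "complex \<Rightarrow> complex^2^2 \<Rightarrow> complex^2^2" where
  "cscale c A = (\<chi> i j. c * A $ i $ j)"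

definition mexp :: "complex^2^2 \<Rightarrow> complex^2^2" where
  "mexp A = (\<Sum>n. (1 / fact n) *\<^sub>R (((**) A) ^^ n) (mat 1))"

text \<open>\<open>X(l) \<in> sl(2,\<real>)\<close> for the oriented geodesic \<open>l\<close> through \<open>(p, u)\<close>.\<close>

definition transl_gen :: "real^3 \<Rightarrow> real^3 \<Rightarrow> complex^2^2" where
  "transl_gen p u = (THE X. real_entries X \<and> trace X = 0 \<and>
     (\<forall>s t. mact (mexp (cscale (complex_of_real t) X)) (geoline p u s) = geoline p u (s + 2 * t)))"

text \<open>\<open>P\<close> is hyperbolic with oriented axis through \<open>(p, u)\<close> and translation length \<open>d\<close>.\<close>

definition translates :: "(complex^2^2) set \<Rightarrow> real^3 \<Rightarrow> real^3 \<Rightarrow> real \<Rightarrow> bool" where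
  "translates P p u d \<longleftrightarrow> unit_tangent p u \<and> d > 0 \<and> (\<forall>s. act P (geoline p u s) = geoline p u (s + d))"

definition hyperbolic :: "(complex^2^2) set \<Rightarrow> bool" where
  "hyperbolic P \<longleftrightarrow> P \<in> PSL2R \<and> (\<exists>p u d. translates P p u d)"

definition transl_length :: "(complex^2^2) set \<Rightarrow> real" where
  "transl_length P = (THE d. \<exists>p u. translates P p u d)"

definition axis_right_normal :: "(complex^2^2) set \<Rightarrow> real^3" where
  "axis_right_normal P = (THE v. \<exists>p u d. translates P p u d \<and>
     mink v v = 1 \<and> mink v p = 0 \<and> mink v u = 0 \<and> side p u v < 0)"

definition diag2 :: "complex \<Rightarrow> complex \<Rightarrow> complex^2^2" where
  "diag2 a b = vector [vector [a, 0], vector [0, b]]"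

definition conj_to_diag :: "(complex^2^2) set \<Rightarrow> complex \<Rightarrow> bool" where
  "conj_to_diag P z \<longleftrightarrow> (\<exists>g\<in>carrier PSL2C.
     P = g \<otimes>\<^bsub>PSL2C\<^esub> psl (diag2 (exp (z / 2)) (exp (- z / 2))) \<otimes>\<^bsub>PSL2C\<^esub> inv\<^bsub>PSL2C\<^esub> g)"

definition loxodromic :: "(complex^2^2) set \<Rightarrow> bool" where
  "loxodromic P \<longleftrightarrow> (\<exists>z. Re z > 0 \<and> conj_to_diag P z)"

text \<open>The translation length plus \<open>\<i>\<close> times rotation angle. It is unique unless the rotation angle is
  \<open>\<plusminus>\<pi>\<close>, where either sign may be chosen.\<close>

definition complex_length :: "(complex^2^2) set \<Rightarrow> complex" where
  "complex_length P = (SOME z. Re z > 0 \<and> Im z \<in> {-pi..pi} \<and> conj_to_diag P z)"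


section \<open>Measured geodesic laminations\<close>

record mlam =
  leaves :: "(real^3) set set"
  tmeasure :: "(real^3) set \<Rightarrow> (real^3) measure"

definition lam_support :: "mlam \<Rightarrow> (real^3) set" where
  "lam_support \<Lambda> = \<Union> (leaves \<Lambda>)"

text \<open>On a compact part of \<open>H2\<close> the Euclidean and the hyperbolic distance are
  Lipschitz equivalent, so that both define the same rectifiable paths.\<close>

definition rectifiable :: "(real \<Rightarrow> real^3) \<Rightarrow> bool" where
  "rectifiable g \<longleftrightarrow> (\<exists>B. \<forall>ts. sorted ts \<and> set ts \<subseteq> {0..1} \<longrightarrow>
     (\<Sum>j<length ts - 1. dist (g (ts ! j)) (g (ts ! Suc j))) \<le> B)"

text \<open>Transversality of a rectifiable arc: each of its points has a neighbourhood in the arc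
  which meets each leaf at most once, crossing it from one side to the other. (The leaf is
  oriented so that the crossing is from left to right.)\<close>

definition transverse_path :: "(real^3) set set \<Rightarrow> (real \<Rightarrow> real^3) \<Rightarrow> bool" where
  "transverse_path \<L> g \<longleftrightarrow> arc g \<and> path_image g \<subseteq> H2 \<and> rectifiable g \<and>
     (\<forall>t\<^sub>0\<in>{0..1}. \<exists>\<epsilon>>0. \<forall>t\<in>{0..1}. \<forall>l\<in>\<L>. \<bar>t - t\<^sub>0\<bar> < \<epsilon> \<and> g t \<in> l \<longrightarrow>
        (\<exists>p u. unit_tangent p u \<and> l = range (geoline p u) \<and>
           (\<forall>s\<in>{0..1}. \<bar>s - t\<^sub>0\<bar> < \<epsilon> \<longrightarrow> sgn (side p u (g s)) = sgn (t - s))))"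

definition transverse_arc :: "(real^3) set set \<Rightarrow> (real^3) set \<Rightarrow> bool" where
  "transverse_arc \<L> k \<longleftrightarrow> (\<exists>g. transverse_path \<L> g \<and> k = path_image g)"

text \<open>The homotopies of arcs that carry transverse measures to each other: those through
  transverse arcs during which no point enters, leaves or changes its leaf.\<close>

definition transverse_homotopy :: "(real^3) set set \<Rightarrow> (real \<Rightarrow> real \<Rightarrow> real^3) \<Rightarrow> bool" where
  "transverse_homotopy \<L> h \<longleftrightarrow>
     continuous_on ({0..1} \<times> {0..1}) (\<lambda>(s, t). h s t) \<and>
     (\<forall>s\<in>{0..1}. transverse_path \<L> (h s)) \<and>
     (\<forall>s\<in>{0..1}. \<forall>t\<in>{0..1}. \<forall>l\<in>\<L>. h s t \<in> l \<longleftrightarrow> h 0 t \<in> l)"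

definition measure_support :: "(real^3) measure \<Rightarrow> (real^3) set" where
  "measure_support M = {q. \<forall>U. open U \<and> q \<in> U \<longrightarrow> emeasure M U > 0}"

text \<open>The measure \<open>\<mu>\<^sub>k\<close> on the arc \<open>k\<close> is regarded as a Borel measure on \<open>\<real>\<^sup>3\<close>
  concentrated on \<open>k\<close>. Its support is \<open>k \<inter> L\<close>, up to
  the endpoints of \<open>k\<close>: an endpoint on \<open>L\<close> to which no mass accumulates from inside \<open>k\<close> (for instance on a
  leaf without atom that bounds a gap containing the rest of \<open>k\<close>) cannot be asked to lie in the support,
  since \<open>\<mu>\<^sub>k\<close> must be the restriction of the measure of any longer arc.\<close>

definition transverse_measure ::
    "(real^3) set set \<Rightarrow> ((real^3) set \<Rightarrow> (real^3) measure) \<Rightarrow> bool" where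
  "transverse_measure \<L> \<mu> \<longleftrightarrow>
     (\<forall>g. transverse_path \<L> g \<longrightarrow>
        finite_measure (\<mu> (path_image g)) \<and> sets (\<mu> (path_image g)) = sets borel \<and>
        measure_support (\<mu> (path_image g)) \<subseteq> path_image g \<inter> \<Union>\<L> \<and>
        (path_image g - {pathstart g, pathfinish g}) \<inter> \<Union>\<L> \<subseteq> measure_support (\<mu> (path_image g))) \<and>
     (\<forall>k k' A. transverse_arc \<L> k \<and> transverse_arc \<L> k' \<and> k' \<subseteq> k \<and> A \<in> sets borel \<and> A \<subseteq> k' \<longrightarrow>
        emeasure (\<mu> k') A = emeasure (\<mu> k) A) \<and>
     (\<forall>h T. transverse_homotopy \<L> h \<and> T \<in> sets borel \<and> T \<subseteq> {0..1} \<longrightarrow>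
        emeasure (\<mu> (path_image (h 1))) (h 1 ` T) = emeasure (\<mu> (path_image (h 0))) (h 0 ` T))"

definition measured_lamination :: "mlam \<Rightarrow> bool" where
  "measured_lamination \<Lambda> \<longleftrightarrow>
     (\<forall>l\<in>leaves \<Lambda>. complete_geodesic l) \<and> disjoint (leaves \<Lambda>) \<and> closed (lam_support \<Lambda>) \<and>
     transverse_measure (leaves \<Lambda>) (tmeasure \<Lambda>)"

definition weighted_part :: "mlam \<Rightarrow> (real^3) set" where
  "weighted_part \<Lambda> = \<Union> {l \<in> leaves \<Lambda>. \<exists>k q. transverse_arc (leaves \<Lambda>) k \<and> q \<in> k \<inter> l \<and>
     emeasure (tmeasure \<Lambda> k) {q} > 0}"

text \<open>For \<open>t = 0\<close> this keeps the leaves and has zero measure, so it is not itself a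
  \<^const>\<open>measured_lamination\<close> unless there are no leaves.\<close>

definition scale_lam :: "real \<Rightarrow> mlam \<Rightarrow> mlam" where
  "scale_lam t \<Lambda> = \<Lambda>\<lparr>tmeasure := \<lambda>k. scale_measure (ennreal t) (tmeasure \<Lambda> k)\<rparr>"

definition lam_invariant :: "mlam \<Rightarrow> (complex^2^2) set set \<Rightarrow> bool" where
  "lam_invariant \<Lambda> \<Gamma> \<longleftrightarrow> (\<forall>g\<in>\<Gamma>.
     (\<lambda>l. act g ` l) ` leaves \<Lambda> = leaves \<Lambda> \<and>
     (\<forall>k A. transverse_arc (leaves \<Lambda>) k \<and> A \<in> sets borel \<and> A \<subseteq> k \<longrightarrow>
        emeasure (tmeasure \<Lambda> (act g ` k)) (act g ` A) = emeasure (tmeasure \<Lambda> k) A))"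

definition acts_freely :: "(complex^2^2) set set \<Rightarrow> bool" where
  "acts_freely \<Gamma> \<longleftrightarrow> (\<forall>g\<in>\<Gamma>. \<forall>v\<in>H2. act g v = v \<longrightarrow> g = \<one>\<^bsub>PSL2C\<^esub>)"

definition acts_properly :: "(complex^2^2) set set \<Rightarrow> bool" where
  "acts_properly \<Gamma> \<longleftrightarrow> (\<forall>K. compact K \<and> K \<subseteq> H2 \<longrightarrow> finite {g \<in> \<Gamma>. act g ` K \<inter> K \<noteq> {}})"


section \<open>Cocycles\<close>

text \<open>The transverse measure on \<open>[x,y]\<close>. A segment that is not transverse is either a point or
  contained in a leaf; such a segment crosses nothing and gets measure zero.\<close>

definition seg_measure :: "mlam \<Rightarrow> real^3 \<Rightarrow> real^3 \<Rightarrow> (real^3) measure" where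
  "seg_measure \<Lambda> x y = (if transverse_arc (leaves \<Lambda>) (segment x y)
     then tmeasure \<Lambda> (segment x y) else null_measure borel)"

text \<open>The mass of a part of \<open>[x,y]\<close>, with atoms at \<open>x\<close> and \<open>y\<close> counted by half.\<close>

definition seg_mass :: "mlam \<Rightarrow> real^3 \<Rightarrow> real^3 \<Rightarrow> (real^3) set \<Rightarrow> real" where
  "seg_mass \<Lambda> x y A = measure (seg_measure \<Lambda> x y) A
     - measure (seg_measure \<Lambda> x y) (A \<inter> {x, y}) / 2"

definition subdivision :: "mlam \<Rightarrow> real^3 \<Rightarrow> real^3 \<Rightarrow> real list \<Rightarrow> bool" where
  "subdivision \<Lambda> x y ts \<longleftrightarrow> ts \<noteq> [] \<and> sorted_wrt (<) ts \<and> hd ts = 0 \<and> last ts = hdist x y \<and>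
     (\<forall>j. 0 < j \<and> j < length ts - 1 \<longrightarrow> geoseg x y (ts ! j) \<notin> weighted_part \<Lambda>)"

definition subinterval :: "real^3 \<Rightarrow> real^3 \<Rightarrow> real list \<Rightarrow> nat \<Rightarrow> (real^3) set" where
  "subinterval x y ts j = geoseg x y ` {ts ! j..ts ! Suc j}"

text \<open>For each \<open>j\<close> with positive mass, \<open>(p j, u j)\<close> is an oriented leaf meeting the \<open>j\<close>-th interval, with \<open>x\<close> on its
  left and \<open>y\<close> on its right. Both sides are closed, which settles the orientation also
  of a leaf that passes through \<open>x\<close> or \<open>y\<close>.\<close>

definition leaf_choice ::
    "mlam \<Rightarrow> real^3 \<Rightarrow> real^3 \<Rightarrow> real list \<Rightarrow> (nat \<Rightarrow> real^3) \<Rightarrow> (nat \<Rightarrow> real^3) \<Rightarrow> bool" where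
  "leaf_choice \<Lambda> x y ts p u \<longleftrightarrow>
     (\<forall>j < length ts - 1. seg_mass \<Lambda> x y (subinterval x y ts j) > 0 \<longrightarrow>
        unit_tangent (p j) (u j) \<and> range (geoline (p j) (u j)) \<in> leaves \<Lambda> \<and>
        range (geoline (p j) (u j)) \<inter> subinterval x y ts j \<noteq> {} \<and>
        side (p j) (u j) x \<ge> 0 \<and> side (p j) (u j) y \<le> 0)"

definition ordered_product ::
    "complex \<Rightarrow> mlam \<Rightarrow> real^3 \<Rightarrow> real^3 \<Rightarrow> real list \<Rightarrow> (nat \<Rightarrow> real^3) \<Rightarrow> (nat \<Rightarrow> real^3) \<Rightarrow> complex^2^2"
  where
  "ordered_product c \<Lambda> x y ts p u = foldr (**)
     (map (\<lambda>j. mexp (cscale (c * complex_of_real (seg_mass \<Lambda> x y (subinterval x y ts j)) / 2)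
                      (transl_gen (p j) (u j))))
        [0..<length ts - 1]) (mat 1)"

text \<open>\<open>E\<^bsub>c\<lambda>\<^esub>(x,y)\<close>. The limit is taken in \<open>PSL(2,\<complex>)\<close> with the quotient topology, in which the classes meeting
  the balls around \<open>B\<close> form a neighbourhood base at the class of \<open>B\<close>.\<close>

definition cocycle :: "complex \<Rightarrow> mlam \<Rightarrow> real^3 \<Rightarrow> real^3 \<Rightarrow> (complex^2^2) set" where
  "cocycle c \<Lambda> x y = (THE P. P \<in> carrier PSL2C \<and>
     (\<forall>B\<in>P. \<forall>\<epsilon>>0. \<exists>\<delta>>0. \<forall>ts p u.
        subdivision \<Lambda> x y ts \<and> (\<forall>j < length ts - 1. ts ! Suc j - ts ! j < \<delta>) \<and>
        leaf_choice \<Lambda> x y ts p u \<longrightarrow>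
        (\<exists>A \<in> psl (ordered_product c \<Lambda> x y ts p u). dist A B < \<epsilon>)))"

text \<open>The unit normal at \<open>q \<in> L\<close> to the leaf through \<open>q\<close>, pointing from \<open>x\<close> towards \<open>y\<close>; as a vector of
  \<open>\<real>\<^sup>3\<close> it is orthogonal to the whole plane spanned by the leaf.\<close>

definition leaf_normal :: "mlam \<Rightarrow> real^3 \<Rightarrow> real^3 \<Rightarrow> real^3 \<Rightarrow> real^3" where
  "leaf_normal \<Lambda> x y q = (THE v. mink v v = 1 \<and>
     (\<exists>l\<in>leaves \<Lambda>. q \<in> l \<and> (\<forall>w\<in>l. mink v w = 0)) \<and> mink v x \<le> 0 \<and> mink v y \<ge> 0)"

definition translation_part :: "mlam \<Rightarrow> real^3 \<Rightarrow> (complex^2^2) set \<Rightarrow> real^3" where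
  "translation_part \<Lambda> x\<^sub>0 \<gamma> =
     (LINT q : segment x\<^sub>0 (act \<gamma> x\<^sub>0) \<inter> lam_support \<Lambda> | seg_measure \<Lambda> x\<^sub>0 (act \<gamma> x\<^sub>0).
        leaf_normal \<Lambda> x\<^sub>0 (act \<gamma> x\<^sub>0) q)"


section \<open>Holonomies and spectra\<close>

definition hol :: "complex \<Rightarrow> mlam \<Rightarrow> real^3 \<Rightarrow> (complex^2^2) set \<Rightarrow> (complex^2^2) set" where
  "hol c \<Lambda> x\<^sub>0 \<gamma> = cocycle c \<Lambda> x\<^sub>0 (act \<gamma> x\<^sub>0) \<otimes>\<^bsub>PSL2C\<^esub> \<gamma>"

abbreviation hol_dS :: "mlam \<Rightarrow> real^3 \<Rightarrow> (complex^2^2) set \<Rightarrow> (complex^2^2) set" where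
  "hol_dS \<equiv> hol \<i>"

abbreviation hol_AdS_plus :: "mlam \<Rightarrow> real^3 \<Rightarrow> (complex^2^2) set \<Rightarrow> (complex^2^2) set" where
  "hol_AdS_plus \<equiv> hol 1"

abbreviation hol_AdS_minus :: "mlam \<Rightarrow> real^3 \<Rightarrow> (complex^2^2) set \<Rightarrow> (complex^2^2) set" where
  "hol_AdS_minus \<equiv> hol (- 1)"

text \<open>The spectra for \<open>\<kappa> \<in> {0, 1, - 1}\<close>, evaluated at a representative \<open>\<gamma>\<close> of the conjugacy class.\<close>

definition length_spectrum :: "int \<Rightarrow> mlam \<Rightarrow> real^3 \<Rightarrow> (complex^2^2) set \<Rightarrow> real" where
  "length_spectrum \<kappa> \<Lambda> x\<^sub>0 \<gamma> =
     (if \<kappa> = 0 then transl_length \<gamma>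
      else if \<kappa> = 1 then Re (complex_length (hol_dS \<Lambda> x\<^sub>0 \<gamma>))
      else (transl_length (hol_AdS_minus \<Lambda> x\<^sub>0 \<gamma>) + transl_length (hol_AdS_plus \<Lambda> x\<^sub>0 \<gamma>)) / 2)"

definition measure_spectrum :: "int \<Rightarrow> mlam \<Rightarrow> real^3 \<Rightarrow> (complex^2^2) set \<Rightarrow> real" where
  "measure_spectrum \<kappa> \<Lambda> x\<^sub>0 \<gamma> =
     (if \<kappa> = 0 then mink (axis_right_normal \<gamma>) (translation_part \<Lambda> x\<^sub>0 \<gamma>)
      else if \<kappa> = 1 then Im (complex_length (hol_dS \<Lambda> x\<^sub>0 \<gamma>))
      else (transl_length (hol_AdS_plus \<Lambda> x\<^sub>0 \<gamma>) - transl_length (hol_AdS_minus \<Lambda> x\<^sub>0 \<gamma>)) / 2)"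

end

theory Submission
  imports Defs
begin

text \<open>
  Lorentzian space is isomorphic to \<open>sl(2,\<real>)\<close> by the map \<open>genm\<close>, which sends the right unit normal of an
  oriented geodesic \<open>l\<close> to the generator \<open>X(l)\<close>, squares unit vectors to \<open>1\<close> and satisfies
  \<open>trace (genm a ** genm b) = 2 * mink a b\<close>. For a leaf oriented with \<open>x\<^sub>0\<close> on its left, the right normal is also the
  vector that \<open>\<tau>\<^sub>\<lambda>(\<gamma>)\<close> integrates. The linear parts of the ordered products that define the cocycle are therefore
  Riemann sums of \<open>\<tau>\<^sub>\<lambda>(\<gamma>)\<close>, and \<open>E\<^bsub>ct\<lambda>\<^esub>(x\<^sub>0, \<gamma>x\<^sub>0) = 1 + (ct/2) genm (\<tau>\<^sub>\<lambda>(\<gamma>)) + O(t\<^sup>2)\<close>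
  (\<open>holonomy_first_order\<close>).

  A hyperbolic \<open>\<gamma>\<close> of translation length \<open>\<ell>\<close> is represented by
  \<open>cosh (\<ell>/2) + sinh (\<ell>/2) genm n\<close>, where \<open>n\<close> is the right normal of its axis. Hence the trace of the
  holonomy is
  \<open>2 cosh (\<ell>/2) + ct sinh (\<ell>/2) mink n \<tau>\<^sub>\<lambda>(\<gamma>) + O(t\<^sup>2)\<close> (\<open>trace_derivative\<close>). Since the trace is
  \<open>2 cosh (z/2)\<close> for the complex length \<open>z\<close>, and for the translation length if the matrix is real, these lengths have
  the derivative \<open>c mink n \<tau>\<^sub>\<lambda>(\<gamma>)\<close> at \<open>t = 0\<close> (\<open>complex_length_derivative\<close>, \<open>transl_length_derivative\<close>). The
  theorem collects the cases \<open>c = \<i>\<close> and \<open>c = \<plusminus>1\<close>.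

  Most of the work lies in the existence of the limit that defines the cocycle. Leaves are disjoint, so their
  half-planes are nested along the segment \<open>[x\<^sub>0, \<gamma>x\<^sub>0]\<close> and their normals depend Lipschitz continuously on
  the crossing point (\<open>normals_close\<close>, \<open>\<nu>_estimates\<close>). Splitting an interval of a subdivision without changing
  its leaf does not change the product, so that two products can be compared factor by factor on a common
  refinement, and they form a Cauchy net (\<open>oprod_converges\<close>). The limit is unique only because subdivisions of
  every mesh exist whose interior points avoid the leaves with atoms. An interval of the segment covered by such
  leaves would be foliated, and the homotopy invariance of the transverse measure would move all their atoms into
  the segment, whose mass is finite (\<open>atom_transport\<close>).
\<close>

section \<open>Lorentzian linear algebra\<close>

lemma mink_commute: "mink v w = mink w v"
  by (simp add: mink_def mult.commute)

lemma mink_simps [simp]: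
  "mink (a + b) w = mink a w + mink b w" "mink w (a + b) = mink w a + mink w b"
  "mink (a - b) w = mink a w - mink b w" "mink w (a - b) = mink w a - mink w b"
  "mink (r *\<^sub>R a) w = r * mink a w" "mink w (r *\<^sub>R a) = r * mink w a"
  "mink (- a) w = - mink a w" "mink w (- a) = - mink w a"
  "mink 0 w = 0" "mink w 0 = 0"
  by (auto simp: mink_def algebra_simps)

lemma continuous_on_mink [continuous_intros]:
  "continuous_on S f \<Longrightarrow> continuous_on S g \<Longrightarrow> continuous_on S (\<lambda>x. mink (f x) (g x))"
  unfolding mink_def by (intro continuous_intros)

lemma norm_sq_3: "(norm (v :: real^3))\<^sup>2 = (v $ 1)\<^sup>2 + (v $ 2)\<^sup>2 + (v $ 3)\<^sup>2"
  by (simp add: norm_vec_def L2_set_def sum_3)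

lemma abs_mink_le: "\<bar>mink v w\<bar> \<le> norm v * norm w"
proof -
  let ?v' = "vector [- (v $ 1), v $ 2, v $ 3] :: real^3"
  have "norm ?v' = norm v"
    by (simp add: norm_vec_def L2_set_def sum_3)
  moreover have "mink v w = ?v' \<bullet> w"
    by (simp add: mink_def inner_vec_def sum_3)
  ultimately show ?thesis
    using Cauchy_Schwarz_ineq2[of ?v' w] by simp
qed

lemma H2D: "p \<in> H2 \<Longrightarrow> mink p p = -1" "p \<in> H2 \<Longrightarrow> p $ 1 > 0"
  by (auto simp: H2_def)

text \<open>The Lorentzian form is positive definite on the tangent plane at \<open>p\<close>; this compares it with the
  Euclidean norm.\<close>

lemma tangent_norm:
  assumes "p \<in> H2" "mink p w = 0"
  shows "(norm w)\<^sup>2 \<le> (2 * (p $ 1)\<^sup>2 - 1) * mink w w"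
proof -
  have p: "(p $ 1)\<^sup>2 = 1 + (p $ 2)\<^sup>2 + (p $ 3)\<^sup>2"
    using H2D[OF assms(1)] by (simp add: mink_def power2_eq_square)
  have e: "p $ 1 * w $ 1 = p $ 2 * w $ 2 + p $ 3 * w $ 3"
    using assms by (simp add: mink_def)
  have "(p $ 1 * w $ 1)\<^sup>2 \<le> ((p $ 2)\<^sup>2 + (p $ 3)\<^sup>2) * ((w $ 2)\<^sup>2 + (w $ 3)\<^sup>2)"
    unfolding e using zero_le_power2[of "p $ 2 * w $ 3 - p $ 3 * w $ 2"]
    by (simp add: power2_eq_square algebra_simps)
  also have "\<dots> = ((p $ 1)\<^sup>2 - 1) * (mink w w + (w $ 1)\<^sup>2)"
    using p by (simp add: mink_def power2_eq_square algebra_simps)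
  finally have "(w $ 1)\<^sup>2 \<le> ((p $ 1)\<^sup>2 - 1) * mink w w"
    by (simp add: power2_eq_square algebra_simps)
  moreover have "(norm w)\<^sup>2 = mink w w + 2 * (w $ 1)\<^sup>2"
    unfolding norm_sq_3 by (simp add: mink_def power2_eq_square)
  ultimately show ?thesis by (simp add: algebra_simps)
qed

lemma H2_1_ge: "p \<in> H2 \<Longrightarrow> p $ 1 \<ge> 1"
proof -
  assume "p \<in> H2"
  then have "(p $ 1)\<^sup>2 = 1 + (p $ 2)\<^sup>2 + (p $ 3)\<^sup>2" "p $ 1 > 0"
    by (auto simp: mink_def power2_eq_square H2_def)
  then have "(p $ 1)\<^sup>2 \<ge> 1\<^sup>2" by simp
  then show ?thesis using \<open>p $ 1 > 0\<close> by (metis power2_le_imp_le less_imp_le)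
qed

lemma tangent_pos:
  assumes "p \<in> H2" "mink p w = 0"
  shows "mink w w \<ge> 0" "mink w w = 0 \<Longrightarrow> w = 0"
proof -
  have "(p $ 1)\<^sup>2 \<ge> 1" using H2_1_ge[OF assms(1)] by (simp add: one_le_power)
  then have c: "2 * (p $ 1)\<^sup>2 - 1 > 0" by simp
  show "mink w w \<ge> 0"
    using tangent_norm[OF assms] c by (meson order_trans zero_le_mult_iff zero_le_power2 not_le)
  show "w = 0" if "mink w w = 0"
    using tangent_norm[OF assms] that by simp
qed

text \<open>The orthogonal complement of a point of the hyperboloid is spacelike, so that the pairing with a
  nonzero causal vector never vanishes on the connected set \<open>H2\<close> and keeps its sign.\<close>

lemma causal_neg:
  assumes "mink v v \<le> 0" "p \<in> H2" "mink v p < 0" "q \<in> H2"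
  shows "mink v q < 0"
proof -
  have sq: "(mink v z + v $ 1 * z $ 1)\<^sup>2 \<le> (v $ 1)\<^sup>2 * ((z $ 1)\<^sup>2 - 1)" if "z \<in> H2" for z
  proof -
    have "(mink v z + v $ 1 * z $ 1)\<^sup>2 \<le> ((v $ 2)\<^sup>2 + (v $ 3)\<^sup>2) * ((z $ 2)\<^sup>2 + (z $ 3)\<^sup>2)"
      using zero_le_power2[of "v $ 2 * z $ 3 - v $ 3 * z $ 2"]
      by (simp add: power2_eq_square algebra_simps mink_def)
    also have "\<dots> \<le> (v $ 1)\<^sup>2 * ((z $ 2)\<^sup>2 + (z $ 3)\<^sup>2)"
      using assms(1) by (intro mult_right_mono) (auto simp: mink_def power2_eq_square)
    also have "(z $ 2)\<^sup>2 + (z $ 3)\<^sup>2 = (z $ 1)\<^sup>2 - 1"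
      using H2D[OF that] by (simp add: mink_def power2_eq_square)
    finally show ?thesis .
  qed
  have key: "\<bar>mink v z + v $ 1 * z $ 1\<bar> < \<bar>v $ 1\<bar> * z $ 1" if "z \<in> H2" "v $ 1 \<noteq> 0" for z
  proof -
    have "(mink v z + v $ 1 * z $ 1)\<^sup>2 < (\<bar>v $ 1\<bar> * z $ 1)\<^sup>2"
      using sq[OF that(1)] that(2) by (simp add: power_mult_distrib algebra_simps)
        (smt (verit) zero_less_power2)
    then show ?thesis
      by (metis H2D(2) abs_ge_zero less_imp_le mult_nonneg_nonneg power2_abs power_less_imp_less_base that(1))
  qed
  have v1: "v $ 1 \<noteq> 0"
  proof
    assume 0: "v $ 1 = 0"
    then have "(mink v p)\<^sup>2 \<le> 0" using sq[OF assms(2)] by simp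
    then show False using assms(3) by simp
  qed
  have "v $ 1 > 0"
  proof (rule ccontr)
    assume "\<not> v $ 1 > 0"
    then show False using key[OF assms(2) v1] assms(3) by (simp add: abs_if split: if_splits)
  qed
  then show ?thesis using key[OF assms(4) v1] by (simp only: abs_less_iff) simp
qed

lemma mink_H2_le:
  assumes "p \<in> H2" "q \<in> H2"
  shows "mink p q \<le> -1"
proof -
  have neg: "mink p q < 0"
    by (rule causal_neg[OF _ assms(1) _ assms(2)]) (auto simp: H2D[OF assms(1)])
  let ?w = "q + mink p q *\<^sub>R p"
  have "mink p ?w = 0" by (simp add: H2D[OF assms(1)])
  from tangent_pos(1)[OF assms(1) this]
  have "(mink p q)\<^sup>2 \<ge> 1\<^sup>2"
    by (simp add: H2D[OF assms(1)] H2D[OF assms(2)] mink_commute[of q p] power2_eq_square)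
  then have "1 \<le> \<bar>mink p q\<bar>" by (simp only: abs_le_square_iff[symmetric])
  then show ?thesis using neg by simp
qed

lemma mink_H2_eq:
  assumes "p \<in> H2" "q \<in> H2" "mink p q = -1"
  shows "p = q"
proof -
  let ?w = "q + mink p q *\<^sub>R p"
  have "mink p ?w = 0" by (simp add: H2D[OF assms(1)])
  from tangent_pos(2)[OF assms(1) this]
  show ?thesis by (simp add: H2D[OF assms(1)] H2D[OF assms(2)] assms(3) mink_commute[of q p])
qed

text \<open>The Lorentzian cross product, with the sign for which \<open>lcross p u\<close> points to the right of the oriented
  geodesic through the unit tangent vector \<open>(p, u)\<close>.\<close>

definition lcross :: "real^3 \<Rightarrow> real^3 \<Rightarrow> real^3" where
  "lcross a b = vector [a $ 2 * b $ 3 - a $ 3 * b $ 2,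
                        a $ 1 * b $ 3 - a $ 3 * b $ 1,
                        a $ 2 * b $ 1 - a $ 1 * b $ 2]"

lemma lcross_nth [simp]:
  "lcross a b $ 1 = a $ 2 * b $ 3 - a $ 3 * b $ 2"
  "lcross a b $ 2 = a $ 1 * b $ 3 - a $ 3 * b $ 1"
  "lcross a b $ 3 = a $ 2 * b $ 1 - a $ 1 * b $ 2"
  by (simp_all add: lcross_def)

lemma mink_lcross_lcross: "mink (lcross a b) (lcross a b) = (mink a b)\<^sup>2 - mink a a * mink b b"
  by (simp add: mink_def power2_eq_square algebra_simps)

lemma mink_lcross [simp]:
  "mink (lcross a b) a = 0" "mink (lcross a b) b = 0" "mink a (lcross a b) = 0" "mink b (lcross a b) = 0"
  by (simp_all add: mink_def algebra_simps)

lemma lcross_lcross: "lcross a (lcross a b) = mink a a *\<^sub>R b - mink a b *\<^sub>R a"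
  by (simp add: vec_eq_iff forall_3 mink_def algebra_simps)

lemma side_eq: "side p u q = - mink (lcross p u) q"
  by (simp add: side_def det_3 mink_def algebra_simps)

lemma unit_tangentD:
  "unit_tangent p u \<Longrightarrow> p \<in> H2" "unit_tangent p u \<Longrightarrow> mink p p = -1"
  "unit_tangent p u \<Longrightarrow> mink p u = 0" "unit_tangent p u \<Longrightarrow> mink u p = 0" "unit_tangent p u \<Longrightarrow> mink u u = 1"
  by (auto simp: unit_tangent_def H2_def mink_commute)

lemma lcross_unit: "unit_tangent p u \<Longrightarrow> mink (lcross p u) (lcross p u) = 1"
  by (simp add: mink_lcross_lcross unit_tangentD)

lemma lcross_normal_frame:
  assumes "unit_tangent p u"
  shows "lcross (lcross p u) p = u" "lcross (lcross p u) u = p"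
proof -
  have 1: "lcross (lcross a b) c = mink b c *\<^sub>R a - mink a c *\<^sub>R b" for a b c
    by (simp add: vec_eq_iff forall_3 mink_def algebra_simps)
  show "lcross (lcross p u) p = u" "lcross (lcross p u) u = p"
    by (simp_all add: 1 unit_tangentD[OF assms])
qed

lemma unit_tangent_of_normal:
  assumes "mink n n = 1" "p \<in> H2" "mink n p = 0"
  shows "unit_tangent p (lcross n p)" "lcross p (lcross n p) = n"
proof -
  have "mink (lcross n p) (lcross n p) = 1"
    using assms by (simp add: mink_lcross_lcross H2D)
  then show "unit_tangent p (lcross n p)" using assms by (simp add: unit_tangent_def)
  have "lcross a (lcross b a) = mink a b *\<^sub>R a - mink a a *\<^sub>R b" for a b
    by (simp add: vec_eq_iff forall_3 mink_def algebra_simps)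
  then show "lcross p (lcross n p) = n"
    using assms by (simp add: H2D mink_commute[of p n])
qed

text \<open>The remainder of the expansion is orthogonal to the frame; a vector orthogonal to \<open>p\<close> and \<open>u\<close> has zero
  cross product with their normal, hence is a multiple of it.\<close>

lemma frame_expansion:
  assumes "unit_tangent p u"
  shows "q = (- mink q p) *\<^sub>R p + mink q u *\<^sub>R u + mink q (lcross p u) *\<^sub>R lcross p u"
proof -
  define n where "n = lcross p u"
  define r where "r = q + mink q p *\<^sub>R p - mink q u *\<^sub>R u - mink q n *\<^sub>R n"
  have n: "mink n n = 1" "mink n p = 0" "mink n u = 0" "mink p n = 0" "mink u n = 0"
    using lcross_unit[OF assms] by (simp_all add: n_def)
  have r: "mink p r = 0" "mink u r = 0" "mink n r = 0"
    by (simp_all add: r_def unit_tangentD[OF assms] n mink_commute[of _ q])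
  have "lcross n r = mink u r *\<^sub>R p - mink p r *\<^sub>R u"
    by (simp add: n_def vec_eq_iff forall_3 mink_def algebra_simps)
  then have "lcross n (lcross n r) = 0" using r by (simp add: vec_eq_iff forall_3)
  then have "r = 0" using n r by (simp add: lcross_lcross)
  then show ?thesis by (simp add: r_def n_def algebra_simps)
qed

lemma geoline_H2:
  assumes "unit_tangent p u"
  shows "geoline p u s \<in> H2"
proof -
  have e: "mink (geoline p u s) (geoline p u s) = -1"
    using cosh_square_eq[of s] by (simp add: geoline_def unit_tangentD[OF assms] power2_eq_square)
  have p: "mink p (geoline p u s) \<le> -1"
    using cosh_real_ge_1 by (simp add: geoline_def unit_tangentD[OF assms])
  have "geoline p u s $ 1 > 0"
  proof (rule ccontr)
    assume "\<not> geoline p u s $ 1 > 0"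
    moreover have "geoline p u s $ 1 \<noteq> 0"
      using e by (auto simp: mink_def) (smt (verit) zero_le_square)
    ultimately have "- geoline p u s \<in> H2" using e by (simp add: H2_def)
    from mink_H2_le[OF unit_tangentD(1)[OF assms] this] p show False by simp
  qed
  then show ?thesis using e by (simp add: H2_def)
qed

section \<open>Geodesics and their unit normals\<close>

text \<open>A geodesic is the intersection of \<open>H2\<close> with the plane orthogonal to a spacelike unit vector, which is unique
  up to sign. Fixing the sign orients the geodesic, so that questions about leaves become
  inequalities between products of normals.\<close>

definition geod :: "real^3 \<Rightarrow> (real^3) set" where
  "geod n = {q \<in> H2. mink n q = 0}"

lemma range_geoline: 
  assumes "unit_tangent p u"
  shows "range (geoline p u) = geod (lcross p u)"
proof
  show "range (geoline p u) \<subseteq> geod (lcross p u)"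
    using geoline_H2[OF assms] by (auto simp: geod_def) (simp add: geoline_def)
  show "geod (lcross p u) \<subseteq> range (geoline p u)"
  proof
    fix q assume "q \<in> geod (lcross p u)"
    then have q: "q \<in> H2" "mink q (lcross p u) = 0" by (auto simp: geod_def mink_commute)
    have e: "q = (- mink q p) *\<^sub>R p + mink q u *\<^sub>R u"
      using frame_expansion[OF assms, of q] q by simp
    have "-1 = mink q ((- mink q p) *\<^sub>R p + mink q u *\<^sub>R u)"
      using H2D(1)[OF q(1)] e by simp
    then have eq: "(- mink q p)\<^sup>2 = (mink q u)\<^sup>2 + 1" by (simp add: power2_eq_square)
    define s where "s = arsinh (mink q u)"
    have s: "sinh s = mink q u" by (simp add: s_def)
    have "(cosh s)\<^sup>2 = (- mink q p)\<^sup>2" using cosh_square_eq[of s] s eq by simp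
    moreover have "- mink q p \<ge> 0" using mink_H2_le[OF q(1) unit_tangentD(1)[OF assms]] by simp
    ultimately have "cosh s = - mink q p"
      by (metis cosh_real_nonneg power2_eq_iff_nonneg)
    then have "q = geoline p u s" using e s by (simp add: geoline_def)
    then show "q \<in> range (geoline p u)" by blast
  qed
qed

lemma exists_point_of_normal:
  assumes "mink n n = 1"
  shows "\<exists>p\<in>H2. mink n p = 0"
proof -
  define h where "h = sqrt ((n $ 2)\<^sup>2 + (n $ 3)\<^sup>2)"
  have h2: "h\<^sup>2 = 1 + (n $ 1)\<^sup>2" "h\<^sup>2 = (n $ 2)\<^sup>2 + (n $ 3)\<^sup>2"
    using assms by (auto simp: h_def mink_def power2_eq_square)
  have h: "h > 0" using h2(1) by (auto simp: h_def) (smt (verit) real_sqrt_gt_zero zero_le_power2 h_def)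
  \<comment> \<open>the point of the geodesic closest to the base point \<open>(1, 0, 0)\<close>\<close>
  define p :: "real^3" where "p = vector [h, n $ 1 * n $ 2 / h, n $ 1 * n $ 3 / h]"
  have "mink n p * h = 0"
    using h h2(2) by (simp add: mink_def p_def power2_eq_square field_simps)
       (metis (no_types, opaque_lifting) distrib_left mult.commute mult.left_commute mult.assoc)
  have "mink p p * h\<^sup>2 = - (h\<^sup>2)"
  proof -
    have "mink p p * h\<^sup>2 = - (h\<^sup>2 * h\<^sup>2) + (n $ 1)\<^sup>2 * ((n $ 2)\<^sup>2 + (n $ 3)\<^sup>2)"
      using h by (simp add: mink_def p_def power2_eq_square field_simps)
    also have "\<dots> = - (h\<^sup>2)" unfolding h2(2)[symmetric] using h2(1) by (simp add: algebra_simps)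
    finally show ?thesis .
  qed
  then have "mink p p * h\<^sup>2 = (-1) * h\<^sup>2" by simp
  then have "mink p p = -1" using h by (simp only: mult_cancel_right) simp
  moreover have "mink n p = 0" using \<open>mink n p * h = 0\<close> h by simp
  ultimately have "mink n p = 0" "mink p p = -1" by auto
  then show ?thesis using h by (intro bexI[of _ p]) (auto simp: H2_def p_def)
qed

lemma complete_geodesic_iff: "complete_geodesic l \<longleftrightarrow> (\<exists>n. mink n n = 1 \<and> l = geod n)"
proof
  assume "complete_geodesic l"
  then show "\<exists>n. mink n n = 1 \<and> l = geod n"
    unfolding complete_geodesic_def using range_geoline lcross_unit by blast
next
  assume "\<exists>n. mink n n = 1 \<and> l = geod n"
  then obtain n where n: "mink n n = 1" "l = geod n" by blast
  obtain p where "p \<in> H2" "mink n p = 0" using exists_point_of_normal[OF n(1)] by blast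
  from unit_tangent_of_normal[OF n(1) this]
  show "complete_geodesic l"
    unfolding complete_geodesic_def using range_geoline n(2) by metis
qed

text \<open>The plane spanned by the two normals is spacelike, so their cross product is timelike and
  normalizes to a common point of the two geodesics.\<close>

lemma geod_crossing:
  assumes "mink n n = 1" "mink m m = 1" "\<bar>mink n m\<bar> < 1"
  shows "geod n \<inter> geod m \<noteq> {}"
proof -
  define z where "z = lcross n m"
  have neg: "mink z z < 0"
    using assms by (simp add: z_def mink_lcross_lcross power2_eq_square)
      (metis abs_square_less_1 power2_eq_square)
  define k where "k = sqrt (- mink z z)"
  have k: "k > 0" "k * k = - mink z z" using neg by (auto simp: k_def)
  define w where "w = (if z $ 1 > 0 then 1 / k else - 1 / k) *\<^sub>R z"
  have "mink w w = -1" using k neg by (simp add: w_def field_simps)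
  moreover have "z $ 1 \<noteq> 0"
    using neg by (auto simp: mink_def) (smt (verit) zero_le_square)
  then have "w $ 1 > 0" using k by (auto simp: w_def divide_simps)
  ultimately have "w \<in> H2" by (simp add: H2_def)
  moreover have "mink n w = 0" "mink m w = 0" by (simp_all add: w_def z_def)
  ultimately show ?thesis by (auto simp: geod_def)
qed

text \<open>Two disjoint geodesics that are cooriented so that both normals point away from \<open>x\<close> and
  towards \<open>y\<close> bound nested half-planes. If the product of the normals were at most \<open>-1\<close>, their sum would be
  causal and so could not change sign between \<open>x\<close> and \<open>y\<close>.\<close>

lemma cooriented_ge_1:
  assumes "mink n n = 1" "mink m m = 1" "geod n \<inter> geod m = {}"
    and "x \<in> H2" "y \<in> H2"
    and "mink n x \<le> 0" "mink n y \<ge> 0" "mink m x \<le> 0" "mink m y \<ge> 0"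
    and "mink n x < 0 \<or> mink n y > 0"
  shows "mink n m \<ge> 1"
proof (rule ccontr)
  assume "\<not> mink n m \<ge> 1"
  then have le: "mink n m \<le> -1" using geod_crossing[OF assms(1,2)] assms(3) by linarith
  then have c: "mink (n + m) (n + m) \<le> 0" "mink (- (n + m)) (- (n + m)) \<le> 0"
    using assms(1,2) by (auto simp: mink_commute[of m n])
  have "mink (n + m) x < 0 \<or> mink (- (n + m)) y < 0" using assms by auto
  then have "mink (n + m) y < 0 \<or> mink (- (n + m)) x < 0"
    using causal_neg[OF c(1) assms(4) _ assms(5)] causal_neg[OF c(2) assms(5) _ assms(4)] by blast
  then show False using assms by auto
qed

text \<open>For nested half-planes as above, the normal depends Lipschitz continuously on the point where the
  geodesic crosses a fixed arc: up to a small timelike part, both normals are unit vectors in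
  the same Euclidean plane, with inner product at least \<open>1\<close>.\<close>

lemma normals_close:
  assumes "mink n n = 1" "mink m m = 1" "mink n m \<ge> 1" "q \<in> H2" "mink n q = 0"
  shows "norm (m - n) \<le> 3 * (q $ 1 + norm q) * \<bar>mink m q\<bar>"
proof -
  define b where "b = - mink m q"
  define w where "w = m - b *\<^sub>R q"
  have q: "mink q q = -1" "q $ 1 \<ge> 1" using H2D H2_1_ge assms(4) by auto
  have qn: "mink q n = 0" using assms(5) by (simp add: mink_commute)
  have wq: "mink q w = 0" "mink q (w - n) = 0"
    by (simp_all add: w_def b_def q qn mink_commute[of q m])
  have "mink (w - n) (w - n) = 2 + b\<^sup>2 - 2 * mink n m"
    using assms by (simp add: w_def b_def q qn mink_commute[of q m] mink_commute[of m n] power2_eq_square algebra_simps)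
  then have le: "mink (w - n) (w - n) \<le> b\<^sup>2" using assms(3) by simp
  have "(norm (w - n))\<^sup>2 \<le> (2 * (q $ 1)\<^sup>2 - 1) * mink (w - n) (w - n)"
    by (rule tangent_norm[OF assms(4) wq(2)])
  also have "\<dots> \<le> (3 * q $ 1)\<^sup>2 * b\<^sup>2"
  proof (intro mult_mono le)
    show "2 * (q $ 1)\<^sup>2 - 1 \<le> (3 * q $ 1)\<^sup>2"
    proof -
      have "(3 * q $ 1)\<^sup>2 = 9 * (q $ 1)\<^sup>2" by (simp add: power_mult_distrib)
      then show ?thesis using zero_le_power2[of "q $ 1"] by linarith
    qed
    show "0 \<le> mink (w - n) (w - n)" by (rule tangent_pos(1)[OF assms(4) wq(2)])
  qed simp
  finally have "norm (w - n) \<le> 3 * q $ 1 * \<bar>b\<bar>"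
    using q by (auto intro: power2_le_imp_le[where y = "3 * q $ 1 * \<bar>b\<bar>"] simp: power_mult_distrib)
  moreover have "m - n = (w - n) + b *\<^sub>R q" by (simp add: w_def)
  then have "norm (m - n) \<le> norm (w - n) + norm (b *\<^sub>R q)" by (metis norm_triangle_ineq)
  moreover have "norm (b *\<^sub>R q) \<le> 3 * norm q * \<bar>b\<bar>" by simp
  moreover have "3 * (q $ 1 + norm q) * \<bar>mink m q\<bar> = 3 * q $ 1 * \<bar>b\<bar> + 3 * norm q * \<bar>b\<bar>"
    by (simp add: algebra_simps b_def)
  ultimately show ?thesis by linarith
qed

section \<open>Geodesic segments\<close>

locale seg =
  fixes x y :: "real^3"
  assumes xH: "x \<in> H2" and yH: "y \<in> H2" and xy: "x \<noteq> y"
begin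

abbreviation d where "d \<equiv> hdist x y"
abbreviation \<sigma> where "\<sigma> \<equiv> geoseg x y"

definition dir where "dir = (1 / sinh d) *\<^sub>R (y - cosh d *\<^sub>R x)"

lemma mink_lt: "mink x y < -1"
  using mink_H2_le[OF xH yH] mink_H2_eq[OF xH yH] xy by fastforce

lemma d_pos: "d > 0"
  unfolding hdist_def using mink_lt by (simp add: arcosh_real_gt_1_iff)

lemma cosh_d: "cosh d = - mink x y"
  unfolding hdist_def using mink_lt by (intro cosh_arcosh_real) simp

lemma sinh_d: "sinh d > 0" using d_pos by simp

lemma dir_unit: "unit_tangent x dir"
proof -
  have "mink (y - cosh d *\<^sub>R x) (y - cosh d *\<^sub>R x) = sinh d * sinh d"
    using cosh_d sinh_square_eq[of d]
    by (simp add: H2D[OF xH] H2D[OF yH] mink_commute[of y x] power2_eq_square)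
  then have "mink dir dir = 1" using sinh_d unfolding dir_def mink_simps(5,6) by simp
  moreover have "mink x dir = 0" using cosh_d by (simp add: dir_def H2D[OF xH])
  ultimately show ?thesis using xH by (simp add: unit_tangent_def)
qed

lemma geoseg_eq: "\<sigma> s = geoline x dir s"
  by (simp add: geoseg_def dir_def Let_def)

lemma \<sigma>_0 [simp]: "\<sigma> 0 = x" by (simp add: geoseg_eq geoline_def)

lemma \<sigma>_d [simp]: "\<sigma> d = y" using sinh_d by (simp add: geoseg_eq geoline_def dir_def)

lemma \<sigma>_H2 [simp]: "\<sigma> s \<in> H2" by (simp add: geoseg_eq geoline_H2[OF dir_unit])

lemma continuous_\<sigma> [continuous_intros]: "continuous_on S f \<Longrightarrow> continuous_on S (\<lambda>s. \<sigma> (f s))"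
  unfolding geoseg_eq geoline_def by (intro continuous_intros)

lemma \<sigma>_inj: "inj \<sigma>"
proof
  fix s t assume "\<sigma> s = \<sigma> t"
  then have "mink dir (\<sigma> s) = mink dir (\<sigma> t)" by simp
  then show "s = t" by (simp add: geoseg_eq geoline_def unit_tangentD[OF dir_unit])
qed

lemma segment_eq: "segment x y = \<sigma> ` {0..d}" by (simp add: segment_def)

lemma compact_segment: "compact (segment x y)"
  unfolding segment_eq by (intro compact_continuous_image continuous_intros) auto

lemma \<sigma>_lipschitz: "\<exists>C>0. \<forall>s\<in>{0..d}. \<forall>t\<in>{0..d}. norm (\<sigma> s - \<sigma> t) \<le> C * \<bar>s - t\<bar>"
proof -
  have der: "(\<sigma> has_vector_derivative sinh r *\<^sub>R x + cosh r *\<^sub>R dir) (at r within {0..d})" for r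
    unfolding geoseg_eq[abs_def] geoline_def
    by (auto intro!: derivative_eq_intros simp: has_vector_derivative_def scaleR_add_right ac_simps)
  define C where "C = sinh d * norm x + cosh d * norm dir + 1"
  have C: "C > 0" using sinh_d cosh_real_pos[of d] by (simp add: C_def add_nonneg_pos)
  have bd: "norm (sinh r *\<^sub>R x + cosh r *\<^sub>R dir) \<le> C" if "r \<in> {0..d}" for r
  proof -
    have "norm (sinh r *\<^sub>R x + cosh r *\<^sub>R dir) \<le> \<bar>sinh r\<bar> * norm x + \<bar>cosh r\<bar> * norm dir"
      by (metis norm_scaleR norm_triangle_ineq)
    also have "\<dots> \<le> sinh d * norm x + cosh d * norm dir"
      using that by (intro add_mono mult_right_mono) (auto simp: cosh_real_nonneg_le_iff)
    finally show ?thesis by (simp add: C_def)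
  qed
  have "norm (\<sigma> s - \<sigma> t) \<le> C * \<bar>s - t\<bar>" if "s \<in> {0..d}" "t \<in> {0..d}" for s t
    using differentiable_bound[of "{0..d}" \<sigma> "\<lambda>r h. h *\<^sub>R (sinh r *\<^sub>R x + cosh r *\<^sub>R dir)" C s t] 
      der bd that
    by (auto simp: has_vector_derivative_def onorm_scaleR_left onorm_id intro!: onorm_le)
  then show ?thesis using C by blast
qed

text \<open>Along a unit speed geodesic every linear form solves \<open>f'' = f\<close>, and a solution is determined by a zero and
  the slope there.\<close>

lemma mink_\<sigma>:
  assumes "mink n (\<sigma> r) = 0"
  shows "mink n (\<sigma> s) = (sinh r * mink n x + cosh r * mink n dir) * sinh (s - r)"
proof -
  let ?A = "mink n x" and ?B = "mink n dir"
  have 0: "cosh r * ?A + sinh r * ?B = 0" using assms by (simp add: geoseg_eq geoline_def)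
  have c: "(cosh r)\<^sup>2 = (sinh r)\<^sup>2 + 1" by (rule cosh_square_eq)
  have "(sinh r * ?A + cosh r * ?B) * (sinh s * cosh r - cosh s * sinh r)
      = cosh s * ?A + sinh s * ?B"
    using 0 c unfolding power2_eq_square by algebra
  then show ?thesis by (simp add: geoseg_eq geoline_def sinh_diff)
qed

end

section \<open>Two by two matrices\<close>

lemma mat2_eqI:
  fixes A B :: "'a^2^2"
  shows "A $ 1 $ 1 = B $ 1 $ 1 \<Longrightarrow> A $ 1 $ 2 = B $ 1 $ 2 \<Longrightarrow> A $ 2 $ 1 = B $ 2 $ 1 \<Longrightarrow> A $ 2 $ 2 = B $ 2 $ 2 \<Longrightarrow> A = B"
  by (simp add: vec_eq_iff forall_2)

lemma mat2_nth [simp]: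
  fixes A B :: "'a::comm_ring_1^2^2"
  shows "(A ** B) $ i $ j = A $ i $ 1 * B $ 1 $ j + A $ i $ 2 * B $ 2 $ j"
    "(mat 1 :: 'a^2^2) $ 1 $ 1 = 1" "(mat 1 :: 'a^2^2) $ 1 $ 2 = 0"
    "(mat 1 :: 'a^2^2) $ 2 $ 1 = 0" "(mat 1 :: 'a^2^2) $ 2 $ 2 = 1"
    "transpose A $ i $ j = A $ j $ i"
  by (auto simp: matrix_matrix_mult_def sum_2 mat_def transpose_def)

lemma cscale_nth [simp]: "cscale c A $ i $ j = c * A $ i $ j"
  by (simp add: cscale_def)

lemma real_entriesI:
  "A $ 1 $ 1 \<in> \<real> \<Longrightarrow> A $ 1 $ 2 \<in> \<real> \<Longrightarrow> A $ 2 $ 1 \<in> \<real> \<Longrightarrow> A $ 2 $ 2 \<in> \<real> \<Longrightarrow> real_entries A"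
  by (simp add: real_entries_def forall_2)

lemma real_entriesD: "real_entries A \<Longrightarrow> A $ i $ j \<in> \<real>"
  by (simp add: real_entries_def)

lemma real_entries_mult: "real_entries A \<Longrightarrow> real_entries B \<Longrightarrow> real_entries (A ** B)"
  by (simp add: real_entries_def)

lemma real_entries_mat_1: "real_entries (mat 1)"
  by (rule real_entriesI) auto

lemma trace_2: "trace (A :: 'a::comm_ring_1^2^2) = A $ 1 $ 1 + A $ 2 $ 2"
  by (simp add: trace_def sum_2)

definition adj2 :: "complex^2^2 \<Rightarrow> complex^2^2" where
  "adj2 A = vector [vector [A $ 2 $ 2, - A $ 1 $ 2], vector [- A $ 2 $ 1, A $ 1 $ 1]]"

lemma adj2_nth [simp]:
  "adj2 A $ 1 $ 1 = A $ 2 $ 2" "adj2 A $ 1 $ 2 = - A $ 1 $ 2"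
  "adj2 A $ 2 $ 1 = - A $ 2 $ 1" "adj2 A $ 2 $ 2 = A $ 1 $ 1"
  by (simp_all add: adj2_def)

lemma adj2_mult: "adj2 (A ** B) = adj2 B ** adj2 A"
  by (rule mat2_eqI) (simp_all add: algebra_simps)

lemma mult_adj2: "det A = 1 \<Longrightarrow> A ** adj2 A = mat 1" "det A = 1 \<Longrightarrow> adj2 A ** A = mat 1"
  by (auto intro!: mat2_eqI simp: det_2 algebra_simps)

lemma det_adj2: "det (adj2 A) = det A"
  by (simp add: det_2 algebra_simps)

lemma real_entries_adj2: "real_entries A \<Longrightarrow> real_entries (adj2 A)"
  by (rule real_entriesI) (auto simp: real_entriesD)

section \<open>The projective groups\<close>

lemma SL2C_simps [simp]:
  "carrier SL2C = {A. det A = 1}" "A \<otimes>\<^bsub>SL2C\<^esub> B = A ** B" "\<one>\<^bsub>SL2C\<^esub> = mat 1"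
  by (simp_all add: SL2C_def)

lemma group_SL2C: "group SL2C"
proof (rule groupI)
  fix A assume "A \<in> carrier SL2C"
  then show "\<exists>B\<in>carrier SL2C. B \<otimes>\<^bsub>SL2C\<^esub> A = \<one>\<^bsub>SL2C\<^esub>"
    by (intro bexI[of _ "adj2 A"]) (auto simp: mult_adj2 det_adj2)
qed (auto simp: det_mul matrix_mul_assoc det_I)

lemma minus_mat_mult:
  fixes A B :: "complex^2^2"
  shows "(- A) ** B = - (A ** B)" "A ** (- B) = - (A ** B)"
  by (intro mat2_eqI; simp)+

lemma inv_SL2C: "det A = 1 \<Longrightarrow> inv\<^bsub>SL2C\<^esub> A = adj2 A"
  by (rule group.inv_equality[OF group_SL2C]) (auto simp: mult_adj2 det_adj2)

lemma det_uminus_2: "det (- A :: complex^2^2) = det A"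
  by (simp add: det_2)

lemma normal_center: "{mat 1, - mat 1} \<lhd> SL2C"
proof -
  interpret group SL2C by (rule group_SL2C)
  have "subgroup {mat 1, - mat 1} SL2C"
    by (rule subgroupI) (auto simp: det_uminus_2 inv_SL2C minus_mat_mult intro!: mat2_eqI)
  then show ?thesis
    by (rule normal_invI) (auto simp: inv_SL2C mult_adj2 minus_mat_mult)
qed

lemma psl_eq: "psl A = {A, - A}"
  by (auto simp: psl_def r_coset_def minus_mat_mult)

lemma group_PSL2C: "group PSL2C"
  unfolding PSL2C_def by (rule normal.factorgroup_is_group[OF normal_center])

lemma carrier_PSL2C: "carrier PSL2C = {psl A | A. det A = 1}"
  by (auto simp: PSL2C_def FactGroup_def RCOSETS_def psl_def)

lemma psl_mult: "det A = 1 \<Longrightarrow> det B = 1 \<Longrightarrow> psl A \<otimes>\<^bsub>PSL2C\<^esub> psl B = psl (A ** B)"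
  using normal.rcos_sum[OF normal_center, of A B] by (simp add: PSL2C_def psl_def)

lemma one_PSL2C: "\<one>\<^bsub>PSL2C\<^esub> = psl (mat 1)"
  by (simp add: PSL2C_def psl_eq)

lemma inv_PSL2C: "det A = 1 \<Longrightarrow> inv\<^bsub>PSL2C\<^esub> (psl A) = psl (adj2 A)"
  by (rule group.inv_equality[OF group_PSL2C])
     (auto simp: psl_mult det_adj2 mult_adj2 one_PSL2C carrier_PSL2C)

lemma psl_eq_iff: "psl A = psl B \<longleftrightarrow> A = B \<or> A = - B"
  by (auto simp: psl_eq doubleton_eq_iff)

section \<open>The action on the hyperboloid\<close>

lemma symm_nth [simp]:
  "symm v $ 1 $ 1 = of_real (v $ 1 + v $ 2)" "symm v $ 1 $ 2 = of_real (v $ 3)"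
  "symm v $ 2 $ 1 = of_real (v $ 3)" "symm v $ 2 $ 2 = of_real (v $ 1 - v $ 2)"
  by (simp_all add: symm_def)

lemma unsymm_nth [simp]:
  "unsymm S $ 1 = Re (S $ 1 $ 1 + S $ 2 $ 2) / 2" "unsymm S $ 2 = Re (S $ 1 $ 1 - S $ 2 $ 2) / 2"
  "unsymm S $ 3 = Re (S $ 1 $ 2)"
  by (simp_all add: unsymm_def)

lemma mact_uminus: "mact (- A) v = mact A v"
proof -
  have "transpose (- A) = - transpose A" by (rule mat2_eqI) auto
  then show ?thesis by (simp add: mact_def minus_mat_mult)
qed

lemma act_psl [simp]: "act (psl A) v = mact A v"
proof -
  have "(SOME B. B \<in> psl A) \<in> psl A" by (rule someI[of _ A]) (simp add: psl_eq)
  then show ?thesis unfolding act_def by (auto simp: psl_eq mact_uminus)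
qed

lemma cscale_mult: "A ** cscale c B = cscale c (A ** B)" "cscale c A ** B = cscale c (A ** B)"
  by (intro mat2_eqI; simp add: algebra_simps)+

lemma matrix_add_rdistrib2:
  fixes A B C :: "complex^2^2"
  shows "(A + B) ** C = A ** C + B ** C"
  by (rule mat2_eqI) (simp_all add: algebra_simps)

lemma cosh_of_real: "cosh (of_real r :: complex) = of_real (cosh r)"
  and sinh_of_real: "sinh (of_real r :: complex) = of_real (sinh r)"
  by (simp_all add: cosh_def sinh_def exp_of_real scaleR_conv_of_real flip: of_real_minus)

lemma linear_mact: "linear (mact A)"
proof (rule linearI)
  fix v w r
  have "symm (v + w) = symm v + symm w" by (rule mat2_eqI) auto
  moreover have "unsymm (S + T) = unsymm S + unsymm T" for S T
    by (simp add: vec_eq_iff forall_3 field_simps)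
  ultimately show "mact A (v + w) = mact A v + mact A w"
    by (simp add: mact_def matrix_add_ldistrib matrix_add_rdistrib2)
  have "symm (r *\<^sub>R v) = cscale (of_real r) (symm v)"
    by (rule mat2_eqI) (auto simp: algebra_simps)
  moreover have "unsymm (cscale (of_real r) S) = r *\<^sub>R unsymm S" for S
    by (simp add: vec_eq_iff forall_3 algebra_simps)
  ultimately show "mact A (r *\<^sub>R v) = r *\<^sub>R mact A v"
    by (simp add: mact_def cscale_mult)
qed

lemmas mact_add = linear_add[OF linear_mact]
lemmas mact_scaleR = linear_scale[OF linear_mact]
lemmas mact_diff = linear_diff[OF linear_mact]

lemma real_entries_symm: "real_entries (symm v)"
  by (rule real_entriesI) (auto simp del: of_real_add of_real_diff)

lemma symm_unsymm:
  assumes "real_entries S" "S $ 1 $ 2 = S $ 2 $ 1"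
  shows "symm (unsymm S) = S"
proof -
  obtain a b e where "S $ 1 $ 1 = of_real a" "S $ 2 $ 1 = of_real b" "S $ 2 $ 2 = of_real e"
    using assms(1) by (metis Reals_cases real_entriesD)
  then show ?thesis using assms(2)
    by (intro mat2_eqI) (auto simp: field_simps simp flip: of_real_add of_real_diff)
qed

lemma symm_mact: "real_entries A \<Longrightarrow> symm (mact A v) = A ** symm v ** transpose A"
  unfolding mact_def
  by (rule symm_unsymm)
     (auto intro!: real_entries_mult real_entries_symm simp: real_entries_def[of "transpose A"] real_entriesD algebra_simps)

lemma mact_mult: "real_entries B \<Longrightarrow> mact (A ** B) v = mact A (mact B v)"
  unfolding mact_def[of A] mact_def[of "A ** B"]
  by (simp add: symm_mact matrix_transpose_mul matrix_mul_assoc)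

lemma mact_1 [simp]: "mact (mat 1) v = v"
  by (simp add: mact_def vec_eq_iff forall_3)

lemma mact_adj2: "det A = 1 \<Longrightarrow> real_entries A \<Longrightarrow> mact (adj2 A) (mact A v) = v"
  "det A = 1 \<Longrightarrow> real_entries A \<Longrightarrow> mact A (mact (adj2 A) v) = v"
  by (simp_all add: mact_mult[symmetric] mult_adj2 real_entries_adj2)

lemma det_symm: "det (symm v) = of_real (- mink v v)"
  by (simp add: det_2 mink_def algebra_simps)

lemma mink_mact_self:
  assumes "real_entries A" "det A = 1"
  shows "mink (mact A v) (mact A v) = mink v v"
proof -
  have "det (symm (mact A v)) = det (symm v)"
    by (simp add: symm_mact assms det_mul det_transpose)
  then show ?thesis by (simp add: det_symm del: of_real_minus)
qed

lemma mink_mact: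
  assumes "real_entries A" "det A = 1"
  shows "mink (mact A v) (mact A w) = mink v w"
  using mink_mact_self[OF assms, of "v + w"] mink_mact_self[OF assms, of v] mink_mact_self[OF assms, of w]
  by (simp add: mact_add mink_commute[of w v] mink_commute[of "mact A w" "mact A v"])

text \<open>The first coordinate is half the trace of a congruent copy of the positive definite matrix
  \<open>symm v\<close>, so the action preserves the future.\<close>

lemma mact_H2:
  assumes "real_entries A" "det A = 1" "v \<in> H2"
  shows "mact A v \<in> H2"
proof -
  let ?w = "mact A v"
  have m: "mink ?w ?w = -1" using mink_mact_self[OF assms(1,2)] H2D[OF assms(3)] by simp
  obtain a b c e where A: "A $ 1 $ 1 = of_real a" "A $ 1 $ 2 = of_real b" "A $ 2 $ 1 = of_real c"
    "A $ 2 $ 2 = of_real e"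
    using assms(1) by (metis Reals_cases real_entriesD)
  define \<alpha> where "\<alpha> = v $ 1 + v $ 2"
  define \<beta> where "\<beta> = v $ 1 - v $ 2"
  have ab: "\<alpha> * \<beta> = 1 + (v $ 3)\<^sup>2" "\<alpha> + \<beta> > 0"
    using H2D[OF assms(3)] by (auto simp: \<alpha>_def \<beta>_def mink_def power2_eq_square algebra_simps)
  have \<alpha>: "\<alpha> > 0"
    using ab by (smt (verit) zero_le_power2 zero_less_mult_iff)
  have nn: "\<alpha> * r\<^sup>2 + 2 * r * s * v $ 3 + \<beta> * s\<^sup>2 \<ge> 0" for r s
  proof -
    have "\<alpha> * (\<alpha> * r\<^sup>2 + 2 * r * s * v $ 3 + \<beta> * s\<^sup>2) = (\<alpha> * r + s * v $ 3)\<^sup>2 + s\<^sup>2"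
      using ab(1) by algebra
    then show ?thesis using \<alpha> by (metis add_nonneg_nonneg zero_le_power2 zero_le_mult_iff not_le)
  qed
  have "2 * ?w $ 1 = (\<alpha> * a\<^sup>2 + 2 * a * b * v $ 3 + \<beta> * b\<^sup>2) + (\<alpha> * c\<^sup>2 + 2 * c * e * v $ 3 + \<beta> * e\<^sup>2)"
    unfolding \<alpha>_def \<beta>_def power2_eq_square by (simp add: mact_def A) (simp add: algebra_simps)
  then have "?w $ 1 \<ge> 0" using nn[of a b] nn[of c e] by simp
  moreover have "?w $ 1 \<noteq> 0" using m by (auto simp: mink_def) (smt (verit) zero_le_square)
  ultimately show ?thesis using m by (simp add: H2_def)
qed

lemma geoseg_mact:
  assumes "real_entries A" "det A = 1"
  shows "geoseg (mact A x) (mact A y) s = mact A (geoseg x y s)"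
  by (simp add: geoseg_def geoline_def hdist_def mink_mact[OF assms] Let_def mact_add mact_diff mact_scaleR)

lemma segment_mact:
  assumes "real_entries A" "det A = 1"
  shows "segment (mact A x) (mact A y) = mact A ` segment x y"
  by (simp add: segment_def geoseg_mact[OF assms] image_image hdist_def mink_mact[OF assms])

section \<open>Translations along geodesics\<close>

text \<open>The isomorphism from Lorentzian space to the Lie algebra of \<open>SL(2,\<real>)\<close>. It sends the right unit
  normal of an oriented geodesic to the generator of the translations along it.\<close>

definition genm :: "real^3 \<Rightarrow> complex^2^2" where
  "genm n = vector [vector [of_real (- (n $ 3)), of_real (n $ 1 + n $ 2)],
                    vector [of_real (n $ 2 - n $ 1), of_real (n $ 3)]]"

lemma genm_nth [simp]:
  "genm n $ 1 $ 1 = - of_real (n $ 3)" "genm n $ 1 $ 2 = of_real (n $ 1 + n $ 2)"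
  "genm n $ 2 $ 1 = of_real (n $ 2 - n $ 1)" "genm n $ 2 $ 2 = of_real (n $ 3)"
  by (simp_all add: genm_def)

lemma genm_linear: "genm (a + b) = genm a + genm b" "genm (a - b) = genm a - genm b"
  "genm (r *\<^sub>R a) = cscale (of_real r) (genm a)"
  by (rule mat2_eqI; simp add: algebra_simps)+

lemma genm_square: "genm n ** genm n = cscale (of_real (mink n n)) (mat 1)"
  by (rule mat2_eqI) (simp_all add: mink_def algebra_simps)

lemma real_entries_genm: "real_entries (genm n)"
  by (rule real_entriesI) (auto simp del: of_real_add of_real_diff)

lemma genm_surj: "real_entries X \<Longrightarrow> trace X = 0 \<Longrightarrow> \<exists>n. X = genm n"
proof -
  assume X: "real_entries X" "trace X = 0"
  obtain a b c where A: "X $ 1 $ 1 = of_real a" "X $ 1 $ 2 = of_real b" "X $ 2 $ 1 = of_real c"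
    using X(1) by (metis Reals_cases real_entriesD)
  then have "X = genm (vector [(b - c) / 2, (b + c) / 2, - a])"
    using X(2) by (intro mat2_eqI) (auto simp: trace_2 add_eq_0_iff simp flip: of_real_add of_real_diff simp: field_simps)
  then show ?thesis by blast
qed

text \<open>The closed form of \<open>exp (a X)\<close> for a generator with \<open>X\<^sup>2 = 1\<close>.\<close>

definition hexp :: "complex \<Rightarrow> real^3 \<Rightarrow> complex^2^2" where
  "hexp a n = cscale (cosh a) (mat 1) + cscale (sinh a) (genm n)"

lemma mact_quadratic:
  "mact (cscale \<alpha> (mat 1) + cscale \<beta> (genm n)) v =
     Re (\<alpha>\<^sup>2) *\<^sub>R v + Re (2 * \<alpha> * \<beta>) *\<^sub>R lcross n v + Re (\<beta>\<^sup>2) *\<^sub>R (mink n n *\<^sub>R v - (2 * mink n v) *\<^sub>R n)"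
  by (simp add: mact_def vec_eq_iff forall_3 mink_def power2_eq_square) (auto simp: field_simps)

lemma mult_quadratic:
  "(cscale \<alpha> (mat 1) + cscale \<beta> (genm n)) ** (cscale \<alpha>' (mat 1) + cscale \<beta>' (genm n)) =
   cscale (\<alpha> * \<alpha>' + \<beta> * \<beta>' * of_real (mink n n)) (mat 1) + cscale (\<alpha> * \<beta>' + \<beta> * \<alpha>') (genm n)"
  by (rule mat2_eqI) (simp_all add: mink_def algebra_simps)

lemma det_quadratic: "det (cscale \<alpha> (mat 1) + cscale \<beta> (genm n)) = \<alpha>\<^sup>2 - \<beta>\<^sup>2 * of_real (mink n n)"
  by (simp add: det_2 mink_def power2_eq_square algebra_simps)

lemma trace_quadratic: "trace (cscale \<alpha> (mat 1) + cscale \<beta> (genm n)) = 2 * \<alpha>"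
  by (simp add: trace_2)

lemma det_hexp: "mink n n = 1 \<Longrightarrow> det (hexp a n) = 1"
  by (simp add: hexp_def det_quadratic hyperbolic_pythagoras)

lemma hexp_add: "mink n n = 1 \<Longrightarrow> hexp (a + b) n = hexp a n ** hexp b n"
  by (simp add: hexp_def mult_quadratic cosh_add sinh_add algebra_simps)

lemma hexp_0 [simp]: "hexp 0 n = mat 1"
  by (rule mat2_eqI) (simp_all add: hexp_def)

lemma real_entries_hexp: "a \<in> \<real> \<Longrightarrow> real_entries (hexp a n)"
proof -
  assume "a \<in> \<real>"
  then obtain r where "a = of_real r" by (auto elim: Reals_cases)
  then show ?thesis
    by (intro real_entriesI) (auto simp: hexp_def cosh_of_real sinh_of_real simp del: of_real_add of_real_diff)
qed

text \<open>Since \<open>genm n\<close> squares to a scalar, the even and the odd terms of the exponential series separate. The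
  generators that compete in the definition of \<^const>\<open>transl_gen\<close> are arbitrary traceless real matrices, so
  that the scalar can also be negative or zero; a complex square root \<open>w\<close> of it covers all nonzero values.\<close>

lemma genm_power: "((**) (cscale a (genm n)) ^^ k) (mat 1) =
   (if even k then cscale (a ^ k * of_real (mink n n) ^ (k div 2)) (mat 1)
    else cscale (a ^ k * of_real (mink n n) ^ (k div 2)) (genm n))"
proof (induction k)
  case 0
  show ?case by (auto intro!: mat2_eqI)
next
  case (Suc k)
  have 1: "cscale a (genm n) ** cscale b (mat 1) = cscale (a * b) (genm n)" for b
    by (rule mat2_eqI) simp_all
  have 2: "cscale a (genm n) ** cscale b (genm n) = cscale (a * b * of_real (mink n n)) (mat 1)" for b
    by (rule mat2_eqI) (simp_all add: mink_def algebra_simps)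
  show ?case using Suc by (auto simp: 1 2 ac_simps elim!: oddE evenE)
qed

lemma bounded_linear_cscale: "bounded_linear (\<lambda>c. cscale c A)"
  by (subst linear_conv_bounded_linear[symmetric], rule linearI)
     (auto intro!: mat2_eqI simp: algebra_simps)

lemma mexp_genm:
  assumes "w\<^sup>2 = of_real (mink n n)" "w \<noteq> 0"
  shows "mexp (cscale a (genm n)) = cscale (cosh (a * w)) (mat 1) + cscale (sinh (a * w) / w) (genm n)"
proof -
  let ?c = "\<lambda>k. if even k then (a * w) ^ k /\<^sub>R fact k else 0"
  let ?s = "\<lambda>k. (if even k then 0 else (a * w) ^ k /\<^sub>R fact k) / w"
  have kth: "(1 / fact k) *\<^sub>R (((**) (cscale a (genm n)) ^^ k) (mat 1)) =
      cscale (?c k) (mat 1) + cscale (?s k) (genm n)" for k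
  proof -
    have "a ^ k * of_real (mink n n) ^ (k div 2) = (if even k then (a * w) ^ k else (a * w) ^ k / w)"
      using assms by (auto simp flip: assms(1) power_mult simp: power_mult_distrib elim!: oddE evenE)
    then show ?thesis
      unfolding genm_power
      by (auto intro!: mat2_eqI simp: divide_inverse scaleR_conv_of_real[where 'a = complex])
  qed
  have "(\<lambda>k. cscale (?c k) (mat 1) + cscale (?s k) (genm n)) sums
      (cscale (cosh (a * w)) (mat 1) + cscale (sinh (a * w) / w) (genm n))"
    by (intro sums_add bounded_linear.sums[OF bounded_linear_cscale] cosh_converges sums_divide sinh_converges)
  then show ?thesis unfolding mexp_def kth by (simp add: sums_iff)
qed

lemma mexp_genm_null:
  assumes "mink n n = 0"
  shows "mexp (cscale a (genm n)) = mat 1 + cscale a (genm n)"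
proof -
  let ?f = "\<lambda>k. (1 / fact k) *\<^sub>R (((**) (cscale a (genm n)) ^^ k) (mat 1))"
  have "?f k = 0" if "k \<notin> {0, 1}" for k
  proof -
    have "k div 2 \<noteq> 0" using that by auto
    then show ?thesis unfolding genm_power by (auto intro!: mat2_eqI simp: assms)
  qed
  then have "?f sums (\<Sum>k\<in>{0, 1}. ?f k)" by (intro sums_finite) auto
  also have "(\<Sum>k\<in>{0, 1}. ?f k) = mat 1 + cscale a (genm n)"
    by (auto intro!: mat2_eqI)
  finally show ?thesis unfolding mexp_def by (simp add: sums_iff)
qed

lemma mexp_hexp: "mink n n = 1 \<Longrightarrow> mexp (cscale a (genm n)) = hexp a n"
  using mexp_genm[of 1 n a] by (simp add: hexp_def)

lemma mexp_first_order:
  "\<exists>\<alpha> \<beta>. (\<forall>a. mexp (cscale a (genm n)) = cscale (\<alpha> a) (mat 1) + cscale (\<beta> a) (genm n)) \<and>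
     \<alpha> 0 = 1 \<and> \<beta> 0 = 0 \<and> (\<alpha> has_field_derivative 0) (at 0) \<and> (\<beta> has_field_derivative 1) (at 0)"
proof (cases "mink n n = 0")
  case True
  have e: "mexp (cscale a (genm n)) = cscale ((\<lambda>_. 1) a) (mat 1) + cscale (id a) (genm n)" for a
    by (auto simp: mexp_genm_null[OF True] intro!: mat2_eqI)
  show ?thesis
    by (intro exI[of _ "\<lambda>_. 1"] exI[of _ id] conjI allI e) (auto intro!: derivative_eq_intros simp: id_def)
next
  case False
  obtain w :: complex where w: "w\<^sup>2 = of_real (mink n n)" using power2_csqrt by blast
  then have w0: "w \<noteq> 0" using False by auto
  show ?thesis
    by (intro exI[of _ "\<lambda>a. cosh (a * w)"] exI[of _ "\<lambda>a. sinh (a * w) / w"] conjI allI mexp_genm[OF w w0])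
       (use w0 in \<open>auto intro!: derivative_eq_intros\<close>)
qed

lemma hexp_translates:
  assumes "unit_tangent p u"
  shows "mact (hexp (of_real t) (lcross p u)) (geoline p u s) = geoline p u (s + 2 * t)"
proof -
  let ?n = "lcross p u"
  have n: "mink ?n p = 0" "mink ?n u = 0" "mink ?n ?n = 1" using lcross_unit[OF assms] by auto
  have lin: "lcross ?n (geoline p u s) = sinh s *\<^sub>R p + cosh s *\<^sub>R u"
  proof -
    have "lcross a (r *\<^sub>R v + q *\<^sub>R w) = r *\<^sub>R lcross a v + q *\<^sub>R lcross a w" for a v w r q
      by (simp add: vec_eq_iff forall_3 algebra_simps)
    then show ?thesis by (simp add: geoline_def lcross_normal_frame[OF assms])
  qed
  have "mact (hexp (of_real t) ?n) (geoline p u s) =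
      (cosh t)\<^sup>2 *\<^sub>R geoline p u s + (2 * cosh t * sinh t) *\<^sub>R (sinh s *\<^sub>R p + cosh s *\<^sub>R u)
      + (sinh t)\<^sup>2 *\<^sub>R geoline p u s"
    unfolding hexp_def mact_quadratic lin
    by (simp add: n geoline_def cosh_of_real sinh_of_real flip: of_real_power)
  also have "\<dots> = cosh (2 * t) *\<^sub>R geoline p u s + sinh (2 * t) *\<^sub>R (sinh s *\<^sub>R p + cosh s *\<^sub>R u)"
    unfolding cosh_double sinh_double by (simp add: algebra_simps)
  also have "\<dots> = geoline p u (s + 2 * t)"
    by (simp add: geoline_def cosh_add sinh_add algebra_simps)
  finally show ?thesis .
qed

text \<open>By the formula for the double cross product, \<open>p\<close> and \<open>u\<close> would both be multiples of \<open>k\<close> if \<open>k\<close> were not null;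
  a null vector orthogonal to \<open>p\<close> vanishes.\<close>

lemma lcross_eq_0:
  assumes "unit_tangent p u" "lcross k p = 0" "lcross k u = 0"
  shows "k = 0"
proof (rule ccontr)
  assume "k \<noteq> 0"
  have 1: "mink k k *\<^sub>R p = mink k p *\<^sub>R k" "mink k k *\<^sub>R u = mink k u *\<^sub>R k"
    using lcross_lcross[of k p] lcross_lcross[of k u] assms(2,3) by (simp_all add: vec_eq_iff forall_3)
  show False
  proof (cases "mink k k = 0")
    case True
    then have "mink p k = 0" using 1 \<open>k \<noteq> 0\<close> by (simp add: mink_commute)
    then show False using tangent_pos(2)[OF unit_tangentD(1)[OF assms(1)]] True \<open>k \<noteq> 0\<close> by blast
  next
    case False
    have "mink (mink k k *\<^sub>R p) (mink k k *\<^sub>R u) = mink k p * mink k u * mink k k"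
      unfolding 1 by simp
    then have "mink k p = 0 \<or> mink k u = 0" using False by (simp add: unit_tangentD[OF assms(1)])
    then have "p = 0 \<or> u = 0" using 1 False by auto
    then show False using unit_tangentD[OF assms(1)] by auto
  qed
qed

text \<open>Differentiating the defining property at time \<open>0\<close> determines the cross products of the
  normal with \<open>p\<close> and \<open>u\<close>, hence the generator.\<close>

lemma transl_gen_eq:
  assumes "unit_tangent p u"
  shows "transl_gen p u = genm (lcross p u)"
  unfolding transl_gen_def
proof (rule the_equality)
  let ?n = "lcross p u"
  show "real_entries (genm ?n) \<and> trace (genm ?n) = 0 \<and>
     (\<forall>s t. mact (mexp (cscale (complex_of_real t) (genm ?n))) (geoline p u s) = geoline p u (s + 2 * t))"
    using hexp_translates[OF assms]
    by (simp add: real_entries_genm trace_2 mexp_hexp[OF lcross_unit[OF assms]])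
next
  fix X assume X: "real_entries X \<and> trace X = 0 \<and>
     (\<forall>s t. mact (mexp (cscale (complex_of_real t) X)) (geoline p u s) = geoline p u (s + 2 * t))"
  then obtain m where m: "X = genm m" using genm_surj by blast
  obtain \<alpha> \<beta> where ab: "\<And>a. mexp (cscale a (genm m)) = cscale (\<alpha> a) (mat 1) + cscale (\<beta> a) (genm m)"
    "\<alpha> 0 = 1" "\<beta> 0 = 0" "(\<alpha> has_field_derivative 0) (at 0)" "(\<beta> has_field_derivative 1) (at 0)"
    using mexp_first_order[of m] by blast
  have Re_der: "((\<lambda>t. Re (f (of_real t))) has_real_derivative Re D) (at 0)"
    if "(f has_field_derivative D) (at (0::complex))" for f D
    using bounded_linear.has_vector_derivative[OF bounded_linear_Re has_vector_derivative_real_field[of f D 0 UNIV]] that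
    by (simp add: has_real_derivative_iff_has_vector_derivative)
  have d1: "((\<lambda>t. Re ((\<alpha> (of_real t))\<^sup>2)) has_real_derivative 0) (at 0)"
    using Re_der[OF DERIV_power[OF ab(4), of 2]] by simp
  have d2: "((\<lambda>t. Re (2 * \<alpha> (of_real t) * \<beta> (of_real t))) has_real_derivative 2) (at 0)"
    using Re_der[OF DERIV_mult[OF DERIV_cmult[OF ab(4), of 2] ab(5)]] ab(2,3) by simp
  have d3: "((\<lambda>t. Re ((\<beta> (of_real t))\<^sup>2)) has_real_derivative 0) (at 0)"
    using Re_der[OF DERIV_power[OF ab(5), of 2]] ab(3) by simp
  have key: "lcross m (geoline p u s) = sinh s *\<^sub>R p + cosh s *\<^sub>R u" for s
  proof -
    let ?v = "geoline p u s"
    have "((\<lambda>t. mact (mexp (cscale (complex_of_real t) X)) ?v) has_vector_derivative 2 *\<^sub>R lcross m ?v) (at 0)"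
      unfolding m ab(1) mact_quadratic
      using has_vector_derivative_add[OF has_vector_derivative_add[OF
          has_vector_derivative_scaleR[OF d1 has_vector_derivative_const[of ?v]]
          has_vector_derivative_scaleR[OF d2 has_vector_derivative_const[of "lcross m ?v"]]]
          has_vector_derivative_scaleR[OF d3 has_vector_derivative_const[of "mink m m *\<^sub>R ?v - (2 * mink m ?v) *\<^sub>R m"]]]
      by (simp add: ab(2,3))
    moreover have "((\<lambda>t. geoline p u (s + 2 * t)) has_vector_derivative 2 *\<^sub>R (sinh s *\<^sub>R p + cosh s *\<^sub>R u)) (at 0)"
      unfolding geoline_def
      by (rule has_vector_derivative_eq_rhs,
          (rule has_vector_derivative_add has_vector_derivative_scaleR has_vector_derivative_const derivative_eq_intros refl)+)
         (auto simp: algebra_simps)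
    ultimately have "2 *\<^sub>R lcross m ?v = 2 *\<^sub>R (sinh s *\<^sub>R p + cosh s *\<^sub>R u)"
      using X vector_derivative_unique_at by fastforce
    then show ?thesis by simp
  qed
  have lp: "lcross m p = u" using key[of 0] by (simp add: geoline_def)
  have "lcross m (geoline p u 1) = cosh 1 *\<^sub>R lcross m p + sinh 1 *\<^sub>R lcross m u"
    by (simp add: geoline_def vec_eq_iff forall_3 algebra_simps)
  then have "sinh 1 *\<^sub>R lcross m u = sinh 1 *\<^sub>R p" using key[of 1] lp by simp
  then have lu: "lcross m u = p" by simp
  have diff: "lcross (m - lcross p u) v = lcross m v - lcross (lcross p u) v" for v
    by (simp add: vec_eq_iff forall_3 algebra_simps)
  have "m - lcross p u = 0"
    by (rule lcross_eq_0[OF assms]) (simp_all only: diff lcross_normal_frame[OF assms] lp lu diff_self)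
  then show "X = genm (lcross p u)" using m by simp
qed

section \<open>Hyperbolic elements of \<open>PSL(2,\<real>)\<close>\<close>

lemma PSL2R_iff: "P \<in> PSL2R \<longleftrightarrow> (\<exists>A. P = psl A \<and> det A = 1 \<and> real_entries A)"
  by (auto simp: PSL2R_def)

lemma symm_adj2: 
  assumes "unit_tangent p u"
  shows "symm u ** adj2 (symm p) = genm (lcross p u)"
proof -
  have e: "u $ 1 * p $ 1 = u $ 2 * p $ 2 + u $ 3 * p $ 3"
    using unit_tangentD(4)[OF assms] by (simp add: mink_def)
  show ?thesis
    by (rule mat2_eqI)
       (use e in \<open>auto simp: algebra_simps simp flip: of_real_mult of_real_add of_real_diff of_real_minus\<close>)
qed

text \<open>A matrix that fixes \<open>p\<close> and \<open>u\<close> commutes with \<open>symm u ** adj2 (symm p)\<close>, the generator of the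
  translations along the geodesic. Its traceless part is therefore a multiple of this generator, so that the
  matrix is, up to sign, itself such a translation, and it fixes \<open>p\<close>.\<close>

lemma stabilizer_trivial:
  assumes ut: "unit_tangent p u" and H: "real_entries H" "det H = 1"
    and fixed: "mact H p = p" "mact H u = u"
  shows "H = mat 1 \<or> H = - mat 1"
proof -
  let ?n = "lcross p u" and ?T = "transpose H"
  have n: "mink ?n ?n = 1" "mink ?n p = 0" using lcross_unit[OF ut] by simp_all
  have Sp: "H ** symm p ** ?T = symm p" and Su: "H ** symm u ** ?T = symm u"
    using symm_mact[OF H(1), of p] symm_mact[OF H(1), of u] fixed by simp_all
  have dT: "det ?T = 1" using H by (simp add: det_transpose)
  have "adj2 (symm p) ** H = adj2 ?T ** adj2 (symm p) ** adj2 H ** H"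
    using arg_cong[OF Sp, of adj2] by (simp add: adj2_mult matrix_mul_assoc)
  also have "\<dots> = adj2 ?T ** adj2 (symm p)"
    by (simp add: matrix_mul_assoc[symmetric] mult_adj2 H)
  finally have 1: "adj2 (symm p) ** H = adj2 ?T ** adj2 (symm p)" .
  have "symm u ** adj2 ?T = H ** symm u ** (?T ** adj2 ?T)"
    using Su by (simp add: matrix_mul_assoc)
  then have 2: "symm u ** adj2 ?T = H ** symm u" by (simp add: mult_adj2 dT H(2))
  have comm: "genm ?n ** H = H ** genm ?n"
    unfolding symm_adj2[OF ut, symmetric]
    by (simp add: matrix_mul_assoc[symmetric] 1) (simp add: matrix_mul_assoc 2)
  define h where "h = Re (trace H) / 2"
  have tr: "trace H = of_real (2 * h)"
    using real_entriesD[OF H(1)] by (simp add: h_def trace_2 complex_eq_iff complex_is_Real_iff)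
  have "real_entries (H - cscale (of_real h) (mat 1))"
    by (rule real_entriesI) (auto simp: real_entriesD[OF H(1)])
  moreover have "trace (H - cscale (of_real h) (mat 1)) = 0"
    using tr by (simp add: trace_2)
  ultimately obtain k where k: "H - cscale (of_real h) (mat 1) = genm k" using genm_surj by blast
  then have Hk: "H = cscale (of_real h) (mat 1) + genm k" by (metis add.commute diff_add_cancel)
  have c: "genm ?n ** genm k = genm k ** genm ?n"
  proof -
    have "genm ?n ** H = cscale (of_real h) (genm ?n) + genm ?n ** genm k"
      "H ** genm ?n = cscale (of_real h) (genm ?n) + genm k ** genm ?n"
      unfolding Hk by (rule mat2_eqI; simp add: algebra_simps)+
    then show ?thesis using comm by simp
  qed
  have anti: "genm ?n ** genm k + genm k ** genm ?n = cscale (of_real (2 * mink ?n k)) (mat 1)"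
    by (rule mat2_eqI) (simp_all add: mink_def algebra_simps)
  have "genm ?n ** (genm ?n ** genm k) = genm k"
    by (simp add: matrix_mul_assoc genm_square n cscale_mult) (auto intro!: mat2_eqI)
  moreover have "genm ?n ** genm k = cscale (of_real (mink ?n k)) (mat 1)"
    using anti unfolding c[symmetric]
    by (auto simp: vec_eq_iff forall_2 simp del: lcross_nth genm_nth mat2_nth(1))
  ultimately have "genm k = cscale (of_real (mink ?n k)) (genm ?n)"
    by (simp add: cscale_mult)
  then have H': "H = cscale (of_real h) (mat 1) + cscale (of_real (mink ?n k)) (genm ?n)"
    using Hk by simp
  let ?b = "mink ?n k"
  have d: "h\<^sup>2 - ?b\<^sup>2 = 1"
  proof -
    have "of_real (h\<^sup>2 - ?b\<^sup>2) = (1 :: complex)"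
      using H(2) unfolding H' det_quadratic by (simp add: n)
    then show ?thesis using of_real_eq_1_iff by blast
  qed
  have "h\<^sup>2 *\<^sub>R p + (2 * h * ?b) *\<^sub>R u + ?b\<^sup>2 *\<^sub>R p = p"
    using fixed(1) unfolding H' mact_quadratic
    by (simp add: n lcross_normal_frame[OF ut] flip: of_real_power)
  then have "mink p (h\<^sup>2 *\<^sub>R p + (2 * h * ?b) *\<^sub>R u + ?b\<^sup>2 *\<^sub>R p) = mink p p" by simp
  then have "h\<^sup>2 + ?b\<^sup>2 = 1" by (simp add: unit_tangentD[OF ut])
  then have "?b = 0" "h = 1 \<or> h = -1" using d power2_eq_1_iff[of h] by auto
  then show ?thesis unfolding H' by (auto intro!: mat2_eqI)
qed

lemma translates_imp_hexp:
  assumes "translates (psl A) p u e" "det A = 1" "real_entries A"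
  shows "A = hexp (of_real (e / 2)) (lcross p u) \<or> A = - hexp (of_real (e / 2)) (lcross p u)"
proof -
  let ?n = "lcross p u"
  have ut: "unit_tangent p u" and tr: "\<And>s. mact A (geoline p u s) = geoline p u (s + e)"
    using assms(1) by (auto simp: translates_def)
  have n: "mink ?n ?n = 1" by (rule lcross_unit[OF ut])
  define H where "H = hexp (of_real (- e / 2)) ?n ** A"
  have H: "real_entries H" "det H = 1"
    using assms by (auto simp: H_def det_mul det_hexp n intro!: real_entries_mult real_entries_hexp)
  have fix_line: "mact H (geoline p u s) = geoline p u s" for s
    unfolding H_def mact_mult[OF assms(3)] tr hexp_translates[OF ut] by simp
  have p: "mact H p = p" using fix_line[of 0] by (simp add: geoline_def)
  have "cosh 1 *\<^sub>R mact H p + sinh 1 *\<^sub>R mact H u = cosh 1 *\<^sub>R p + sinh 1 *\<^sub>R u"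
    using fix_line[of 1] by (simp add: geoline_def mact_add mact_scaleR)
  then have "sinh 1 *\<^sub>R mact H u = sinh 1 *\<^sub>R u" using p by simp
  then have "mact H u = u" by simp
  with stabilizer_trivial[OF ut H p] have "H = mat 1 \<or> H = - mat 1" .
  moreover have "hexp (of_real (e / 2)) ?n ** H = A"
    unfolding H_def matrix_mul_assoc hexp_add[OF n, symmetric] by (simp flip: of_real_add)
  ultimately show ?thesis by (auto simp: minus_mat_mult)
qed

lemma trace_hexp: "trace (hexp (of_real r) n) = of_real (2 * cosh r)"
  by (simp add: hexp_def trace_quadratic cosh_of_real)

lemma genm_inj: "genm a = genm b \<Longrightarrow> a = b"
proof -
  assume "genm a = genm b"
  then have "a $ 3 = b $ 3" "a $ 1 + a $ 2 = b $ 1 + b $ 2" "a $ 2 - a $ 1 = b $ 2 - b $ 1"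
    by (auto simp: vec_eq_iff forall_2 simp del: of_real_add of_real_diff)
  then have "a $ 1 = b $ 1" "a $ 2 = b $ 2" "a $ 3 = b $ 3" by linarith+
  then show "a = b" by (simp add: vec_eq_iff forall_3)
qed

lemma hexp_inj:
  assumes "hexp (of_real r) n = hexp (of_real s) m" "r > 0" "s > 0"
  shows "r = s" "n = m"
proof -
  have "complex_of_real (2 * cosh r) = of_real (2 * cosh s)"
    using assms(1) by (metis trace_hexp)
  then have "cosh r = cosh s" by simp
  then show "r = s" using assms    
    using cosh_real_nonneg_le_iff[of r s] cosh_real_nonneg_le_iff[of s r] assms(2,3) by simp
  have "genm (sinh r *\<^sub>R n) = genm (sinh r *\<^sub>R m)"
    using assms(1) \<open>r = s\<close> by (simp add: hexp_def genm_linear sinh_of_real)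
  then have "sinh r *\<^sub>R n = sinh r *\<^sub>R m" by (rule genm_inj)
  then show "n = m" using assms by simp
qed

text \<open>Both representatives are \<open>hexp\<close> of a length and a normal, up to sign. The positive trace excludes the
  sign; then trace and traceless part give back the length and the normal.\<close>

lemma translates_hexp_unique:
  assumes "translates (psl (hexp (of_real (e / 2)) n)) p u e'" "mink n n = 1" "e > 0"
  shows "e' = e" "lcross p u = n"
proof -
  have ut: "unit_tangent p u" and e': "e' > 0" using assms(1) by (auto simp: translates_def)
  have "hexp (of_real (e / 2)) n \<noteq> - hexp (of_real (e' / 2)) (lcross p u)"
  proof
    assume "hexp (of_real (e / 2)) n = - hexp (of_real (e' / 2)) (lcross p u)"
    then have "trace (hexp (of_real (e / 2)) n) = - trace (hexp (of_real (e' / 2)) (lcross p u))"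
      by (simp add: trace_2)
    then have "cosh (e / 2) = - cosh (e' / 2)"
      unfolding trace_hexp by (metis (no_types, lifting) of_real_minus of_real_eq_iff mult_minus_right mult_cancel_left zero_neq_numeral)
    then show False using cosh_real_pos[of "e / 2"] cosh_real_pos[of "e' / 2"] by linarith
  qed
  then have "hexp (of_real (e / 2)) n = hexp (of_real (e' / 2)) (lcross p u)"
    using translates_imp_hexp[OF assms(1)] assms(2) by (auto simp: det_hexp real_entries_hexp)
  from hexp_inj[OF this] assms(3) e' show "e' = e" "lcross p u = n" by auto
qed

lemma translates_hexp:
  assumes "mink n n = 1" "e > 0" "unit_tangent p u" "lcross p u = n"
  shows "translates (psl (hexp (of_real (e / 2)) n)) p u e"
  using assms hexp_translates[OF assms(3), of "e / 2"] by (simp add: translates_def)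

lemma exists_frame:
  assumes "mink n n = 1"
  shows "\<exists>p u. unit_tangent p u \<and> lcross p u = n"
  using exists_point_of_normal[OF assms] unit_tangent_of_normal[OF assms] by blast

lemma transl_length_hexp:
  assumes "mink n n = 1" "e > 0"
  shows "transl_length (psl (hexp (of_real (e / 2)) n)) = e"
  unfolding transl_length_def
  using exists_frame[OF assms(1)] translates_hexp[OF assms] translates_hexp_unique[OF _ assms]
  by (intro the_equality) blast+

lemma axis_right_normal_hexp:
  assumes "mink n n = 1" "e > 0"
  shows "axis_right_normal (psl (hexp (of_real (e / 2)) n)) = n"
  unfolding axis_right_normal_def
proof (rule the_equality)
  obtain p u where pu: "unit_tangent p u" "lcross p u = n" using exists_frame[OF assms(1)] by blast
  then show "\<exists>p u d. translates (psl (hexp (of_real (e / 2)) n)) p u d \<and>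
     mink n n = 1 \<and> mink n p = 0 \<and> mink n u = 0 \<and> side p u n < 0"
    using translates_hexp[OF assms pu] assms
    by (intro exI[of _ p] exI[of _ u] exI[of _ e]) (auto simp: side_eq simp flip: pu(2))
next
  fix v assume "\<exists>p u d. translates (psl (hexp (of_real (e / 2)) n)) p u d \<and>
     mink v v = 1 \<and> mink v p = 0 \<and> mink v u = 0 \<and> side p u v < 0"
  then obtain p u d where t: "translates (psl (hexp (of_real (e / 2)) n)) p u d"
    and v: "mink v v = 1" "mink v p = 0" "mink v u = 0" "side p u v < 0" by blast
  have ut: "unit_tangent p u" using t by (simp add: translates_def)
  have n: "lcross p u = n" by (rule translates_hexp_unique(2)[OF t assms])
  have e: "v = mink v n *\<^sub>R n" using frame_expansion[OF ut, of v] v n by simp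
  then have "mink v v = mink v n * mink v n"
    by (metis mink_simps(6))
  then have "(mink v n)\<^sup>2 = 1" using v by (simp add: power2_eq_square)
  moreover have "mink v n > 0" using v(4) by (simp add: side_eq n mink_commute[of n v])
  ultimately have "mink v n = 1" by (auto simp: power2_eq_1_iff)
  then show "v = n" using e by simp
qed

lemma hyperbolic_imp_hexp:
  assumes "hyperbolic P"
  shows "\<exists>n e. mink n n = 1 \<and> e > 0 \<and> P = psl (hexp (of_real (e / 2)) n)"
proof -
  obtain A p u e where A: "P = psl A" "det A = 1" "real_entries A" and t: "translates P p u e"
    using assms by (auto simp: hyperbolic_def PSL2R_iff)
  have "P = psl (hexp (of_real (e / 2)) (lcross p u))"
    using translates_imp_hexp[of A p u e] A t by (auto simp: psl_eq_iff)
  moreover have "unit_tangent p u" "e > 0" using t by (auto simp: translates_def)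
  ultimately show ?thesis using lcross_unit by blast
qed

text \<open>The traceless part of the matrix is \<open>genm k\<close> for a vector \<open>k\<close>, and determinant \<open>1\<close> gives it the
  length \<open>sinh\<close> of half the translation length, so that the axis is visible without diagonalizing.\<close>

lemma real_trace_gt_2:
  assumes "real_entries A" "det A = 1" "Re (trace A) > 2"
  shows "\<exists>n. mink n n = 1 \<and> A = hexp (of_real (arcosh (Re (trace A) / 2))) n"
proof -
  define h where "h = Re (trace A) / 2"
  define r where "r = arcosh h"
  have h: "h > 1" using assms(3) by (simp add: h_def)
  then have r: "cosh r = h" "r > 0" by (simp_all add: r_def arcosh_real_gt_1_iff)
  have tr: "trace A = of_real (2 * h)"
    using real_entriesD[OF assms(1)] by (simp add: h_def trace_2 complex_eq_iff complex_is_Real_iff)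
  have "real_entries (A - cscale (of_real h) (mat 1))"
    by (rule real_entriesI) (auto simp: real_entriesD[OF assms(1)])
  moreover have "trace (A - cscale (of_real h) (mat 1)) = 0"
    using tr by (simp add: trace_2)
  ultimately obtain k where k: "A - cscale (of_real h) (mat 1) = genm k" using genm_surj by blast
  then have Ak: "A = cscale (of_real h) (mat 1) + cscale 1 (genm k)"
    by (metis (no_types, lifting) add.commute diff_add_cancel genm_linear(3) of_real_1 scaleR_one)
  have "of_real (h\<^sup>2 - mink k k) = (1 :: complex)"
    using assms(2) unfolding Ak det_quadratic by simp
  then have "h\<^sup>2 - mink k k = 1" using of_real_eq_1_iff by blast
  then have kk: "mink k k = (sinh r)\<^sup>2" using r(1) by (simp add: sinh_square_eq)
  define n where "n = (1 / sinh r) *\<^sub>R k"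
  have s: "sinh r > 0" using r by simp
  have "mink n n = 1" using kk s by (simp add: n_def power2_eq_square)
  moreover have "k = sinh r *\<^sub>R n" using s by (simp add: n_def)
  then have "A = hexp (of_real r) n"
    using r(1) Ak by (simp add: hexp_def cosh_of_real sinh_of_real genm_linear) (auto intro!: mat2_eqI)
  ultimately show ?thesis by (auto simp: r_def h_def)
qed

lemma transl_length_trace:
  assumes "real_entries A" "det A = 1" "Re (trace A) > 2"
  shows "transl_length (psl A) = 2 * arcosh (Re (trace A) / 2)"
proof -
  obtain n where n: "mink n n = 1" "A = hexp (of_real (2 * arcosh (Re (trace A) / 2) / 2)) n"
    using real_trace_gt_2[OF assms] by auto
  have "2 * arcosh (Re (trace A) / 2) > 0" using assms(3) by (simp add: arcosh_real_gt_1_iff)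
  from transl_length_hexp[OF n(1) this] n(2) show ?thesis by metis
qed

section \<open>Complex length\<close>

lemma diag2_nth [simp]:
  "diag2 a b $ 1 $ 1 = a" "diag2 a b $ 1 $ 2 = 0" "diag2 a b $ 2 $ 1 = 0" "diag2 a b $ 2 $ 2 = b"
  by (simp_all add: diag2_def)

lemma exists_eigenvector:
  fixes A :: "complex^2^2"
  assumes "det (A - cscale l (mat 1)) = 0"
  shows "\<exists>v. v \<noteq> 0 \<and> A *v v = l *s v"
proof -
  have "\<not> invertible (A - cscale l (mat 1))" using assms by (simp add: invertible_det_nz)
  then obtain v where v: "v \<noteq> 0" "(A - cscale l (mat 1)) *v v = 0"
    using matrix_left_invertible_ker[of "A - cscale l (mat 1)"] invertible_left_inverse by metis
  have "(A - cscale l (mat 1)) *v v = A *v v - l *s v"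
    by (simp add: vec_eq_iff forall_2 matrix_vector_mult_def sum_2 algebra_simps)
  then show ?thesis using v by auto
qed

text \<open>Eigenvectors for the two distinct eigenvalues form a basis; dividing one of them by the determinant of
  the basis makes the change of coordinates unimodular.\<close>

lemma conj_to_diag_of_trace:
  assumes "det M = 1" "trace M = exp (z / 2) + exp (- z / 2)" "exp (z / 2) \<noteq> exp (- z / 2)"
  shows "conj_to_diag (psl M) z"
proof -
  define l where "l = exp (z / 2)"
  define k where "k = exp (- z / 2)"
  have lk: "l * k = 1" "l \<noteq> k" "trace M = l + k"
    using assms by (auto simp: l_def k_def simp flip: exp_add)
  have char: "det (M - cscale q (mat 1)) = q\<^sup>2 - trace M * q + 1" for q
    using assms(1) by (simp add: det_2 trace_2 power2_eq_square algebra_simps)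
  have "det (M - cscale l (mat 1)) = 0" "det (M - cscale k (mat 1)) = 0"
    unfolding char using lk by (simp_all add: power2_eq_square algebra_simps)
  then obtain v w where v: "v \<noteq> 0" "M *v v = l *s v" and w: "w \<noteq> 0" "M *v w = k *s w"
    using exists_eigenvector by blast
  define D where "D = v $ 1 * w $ 2 - w $ 1 * v $ 2"
  have mv: "M $ 1 $ 1 * v $ 1 + M $ 1 $ 2 * v $ 2 = l * v $ 1"
    "M $ 2 $ 1 * v $ 1 + M $ 2 $ 2 * v $ 2 = l * v $ 2"
    using v(2) by (auto simp: vec_eq_iff forall_2 matrix_vector_mult_def sum_2)
  have mw: "M $ 1 $ 1 * w $ 1 + M $ 1 $ 2 * w $ 2 = k * w $ 1"
    "M $ 2 $ 1 * w $ 1 + M $ 2 $ 2 * w $ 2 = k * w $ 2"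
    using w(2) by (auto simp: vec_eq_iff forall_2 matrix_vector_mult_def sum_2)
  have D: "D \<noteq> 0"
  proof
    assume "D = 0"
    then have par: "v $ 1 * w $ 2 = w $ 1 * v $ 2" by (simp add: D_def)
    have "(l - k) * (v $ 1 * w $ 1) = 0" "(l - k) * (v $ 1 * w $ 2) = 0" "(l - k) * (v $ 2 * w $ 2) = 0" 
      using mv mw par by algebra+
    then have z: "v $ 1 * w $ 1 = 0" "v $ 1 * w $ 2 = 0" "v $ 2 * w $ 2 = 0" "w $ 1 * v $ 2 = 0"
      using lk(2) par by auto
    have "v $ 1 \<noteq> 0 \<or> v $ 2 \<noteq> 0" "w $ 1 \<noteq> 0 \<or> w $ 2 \<noteq> 0"
      using v(1) w(1) by (auto simp: vec_eq_iff forall_2)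
    then show False using z by auto
  qed
  define g :: "complex^2^2" where "g = vector [vector [v $ 1 / D, w $ 1], vector [v $ 2 / D, w $ 2]]"
  have g: "g $ 1 $ 1 = v $ 1 / D" "g $ 1 $ 2 = w $ 1" "g $ 2 $ 1 = v $ 2 / D" "g $ 2 $ 2 = w $ 2"
    by (simp_all add: g_def)
  have dg: "det g = 1" using D by (simp add: det_2 g D_def diff_divide_distrib[symmetric]) 
  have ddet: "det (diag2 l k) = 1" by (simp add: det_2 lk)
  have "M ** g = g ** diag2 l k"
    by (rule mat2_eqI) (use mv mw D in \<open>simp_all add: g field_simps\<close>)
  then have "M ** (g ** adj2 g) = g ** diag2 l k ** adj2 g" by (simp add: matrix_mul_assoc)
  then have M: "M = g ** diag2 l k ** adj2 g" by (simp add: mult_adj2 dg)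
  have "psl g \<in> carrier PSL2C" using dg by (auto simp: carrier_PSL2C)
  moreover have "psl M = psl g \<otimes>\<^bsub>PSL2C\<^esub> psl (diag2 l k) \<otimes>\<^bsub>PSL2C\<^esub> inv\<^bsub>PSL2C\<^esub> (psl g)"
    by (simp add: psl_mult inv_PSL2C dg ddet det_mul det_adj2 M[symmetric])
  ultimately show ?thesis unfolding conj_to_diag_def l_def k_def by blast
qed

lemma trace_of_conj_to_diag:
  assumes "conj_to_diag (psl M) z"
  shows "trace M = exp (z / 2) + exp (- z / 2) \<or> trace M = - (exp (z / 2) + exp (- z / 2))"
proof -
  let ?D = "diag2 (exp (z / 2)) (exp (- z / 2))"
  obtain g where g: "det g = 1" "psl M = psl g \<otimes>\<^bsub>PSL2C\<^esub> psl ?D \<otimes>\<^bsub>PSL2C\<^esub> inv\<^bsub>PSL2C\<^esub> (psl g)"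
    using assms by (auto simp: conj_to_diag_def carrier_PSL2C)

  have "det ?D = 1" by (simp add: det_2 flip: exp_add)
  then have "psl M = psl (g ** ?D ** adj2 g)"
    using g by (simp add: psl_mult inv_PSL2C det_mul det_adj2)
  then have M: "M = g ** ?D ** adj2 g \<or> M = - (g ** ?D ** adj2 g)" by (simp add: psl_eq_iff)
  have "trace (g ** ?D ** adj2 g) = det g * (exp (z / 2) + exp (- z / 2))"
    by (simp add: trace_2 det_2 algebra_simps)
  then have "trace (g ** ?D ** adj2 g) = exp (z / 2) + exp (- z / 2)" using g by simp
  moreover have "trace (- X) = - trace X" for X :: "complex^2^2" by (simp add: trace_2)
  ultimately show ?thesis using M by auto
qed

text \<open>The trace determines \<open>exp (z / 2)\<close> up to sign and inversion. The sign is invisible in \<open>exp z\<close>, the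
  inversion is excluded by \<open>Re z > 0\<close>, and the bound on the imaginary part selects the logarithm.\<close>

lemma complex_length_eqI:
  assumes "det M = 1" "trace M = exp (z / 2) + exp (- z / 2)" "Re z > 0" "\<bar>Im z\<bar> < pi"
  shows "loxodromic (psl M)" "complex_length (psl M) = z"
proof -
  have "exp (z / 2) \<noteq> exp (- z / 2)"
  proof
    assume "exp (z / 2) = exp (- z / 2)"
    then have "norm (exp (z / 2)) = norm (exp (- z / 2))" by simp
    then show False using assms(3) by simp
  qed
  then have z: "conj_to_diag (psl M) z" by (rule conj_to_diag_of_trace[OF assms(1,2)])
  then show "loxodromic (psl M)" using assms(3) by (auto simp: loxodromic_def)
  show "complex_length (psl M) = z"
    unfolding complex_length_def
  proof (rule some_equality)
    show "0 < Re z \<and> Im z \<in> {- pi..pi} \<and> conj_to_diag (psl M) z" using z assms by auto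
  next
    fix y assume y: "0 < Re y \<and> Im y \<in> {- pi..pi} \<and> conj_to_diag (psl M) y"
    define l where "l = exp (z / 2)"
    define q where "q = exp (y / 2)"
    have inv: "exp (- z / 2) = inverse l" "exp (- y / 2) = inverse q" "l \<noteq> 0" "q \<noteq> 0"
      by (auto simp: l_def q_def exp_minus)
    have "l + inverse l = q + inverse q \<or> l + inverse l = - (q + inverse q)"
      using trace_of_conj_to_diag[of M y] y assms(2) inv by (auto simp: l_def q_def)
    then have "(l - q) * (l * q - 1) = 0 \<or> (l + q) * (l * q + 1) = 0"
      using inv(3,4) by (auto simp: field_simps)
    moreover have "norm (l * q) > 1"
      using y assms(3) by (simp add: l_def q_def norm_mult flip: exp_add)
    then have "l * q - 1 \<noteq> 0" "l * q + 1 \<noteq> 0" by (auto simp: add_eq_0_iff2)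
    ultimately have "l - q = 0 \<or> l + q = 0" by (metis mult_eq_0_iff)
    then have "l = q \<or> l = - q" by (simp add: eq_neg_iff_add_eq_0)
    then have "l\<^sup>2 = q\<^sup>2" by auto
    then have "exp z = exp y" by (simp add: l_def q_def flip: exp_double)
    then obtain k :: int where k: "z = y + of_int (2 * k) * pi * \<i>" using exp_eq by blast
    then have "Im z - Im y = 2 * of_int k * pi" by simp
    moreover have "\<bar>Im z - Im y\<bar> < 2 * pi" using assms(4) y by auto
    ultimately have "\<bar>2 * real_of_int k * pi\<bar> < 2 * pi" by simp
    then have "\<bar>of_int k\<bar> < (1 :: real)" by (simp add: abs_mult)
    then have "k = 0" by linarith
    then show "y = z" using k by simp
  qed
qed

text \<open>An inverse of \<open>z \<mapsto> 2 cosh (z/2)\<close>, holomorphic near the half line \<open>{2<..}\<close>.\<close>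

definition length_of_trace :: "complex \<Rightarrow> complex" where
  "length_of_trace \<tau> = 2 * Ln (\<tau> / 2 + csqrt ((\<tau> / 2)\<^sup>2 - 1))"

lemma length_of_trace_cosh: "exp (length_of_trace \<tau> / 2) + exp (- length_of_trace \<tau> / 2) = \<tau>"
proof -
  define r where "r = csqrt ((\<tau> / 2)\<^sup>2 - 1)"
  have r: "r\<^sup>2 = (\<tau> / 2)\<^sup>2 - 1" by (simp add: r_def)
  have m: "(\<tau> / 2 + r) * (\<tau> / 2 - r) = 1" using r by (simp add: power2_eq_square algebra_simps)
  then have nz: "\<tau> / 2 + r \<noteq> 0" by auto
  then have "exp (length_of_trace \<tau> / 2) = \<tau> / 2 + r" by (simp add: length_of_trace_def r_def)
  moreover have "inverse (\<tau> / 2 + r) = \<tau> / 2 - r" using m nz by (simp add: inverse_unique)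
  ultimately show ?thesis by (simp add: exp_minus)
qed

lemma length_of_trace_real:
  assumes "r > 0"
  shows "length_of_trace (of_real (2 * cosh r)) = of_real (2 * r)"
    "(length_of_trace has_field_derivative 1 / of_real (sinh r)) (at (of_real (2 * cosh r)))"
proof -
  let ?\<tau> = "of_real (2 * cosh r) :: complex"
  have s: "sinh r > 0" using assms by simp
  have e: "(?\<tau> / 2)\<^sup>2 - 1 = of_real ((sinh r)\<^sup>2)"
    by (simp add: sinh_square_eq flip: of_real_power)
  have sq: "csqrt ((?\<tau> / 2)\<^sup>2 - 1) = of_real (sinh r)"
    unfolding e using s by (subst csqrt_of_real_nonneg) auto
  have arg: "?\<tau> / 2 + csqrt ((?\<tau> / 2)\<^sup>2 - 1) = of_real (exp r)"
    unfolding sq by (simp add: cosh_plus_sinh flip: of_real_add)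
  show "length_of_trace ?\<tau> = of_real (2 * r)"
    unfolding length_of_trace_def arg by (simp add: Ln_of_real)
  have n1: "(?\<tau> / 2)\<^sup>2 - 1 \<notin> \<real>\<^sub>\<le>\<^sub>0" unfolding e using s
    by (simp add: complex_nonpos_Reals_iff not_le flip: of_real_power)
  have n2: "?\<tau> / 2 + csqrt ((?\<tau> / 2)\<^sup>2 - 1) \<notin> \<real>\<^sub>\<le>\<^sub>0" unfolding arg by simp
  have d1: "((\<lambda>\<tau>. (\<tau> / 2)\<^sup>2 - 1) has_field_derivative 2 * (?\<tau> / 2) * (1 / 2)) (at ?\<tau>)"
    by (auto intro!: derivative_eq_intros)
  have d2: "((\<lambda>\<tau>. csqrt ((\<tau> / 2)\<^sup>2 - 1)) has_field_derivative
      inverse (2 * of_real (sinh r)) * (2 * (?\<tau> / 2) * (1 / 2))) (at ?\<tau>)"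
    using DERIV_chain2[OF has_field_derivative_csqrt[OF n1] d1] unfolding sq .
  have d3: "((\<lambda>\<tau>. \<tau> / 2 + csqrt ((\<tau> / 2)\<^sup>2 - 1)) has_field_derivative
      1 / 2 + inverse (2 * of_real (sinh r)) * (2 * (?\<tau> / 2) * (1 / 2))) (at ?\<tau>)"
    by (intro DERIV_add d2) (auto intro!: derivative_eq_intros)
  show "(length_of_trace has_field_derivative 1 / of_real (sinh r)) (at ?\<tau>)"
    unfolding length_of_trace_def[abs_def]
  proof (rule DERIV_cong[OF DERIV_cmult[OF DERIV_chain2[OF has_field_derivative_Ln[OF n2] d3], of 2]])
    have E: "complex_of_real (exp r) = of_real (cosh r) + of_real (sinh r)"
      by (simp add: cosh_plus_sinh flip: of_real_add)
    have "complex_of_real (cosh r) + of_real (sinh r) \<noteq> 0" "complex_of_real (sinh r) \<noteq> 0"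
      using s unfolding E[symmetric] by auto
    then show "2 * (inverse (?\<tau> / 2 + csqrt ((?\<tau> / 2)\<^sup>2 - 1)) *
        (1 / 2 + inverse (2 * of_real (sinh r)) * (2 * (?\<tau> / 2) * (1 / 2)))) = 1 / of_real (sinh r)"
      unfolding arg E by (simp add: field_simps)
  qed
qed

section \<open>Ordered products\<close>

text \<open>The row sum norm: it is submultiplicative and gives the identity norm \<open>1\<close>.\<close>

definition nrm :: "complex^2^2 \<Rightarrow> real" where
  "nrm A = max (cmod (A $ 1 $ 1) + cmod (A $ 1 $ 2)) (cmod (A $ 2 $ 1) + cmod (A $ 2 $ 2))"

lemma nrm_nonneg [simp]: "nrm A \<ge> 0"
  by (simp add: nrm_def le_max_iff_disj)

lemma nrm_zero [simp]: "nrm 0 = 0"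
  by (simp add: nrm_def)

lemma nrm_mat_1 [simp]: "nrm (mat 1) = 1"
  by (simp add: nrm_def)

lemma nrm_cscale: "nrm (cscale c A) = cmod c * nrm A"
  by (simp add: nrm_def norm_mult max_mult_distrib_left distrib_left)

lemma nrm_triangle: "nrm (A + B) \<le> nrm A + nrm B"
  unfolding nrm_def vector_add_component
  by (rule max.boundedI)
     (rule order_trans[OF add_mono[OF norm_triangle_ineq norm_triangle_ineq]], linarith)+

lemma nrm_minus_commute: "nrm (A - B) = nrm (B - A)"
  by (simp add: nrm_def norm_minus_commute)

lemma nrm_triangle4: "nrm (A - C) \<le> nrm (A - B) + nrm (B - C)"
  using nrm_triangle[of "A - B" "B - C"] by simp

lemma nrm_mult: "nrm (A ** B) \<le> nrm A * nrm B"
proof -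
  have row: "cmod ((A ** B) $ i $ 1) + cmod ((A ** B) $ i $ 2) \<le> (cmod (A $ i $ 1) + cmod (A $ i $ 2)) * nrm B" for i
  proof -
    have "cmod ((A ** B) $ i $ 1) + cmod ((A ** B) $ i $ 2) \<le>
        (cmod (A $ i $ 1 * B $ 1 $ 1) + cmod (A $ i $ 2 * B $ 2 $ 1)) +
        (cmod (A $ i $ 1 * B $ 1 $ 2) + cmod (A $ i $ 2 * B $ 2 $ 2))"
      unfolding mat2_nth by (intro add_mono norm_triangle_ineq)
    also have "\<dots> = cmod (A $ i $ 1) * (cmod (B $ 1 $ 1) + cmod (B $ 1 $ 2)) +
        cmod (A $ i $ 2) * (cmod (B $ 2 $ 1) + cmod (B $ 2 $ 2))"
      by (simp add: norm_mult algebra_simps)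
    also have "\<dots> \<le> cmod (A $ i $ 1) * nrm B + cmod (A $ i $ 2) * nrm B"
      by (intro add_mono mult_left_mono) (auto simp: nrm_def)
    finally show ?thesis by (simp add: algebra_simps)
  qed
  have "nrm (A ** B) \<le> max ((cmod (A $ 1 $ 1) + cmod (A $ 1 $ 2)) * nrm B) ((cmod (A $ 2 $ 1) + cmod (A $ 2 $ 2)) * nrm B)"
    unfolding nrm_def[of "A ** B"] using row[of 1] row[of 2] by (intro max.mono)
  also have "\<dots> = nrm A * nrm B"
    unfolding nrm_def[of A] by (simp add: max_mult_distrib_right)
  finally show ?thesis .
qed

lemma cmod_le_nrm: "cmod (A $ i $ j) \<le> nrm A"
proof -
  have "\<forall>i j. cmod (A $ i $ j) \<le> nrm A"
    unfolding forall_2 nrm_def by (auto simp: le_max_iff_disj)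
  then show ?thesis by blast
qed

lemma nrm_le_norm: "nrm A \<le> 2 * norm A"
proof -
  have "cmod (A $ i $ j) \<le> norm A" for i j
    by (meson Finite_Cartesian_Product.norm_nth_le order_trans)
  from this[of 1 1] this[of 1 2] this[of 2 1] this[of 2 2] show ?thesis
    unfolding nrm_def by linarith
qed

lemma norm_le_nrm: "norm A \<le> 4 * nrm A"
proof -
  have "norm A \<le> (\<Sum>i\<in>UNIV. norm (A $ i))" by (simp add: norm_vec_def L2_set_le_sum)
  also have "\<dots> \<le> (\<Sum>i\<in>UNIV. \<Sum>j\<in>UNIV. cmod (A $ i $ j))"
    by (intro sum_mono) (simp add: norm_vec_def L2_set_le_sum)
  also have "\<dots> \<le> 4 * nrm A"
    using cmod_le_nrm[of A 1 1] cmod_le_nrm[of A 1 2] cmod_le_nrm[of A 2 1] cmod_le_nrm[of A 2 2]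
    by (simp add: sum_2)
  finally show ?thesis .
qed

lemma nrm_genm: "nrm (genm n) \<le> 3 * norm n"
proof -
  have c: "\<bar>n $ 1\<bar> \<le> norm n" "\<bar>n $ 2\<bar> \<le> norm n" "\<bar>n $ 3\<bar> \<le> norm n"
    using component_le_norm_cart by blast+
  have "cmod (genm n $ 1 $ 1) + cmod (genm n $ 1 $ 2) = \<bar>n $ 3\<bar> + \<bar>n $ 1 + n $ 2\<bar>"
    "cmod (genm n $ 2 $ 1) + cmod (genm n $ 2 $ 2) = \<bar>n $ 2 - n $ 1\<bar> + \<bar>n $ 3\<bar>"
    by (simp_all del: of_real_add of_real_diff)
  then show ?thesis unfolding nrm_def using c by linarith
qed

lemma cmod_exp_remainder: "cmod (exp a - 1 - a) \<le> exp (cmod a) - 1 - cmod a"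
proof -
  have "exp a - 1 - a = (\<Sum>n. inverse (fact (n + 2)) *\<^sub>R a ^ (n + 2))"
    by (subst exp_first_two_terms) simp
  moreover have "exp (cmod a) - 1 - cmod a = (\<Sum>n. inverse (fact (n + 2)) *\<^sub>R cmod a ^ (n + 2))"
    by (subst exp_first_two_terms) simp
  moreover have "summable (\<lambda>n. inverse (fact (n + 2)) *\<^sub>R cmod a ^ (n + 2))"
    using summable_exp_generic[of "cmod a"] by (subst summable_iff_shift) (simp add: divide_inverse_commute)
  ultimately show ?thesis
    by (simp only:) (rule norm_suminf_le, auto simp: norm_power norm_mult)
qed

lemma cosh_sinh_remainder:
  fixes a :: complex
  shows "cmod (cosh a - 1) \<le> exp (cmod a) - 1 - cmod a"
    and "cmod (sinh a - a) \<le> exp (cmod a) - 1 - cmod a"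
    and "cmod (sinh a) \<le> cmod a * exp (cmod a)"
proof -
  let ?r = "exp (cmod a) - 1 - cmod a"
  have c: "cosh a - 1 = ((exp a - 1 - a) + (exp (- a) - 1 - (- a))) / 2"
    "sinh a - a = ((exp a - 1 - a) - (exp (- a) - 1 - (- a))) / 2"
    by (simp_all add: cosh_def sinh_def scaleR_conv_of_real field_simps)
  have b: "cmod (exp a - 1 - a) \<le> ?r" "cmod (exp (- a) - 1 - (- a)) \<le> ?r"
    using cmod_exp_remainder[of a] cmod_exp_remainder[of "- a"] by simp_all
  show "cmod (cosh a - 1) \<le> ?r"
    unfolding c using norm_triangle_ineq[of "exp a - 1 - a" "exp (- a) - 1 - (- a)"] b
    by (simp only: norm_divide) simp
  show 2: "cmod (sinh a - a) \<le> ?r"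
    unfolding c using norm_triangle_ineq4[of "exp a - 1 - a" "exp (- a) - 1 - (- a)"] b
    by (simp only: norm_divide) simp
  have "cmod (sinh a) \<le> cmod (sinh a - a) + cmod a"
    by (metis diff_add_cancel norm_triangle_ineq)
  also have "\<dots> \<le> exp (cmod a) - 1" using 2 by simp
  also have "\<dots> \<le> cmod a * exp (cmod a)"
  proof -
    have "1 - cmod a \<le> exp (- cmod a)" using exp_ge_add_one_self[of "- cmod a"] by simp
    then have "(1 - cmod a) * exp (cmod a) \<le> exp (- cmod a) * exp (cmod a)"
      by (intro mult_right_mono) auto
    then show ?thesis by (simp add: algebra_simps flip: exp_add)
  qed
  finally show "cmod (sinh a) \<le> cmod a * exp (cmod a)" .
qed

lemma exp_remainder_scale:
  fixes k x :: real
  assumes "k \<ge> 1" "x \<ge> 0"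
  shows "k * (exp x - 1 - x) \<le> exp (k * x) - 1 - k * x"
proof -
  let ?f = "\<lambda>x. exp (k * x) - 1 - k * x - k * (exp x - 1 - x)"
  have "?f 0 \<le> ?f x"
  proof (rule DERIV_nonneg_imp_nondecreasing[OF assms(2)])
    fix y :: real assume y: "0 \<le> y" "y \<le> x"
    have "(?f has_real_derivative k * (exp (k * y) - exp y)) (at y)"
      by (auto intro!: derivative_eq_intros simp: algebra_simps)
    moreover have "y \<le> k * y" using assms(1) y(1) by (simp add: mult_le_cancel_right1)
    then have "k * (exp (k * y) - exp y) \<ge> 0" using assms(1) by simp
    ultimately show "\<exists>D. (?f has_real_derivative D) (at y) \<and> D \<ge> 0" by blast
  qed
  then show ?thesis by simp
qed

text \<open>The constant \<open>k\<close> bounds the norms of both the identity and the generator; it is at least \<open>1\<close>, so that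
  scaling the remainder of the exponential by \<open>k\<close> can be moved into the exponent.\<close>

lemma hexp_remainder:
  assumes "norm n \<le> N"
  defines "k \<equiv> 1 + 3 * N"
  shows "nrm (hexp a n - mat 1 - cscale a (genm n)) \<le> exp (k * cmod a) - 1 - k * cmod a"
    and "nrm (hexp a n - mat 1) \<le> exp (k * cmod a) - 1"
    and "nrm (hexp a n) \<le> exp (k * cmod a)"
proof -
  let ?r = "exp (cmod a) - 1 - cmod a"
  have k: "k \<ge> 1" using assms norm_ge_zero[of n] by (simp add: k_def del: norm_ge_zero)
  have g: "nrm (genm n) \<le> 3 * N" using nrm_genm[of n] assms by simp
  have r: "?r \<ge> 0" using exp_ge_add_one_self[of "cmod a"] by linarith
  have "hexp a n - mat 1 - cscale a (genm n) = cscale (cosh a - 1) (mat 1) + cscale (sinh a - a) (genm n)"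
    by (rule mat2_eqI) (simp_all add: hexp_def algebra_simps)
  then have "nrm (hexp a n - mat 1 - cscale a (genm n)) \<le> cmod (cosh a - 1) + cmod (sinh a - a) * nrm (genm n)"
    using nrm_triangle[of "cscale (cosh a - 1) (mat 1)" "cscale (sinh a - a) (genm n)"]
      by (simp add: nrm_cscale)
  also have "\<dots> \<le> ?r + ?r * (3 * N)"
    using g r by (intro add_mono mult_mono cosh_sinh_remainder) auto
  also have "\<dots> = k * ?r" by (simp add: k_def algebra_simps)
  also have "\<dots> \<le> exp (k * cmod a) - 1 - k * cmod a" by (rule exp_remainder_scale[OF k]) simp
  finally show 1: "nrm (hexp a n - mat 1 - cscale a (genm n)) \<le> exp (k * cmod a) - 1 - k * cmod a" .
  have "hexp a n - mat 1 = (hexp a n - mat 1 - cscale a (genm n)) + cscale a (genm n)" by simp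
  then have "nrm (hexp a n - mat 1) \<le> (exp (k * cmod a) - 1 - k * cmod a) + cmod a * nrm (genm n)"
    using nrm_triangle[of "hexp a n - mat 1 - cscale a (genm n)" "cscale a (genm n)"] 1
    by (simp only: nrm_cscale)
  also have "cmod a * nrm (genm n) \<le> cmod a * k" using g by (intro mult_left_mono) (auto simp: k_def)
  finally show 2: "nrm (hexp a n - mat 1) \<le> exp (k * cmod a) - 1" by (simp add: mult.commute)
  have "hexp a n = (hexp a n - mat 1) + mat 1" by simp
  then show "nrm (hexp a n) \<le> exp (k * cmod a)"
    using nrm_triangle[of "hexp a n - mat 1" "mat 1"] 2 by simp
qed

lemma hexp_lipschitz: "nrm (hexp a n - hexp a n') \<le> 3 * cmod a * exp (cmod a) * norm (n - n')"
proof -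
  have "hexp a n - hexp a n' = cscale (sinh a) (genm (n - n'))"
    by (rule mat2_eqI) (simp_all add: hexp_def algebra_simps)
  then have "nrm (hexp a n - hexp a n') = cmod (sinh a) * nrm (genm (n - n'))" by (simp add: nrm_cscale)
  also have "\<dots> \<le> (cmod a * exp (cmod a)) * (3 * norm (n - n'))"
    by (intro mult_mono cosh_sinh_remainder nrm_genm) auto
  finally show ?thesis by (simp add: algebra_simps)
qed

subsection \<open>Products along a list of points\<close>

fun tagprod :: "complex \<Rightarrow> (real \<Rightarrow> real \<Rightarrow> real) \<Rightarrow> (real \<Rightarrow> real^3) \<Rightarrow> real list \<Rightarrow> complex^2^2" where
  "tagprod c m \<tau> (a # b # xs) = hexp (c * of_real (m a b)) (\<tau> a) ** tagprod c m \<tau> (b # xs)"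
| "tagprod c m \<tau> _ = mat 1"

fun tagsum :: "(real \<Rightarrow> real \<Rightarrow> real) \<Rightarrow> (real \<Rightarrow> real^3) \<Rightarrow> real list \<Rightarrow> real^3" where
  "tagsum m \<tau> (a # b # xs) = m a b *\<^sub>R \<tau> a + tagsum m \<tau> (b # xs)"
| "tagsum m \<tau> _ = 0"

fun total :: "(real \<Rightarrow> real \<Rightarrow> 'a::monoid_add) \<Rightarrow> real list \<Rightarrow> 'a" where
  "total m (a # b # xs) = m a b + total m (b # xs)"
| "total m _ = 0"

lemma total_nonneg: "(\<And>a b. m a b \<ge> (0 :: real)) \<Longrightarrow> total m xs \<ge> 0"
  by (induction xs rule: induct_list012) auto

text \<open>Both bounds are multiplicative along the list: if \<open>F\<close> and \<open>P\<close> deviate from \<open>1\<close> by at most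
  \<open>exp x - 1\<close> and \<open>exp y - 1\<close>, then \<open>F P\<close> deviates by at most \<open>exp (x + y) - 1\<close>, and likewise for the deviations
  from the linear parts.\<close>

lemma tagprod_first_order:
  assumes m: "\<And>a b. m a b \<ge> 0" and N: "\<And>r. norm (\<tau> r) \<le> N"
  defines "k \<equiv> 1 + 3 * N"
  shows "nrm (tagprod c m \<tau> xs - mat 1) \<le> exp (k * (cmod c * total m xs)) - 1 \<and>
     nrm (tagprod c m \<tau> xs - mat 1 - cscale c (genm (tagsum m \<tau> xs)))
       \<le> exp (k * (cmod c * total m xs)) - 1 - k * (cmod c * total m xs)"
proof (induction xs rule: induct_list012)
  case (3 a b xs)
  let ?P = "tagprod c m \<tau> (b # xs)" and ?F = "hexp (c * of_real (m a b)) (\<tau> a)"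
  let ?A = "cscale c (genm (tagsum m \<tau> (b # xs)))" and ?B = "cscale (c * of_real (m a b)) (genm (\<tau> a))"
  define x where "x = k * cmod (c * of_real (m a b))"
  define y where "y = k * (cmod c * total m (b # xs))"
  have k: "k \<ge> 1" using N[of 0] norm_ge_zero[of "\<tau> 0"] by (simp add: k_def del: norm_ge_zero)
  have xy: "k * (cmod c * total m (a # b # xs)) = x + y" "x \<ge> 0" "y \<ge> 0"
    using m k total_nonneg[of m "b # xs", OF m] by (auto simp: x_def y_def norm_mult algebra_simps)
  have F: "nrm (?F - mat 1 - ?B) \<le> exp x - 1 - x" "nrm (?F - mat 1) \<le> exp x - 1" "nrm ?F \<le> exp x"
    unfolding x_def k_def by (rule hexp_remainder[OF N])+
  have P: "nrm (?P - mat 1) \<le> exp y - 1" "nrm (?P - mat 1 - ?A) \<le> exp y - 1 - y"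
    using 3(2) unfolding y_def by auto
  have eq: "?F ** ?P - mat 1 = ?F ** (?P - mat 1) + (?F - mat 1)"
    by (rule mat2_eqI) (simp_all add: algebra_simps)
  have "nrm (?F ** ?P - mat 1) \<le> nrm ?F * nrm (?P - mat 1) + nrm (?F - mat 1)"
    unfolding eq
    using nrm_triangle[of "?F ** (?P - mat 1)" "?F - mat 1"] nrm_mult[of ?F "?P - mat 1"] by linarith
  also have "\<dots> \<le> exp x * (exp y - 1) + (exp x - 1)"
    using F P by (intro add_mono mult_mono) auto
  finally have 1: "nrm (?F ** ?P - mat 1) \<le> exp (x + y) - 1" by (simp add: exp_add algebra_simps)
  have "cscale c (genm (tagsum m \<tau> (a # b # xs))) = ?B + ?A"
    by (rule mat2_eqI) (simp_all add: algebra_simps)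
  then have eq': "?F ** ?P - mat 1 - cscale c (genm (tagsum m \<tau> (a # b # xs))) =
      ((?F - mat 1) ** (?P - mat 1) + (?F - mat 1 - ?B)) + (?P - mat 1 - ?A)"
    by (simp, intro mat2_eqI) (simp_all add: algebra_simps del: cscale_nth)
  have "nrm (?F ** ?P - mat 1 - cscale c (genm (tagsum m \<tau> (a # b # xs)))) \<le>
      nrm (?F - mat 1) * nrm (?P - mat 1) + nrm (?F - mat 1 - ?B) + nrm (?P - mat 1 - ?A)"
    unfolding eq' using nrm_triangle[of "(?F - mat 1) ** (?P - mat 1) + (?F - mat 1 - ?B)" "?P - mat 1 - ?A"]
      nrm_triangle[of "(?F - mat 1) ** (?P - mat 1)" "?F - mat 1 - ?B"] nrm_mult[of "?F - mat 1" "?P - mat 1"]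
    by linarith
  also have "\<dots> \<le> (exp x - 1) * (exp y - 1) + (exp x - 1 - x) + (exp y - 1 - y)"
    using F P xy by (intro add_mono mult_mono) auto
  also have "\<dots> = exp (x + y) - 1 - (x + y)" by (simp add: exp_add algebra_simps)
  finally show ?case using 1 unfolding xy by simp
qed (auto intro!: mat2_eqI simp: nrm_def)

text \<open>The factors are exchanged one after the other, each at the cost of its mass times the distance between its
  two tags.\<close>

lemma tagprod_compare:
  assumes m: "\<And>a b. m a b \<ge> 0" and N: "\<And>r. norm (\<tau> r) \<le> N" "\<And>r. norm (\<tau>' r) \<le> N"
    and \<omega>: "\<omega> \<ge> 0" "successively (\<lambda>a b. m a b = 0 \<or> norm (\<tau> a - \<tau>' a) \<le> \<omega>) xs"
  defines "k \<equiv> 1 + 3 * N"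
  shows "nrm (tagprod c m \<tau> xs - tagprod c m \<tau>' xs)
     \<le> 3 * \<omega> * (cmod c * total m xs) * exp (k * (cmod c * total m xs))"
  using \<omega>(2)
proof (induction xs rule: induct_list012)
  case (3 a b xs)
  let ?P = "tagprod c m \<tau> (b # xs)" and ?F = "hexp (c * of_real (m a b)) (\<tau> a)"
  let ?P' = "tagprod c m \<tau>' (b # xs)" and ?F' = "hexp (c * of_real (m a b)) (\<tau>' a)"
  define x where "x = cmod (c * of_real (m a b))"
  define y where "y = cmod c * total m (b # xs)"
  have k: "k \<ge> 1" using N(1)[of 0] norm_ge_zero[of "\<tau> 0"] by (simp add: k_def del: norm_ge_zero)
  have xy: "cmod c * total m (a # b # xs) = x + y" "x \<ge> 0" "y \<ge> 0"
    using m total_nonneg[of m "b # xs", OF m] by (auto simp: x_def y_def norm_mult algebra_simps)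
  have "nrm (?P - mat 1) \<le> exp (k * y) - 1"
    using tagprod_first_order[of m \<tau> N c "b # xs"] m N unfolding y_def k_def by blast
  then have P: "nrm ?P \<le> exp (k * y)"
    using nrm_triangle[of "?P - mat 1" "mat 1"] by simp
  have F': "nrm ?F' \<le> exp (k * x)" unfolding x_def k_def by (rule hexp_remainder[OF N(2)])
  have FF: "nrm (?F - ?F') \<le> 3 * \<omega> * x * exp (k * x)"
  proof (cases "m a b = 0")
    case True
    then show ?thesis using xy(2) \<omega>(1) by simp
  next
    case False
    then have "norm (\<tau> a - \<tau>' a) \<le> \<omega>" using 3(3) by simp
    then have "3 * x * exp x * norm (\<tau> a - \<tau>' a) \<le> 3 * x * exp (k * x) * \<omega>"
      using xy(2) k \<omega>(1) by (intro mult_mono) (auto simp: mult_le_cancel_right1)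
    then show ?thesis using hexp_lipschitz[of "c * of_real (m a b)" "\<tau> a" "\<tau>' a"]
      by (simp add: x_def algebra_simps)
  qed
  have IH: "nrm (?P - ?P') \<le> 3 * \<omega> * y * exp (k * y)"
    using 3 by (auto simp: y_def)
  have "?F ** ?P - ?F' ** ?P' = (?F - ?F') ** ?P + ?F' ** (?P - ?P')"
    by (rule mat2_eqI) (simp_all add: algebra_simps)
  then have "nrm (?F ** ?P - ?F' ** ?P') \<le> nrm (?F - ?F') * nrm ?P + nrm ?F' * nrm (?P - ?P')"
    using nrm_triangle[of "(?F - ?F') ** ?P"
      "?F' ** (?P - ?P')"] nrm_mult[of "?F - ?F'" ?P] nrm_mult[of ?F' "?P - ?P'"]
    by simp
  also have "\<dots> \<le> (3 * \<omega> * x * exp (k * x)) * exp (k * y) + exp (k * x) * (3 * \<omega> * y * exp (k * y))"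
    using FF P F' IH \<omega>(1) xy(2) by (intro add_mono mult_mono) auto
  also have "\<dots> = 3 * \<omega> * (x + y) * exp (k * (x + y))"
    by (simp add: exp_add algebra_simps)
  finally show ?case unfolding xy by simp
qed auto

text \<open>Factors with the same tag belong to one one-parameter group, so the masses of the two halves of an
  interval add up in the exponent when both inherit its tag. The refinement is therefore exact, and
  comparing two subdivisions reduces to comparing two families of tags on their common refinement.\<close>

lemma tagprod_insort:
  assumes "sorted_wrt (<) xs" "hd xs < z" "z < last xs" "z \<notin> set xs"
    and "\<And>a b. a \<in> set xs \<Longrightarrow> b \<in> set xs \<Longrightarrow> a < z \<Longrightarrow> z < b \<Longrightarrow> m a b = m a z + m z b"
    and "\<And>a. a \<in> set xs \<Longrightarrow> a < z \<Longrightarrow> set xs \<inter> {a<..<z} = {} \<Longrightarrow> \<tau> z = \<tau> a"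
    and "\<And>r. mink (\<tau> r) (\<tau> r) = 1"
  shows "tagprod c m \<tau> (insort z xs) = tagprod c m \<tau> xs"
  using assms(1-6)
proof (induction xs rule: induct_list012)
  case (3 a b xs)
  show ?case
  proof (cases "z < b")
    case True
    have "\<tau> z = \<tau> a" using 3 True by (intro 3(8)) auto
    moreover have "m a b = m a z + m z b" using 3 True by (intro 3(7)) auto
    ultimately show ?thesis using 3 True
      by (simp add: distrib_left hexp_add[OF assms(7)] matrix_mul_assoc)
  next
    case False
    have zb: "b < z" using False 3(6) by auto
    have "tagprod c m \<tau> (insort z (b # xs)) = tagprod c m \<tau> (b # xs)"
    proof (rule 3(2))
      fix a' assume a': "a' \<in> set (b # xs)" "a' < z" "set (b # xs) \<inter> {a'<..<z} = {}"
      have "a < a'" using 3(3) a'(1) by auto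
      then show "\<tau> z = \<tau> a'" using a' by (intro 3(8)) auto
    qed (use 3 zb in auto)
    then show ?thesis using 3 zb by (cases xs) (auto simp: not_le)
  qed
qed auto

subsection \<open>Convergence\<close>

text \<open>What the convergence of the ordered products uses of a transversal \<open>[0,d]\<close>: the mass \<open>m\<close> of its
  subintervals, a dense set \<open>G\<close> of points without mass, the set \<open>C\<close> of crossing parameters, the normals \<open>\<nu>\<close>
  of the leaves crossed and the integral \<open>J\<close> of the normals over subintervals. The decisive property is
  that the normals are Lipschitz continuous along \<open>C\<close>.\<close>

locale crossing =
  fixes d :: real and m :: "real \<Rightarrow> real \<Rightarrow> real" and G C :: "real set"
    and \<nu> :: "real \<Rightarrow> real^3" and J :: "real \<Rightarrow> real \<Rightarrow> real^3" and K N :: real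
  assumes d_pos: "d > 0"
    and m_nonneg: "m a b \<ge> 0"
    and m_add: "\<lbrakk>0 \<le> a; a < z; z < b; b \<le> d; z \<in> G\<rbrakk> \<Longrightarrow> m a b = m a z + m z b"
    and m_mono: "\<lbrakk>0 \<le> a'; a' \<le> a; b \<le> b'; b' \<le> d\<rbrakk> \<Longrightarrow> m a b \<le> m a' b'"
    and m_crossing: "\<lbrakk>0 \<le> a; a < b; b \<le> d; m a b > 0\<rbrakk> \<Longrightarrow> C \<inter> {a..b} \<noteq> {}"
    and J_add: "\<lbrakk>0 \<le> a; a < z; z < b; b \<le> d; z \<in> G\<rbrakk> \<Longrightarrow> J a b = J a z + J z b"
    and J_null: "\<lbrakk>0 \<le> a; a < b; b \<le> d; m a b = 0\<rbrakk> \<Longrightarrow> J a b = 0"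
    and J_est: "\<lbrakk>0 \<le> a; a < b; b \<le> d; r \<in> C; a \<le> r; r \<le> b\<rbrakk> \<Longrightarrow> norm (J a b - m a b *\<^sub>R \<nu> r) \<le> K * (b - a) * m a b"
    and C_sub: "C \<subseteq> {0..d}"
    and \<nu>_unit: "r \<in> C \<Longrightarrow> mink (\<nu> r) (\<nu> r) = 1"
    and \<nu>_bound: "r \<in> C \<Longrightarrow> norm (\<nu> r) \<le> N"
    and \<nu>_lip: "r \<in> C \<Longrightarrow> s \<in> C \<Longrightarrow> norm (\<nu> r - \<nu> s) \<le> K * \<bar>r - s\<bar>"
    and K_nonneg: "K \<ge> 0" and N_ge: "N \<ge> 1"
    and G_dense: "0 \<le> a \<Longrightarrow> a < b \<Longrightarrow> b \<le> d \<Longrightarrow> G \<inter> {a<..<b} \<noteq> {}"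
begin

definition subdiv :: "real list \<Rightarrow> bool" where
  "subdiv ts \<longleftrightarrow> ts \<noteq> [] \<and> sorted_wrt (<) ts \<and> hd ts = 0 \<and> last ts = d \<and>
     (\<forall>j. 0 < j \<and> j < length ts - 1 \<longrightarrow> ts ! j \<in> G)"

definition fine_tags :: "real \<Rightarrow> real list \<Rightarrow> (nat \<Rightarrow> real^3) \<Rightarrow> bool" where
  "fine_tags \<delta> ts n \<longleftrightarrow> subdiv ts \<and> (\<forall>j < length ts - 1. ts ! Suc j - ts ! j < \<delta>) \<and>
     (\<forall>j < length ts - 1. m (ts ! j) (ts ! Suc j) > 0 \<longrightarrow> n j \<in> \<nu> ` (C \<inter> {ts ! j..ts ! Suc j}))"

definition oprod :: "complex \<Rightarrow> real list \<Rightarrow> (nat \<Rightarrow> real^3) \<Rightarrow> complex^2^2" where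
  "oprod c ts n = foldr (**) (map (\<lambda>j. hexp (c * of_real (m (ts ! j) (ts ! Suc j))) (n j)) [0..<length ts - 1]) (mat 1)"

lemma foldr_tagprod:
  assumes "\<And>j. j < length xs - 1 \<Longrightarrow> f j = hexp (c * of_real (m (xs ! j) (xs ! Suc j))) (\<tau> (xs ! j))"
  shows "foldr (**) (map f [0..<length xs - 1]) (mat 1) = tagprod c m \<tau> xs"
  using assms
proof (induction xs arbitrary: f rule: induct_list012)
  case (3 a b xs)
  have u: "[0..<length (a # b # xs) - 1] = 0 # map Suc [0..<length (b # xs) - 1]"
    by (simp add: map_Suc_upt upt_conv_Cons del: upt_Suc)
  have "foldr (**) (map (f \<circ> Suc) [0..<length (b # xs) - 1]) (mat 1) = tagprod c m \<tau> (b # xs)"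
    by (rule 3(2)) (use 3(3) in auto)
  then show ?case unfolding u using 3(3)[of 0] by (simp del: upt_Suc)
qed auto

lemma subdiv_set:
  assumes "subdiv ts"
  shows "set ts \<subseteq> insert 0 (insert d G) \<inter> {0..d}" "0 \<in> set ts" "d \<in> set ts" "distinct ts" "sorted ts"
proof -
  have ts: "ts \<noteq> []" "sorted_wrt (<) ts" "hd ts = 0" "last ts = d" using assms by (auto simp: subdiv_def)
  show "0 \<in> set ts" "d \<in> set ts" using ts by (metis hd_in_set last_in_set)+
  show s: "sorted ts" "distinct ts" using ts(2) by (auto simp: strict_sorted_iff)
  show "set ts \<subseteq> insert 0 (insert d G) \<inter> {0..d}"
  proof
    fix z assume "z \<in> set ts"
    then obtain j where j: "j < length ts" "z = ts ! j" by (auto simp: in_set_conv_nth)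
    have "ts ! 0 \<le> ts ! j" "ts ! j \<le> ts ! (length ts - 1)"
      using s(1) j ts(1) by (auto intro!: sorted_nth_mono)
    moreover have "ts ! 0 = 0" "ts ! (length ts - 1) = d"
      using ts by (auto simp: hd_conv_nth last_conv_nth)
    moreover have "z = 0 \<or> z = d \<or> z \<in> G"
      using assms j calculation by (cases "j = 0"; cases "j = length ts - 1") (auto simp: subdiv_def)
    ultimately show "z \<in> insert 0 (insert d G) \<inter> {0..d}" using j by auto
  qed
qed

lemma subdiv_nth: "subdiv ts \<Longrightarrow> j < length ts \<Longrightarrow> 0 \<le> ts ! j \<and> ts ! j \<le> d"
  using subdiv_set(1)[of ts] nth_mem[of j ts] by fastforce

lemma total_sorted:
  assumes add: "\<And>a z b. 0 \<le> a \<Longrightarrow> a < z \<Longrightarrow> z < b \<Longrightarrow> b \<le> d \<Longrightarrow> z \<in> G \<Longrightarrow> f a b = f a z + f z b"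
    and "sorted_wrt (<) (a # xs)" "xs \<noteq> []" "0 \<le> a" "last xs \<le> d" "set (butlast xs) \<subseteq> G"
  shows "total f (a # xs) = f a (last xs)"
  using assms(2-)
proof (induction xs arbitrary: a)
  case (Cons b xs)
  show ?case
  proof (cases "xs = []")
    case False
    then have "last xs \<in> set xs" by simp
    moreover have "total f (b # xs) = f b (last xs)"
      using Cons False by (intro Cons.IH) auto
    ultimately show ?thesis using Cons.prems False
      by (auto intro!: add[symmetric])
  qed simp
qed simp

lemma total_subdiv:
  assumes "subdiv ts"
    and "\<And>a z b. 0 \<le> a \<Longrightarrow> a < z \<Longrightarrow> z < b \<Longrightarrow> b \<le> d \<Longrightarrow> z \<in> G \<Longrightarrow> f a b = f a z + f z b"
  shows "total f ts = f 0 d"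
proof -
  have ts: "ts \<noteq> []" "sorted_wrt (<) ts" "hd ts = 0" "last ts = d" using assms(1) by (auto simp: subdiv_def)
  then obtain xs where xs: "ts = 0 # xs" by (cases ts) auto
  then have ne: "xs \<noteq> []" using ts d_pos by auto
  have "set (butlast xs) \<subseteq> G"
  proof
    fix z assume "z \<in> set (butlast xs)"
    then obtain j where "j < length xs - 1" "z = xs ! j" by (auto simp: in_set_conv_nth nth_butlast)
    then show "z \<in> G" using assms(1) unfolding subdiv_def xs by (auto dest!: spec[of _ "Suc j"])
  qed
  then show ?thesis
    using total_sorted[of f 0 xs] assms(2) ts xs ne by auto
qed

lemma subdiv_refine:
  assumes "subdiv ts" "finite D" "D \<subseteq> insert 0 (insert d G) \<inter> {0..d}"
  shows "subdiv (sorted_list_of_set (set ts \<union> D))"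
proof -
  let ?S = "set ts \<union> D" and ?xs = "sorted_list_of_set (set ts \<union> D)"
  have fin: "finite ?S" and sub: "?S \<subseteq> insert 0 (insert d G) \<inter> {0..d}" and el: "0 \<in> ?S" "d \<in> ?S"
    using assms subdiv_set[OF assms(1)] by auto
  have xs: "sorted_wrt (<) ?xs" "set ?xs = ?S" "?xs \<noteq> []"
    using fin el by auto
  have "hd ?xs = 0"
  proof -
    have "hd ?xs \<in> ?S" using xs by (metis hd_in_set)
    moreover have "hd ?xs \<le> 0"
    proof -
      obtain j where j: "j < length ?xs" "0 = ?xs ! j" using xs(2) el(1) by (metis in_set_conv_nth)
      have "sorted ?xs" by simp
      then show ?thesis using j xs(3) sorted_nth_mono[of ?xs 0 j] by (simp add: hd_conv_nth)
    qed
    ultimately show ?thesis using sub by fastforce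
  qed
  moreover have "last ?xs = d"
  proof -
    have "last ?xs \<in> ?S" using xs by (metis last_in_set)
    moreover have "d \<le> last ?xs"
    proof -
      obtain j where j: "j < length ?xs" "d = ?xs ! j" using xs(2) el(2) by (metis in_set_conv_nth)
      have "sorted ?xs" by simp
      then show ?thesis using j xs(3) by (auto simp: last_conv_nth intro!: sorted_nth_mono)
    qed
    ultimately show ?thesis using sub by fastforce
  qed
  moreover have "?xs ! j \<in> G" if j: "0 < j" "j < length ?xs - 1" for j
  proof -
    have "?xs ! 0 < ?xs ! j" "?xs ! j < ?xs ! (length ?xs - 1)"
      using xs(1) j by (auto simp: sorted_wrt_iff_nth_less)
    moreover have "?xs ! 0 = 0" "?xs ! (length ?xs - 1) = d"
      using \<open>hd ?xs = 0\<close> \<open>last ?xs = d\<close> xs(3) by (auto simp: hd_conv_nth last_conv_nth)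
    moreover have "?xs ! j \<in> ?S" using xs(2) j
      by (metis diff_less less_trans nth_mem zero_less_one length_greater_0_conv xs(3) less_imp_diff_less)
    ultimately show ?thesis using sub by fastforce
  qed
  ultimately show ?thesis using xs unfolding subdiv_def by blast
qed

lemma tagprod_refine:
  assumes "subdiv ts" "finite D" "D \<subseteq> insert 0 (insert d G) \<inter> {0..d}"
    and \<tau>: "\<And>a z. 0 \<le> a \<Longrightarrow> a < z \<Longrightarrow> set ts \<inter> {a<..z} = {} \<Longrightarrow> \<tau> z = \<tau> a" "\<And>r. mink (\<tau> r) (\<tau> r) = 1"
  shows "tagprod c m \<tau> (sorted_list_of_set (set ts \<union> D)) = tagprod c m \<tau> ts"
  using assms(2,3)
proof (induction D)
  case empty
  have "sorted_list_of_set (set ts) = ts"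
    using subdiv_set[OF assms(1)] by (simp add: sorted_list_of_set.idem_if_sorted_distinct)
  then show ?case by simp
next
  case (insert z D)
  let ?xs = "sorted_list_of_set (set ts \<union> D)"
  show ?case
  proof (cases "z \<in> set ts \<union> D")
    case True
    then have "set ts \<union> insert z D = set ts \<union> D" by auto
    then show ?thesis using insert by simp
  next
    case False
    have part: "subdiv ?xs" by (rule subdiv_refine[OF assms(1)]) (use insert in auto)
    have fin: "finite (set ts \<union> D)" using insert by auto
    have z: "0 < z" "z < d" "z \<in> G"
      using insert(4) False subdiv_set[OF assms(1)] by (auto simp: order_less_le)
    have set: "set ?xs = set ts \<union> D" using fin by simp
    have "sorted_list_of_set (insert z (set ts \<union> D)) = insort z ?xs"
      using fin False by (rule sorted_list_of_set_insert)
    then have "tagprod c m \<tau> (sorted_list_of_set (set ts \<union> insert z D)) = tagprod c m \<tau> (insort z ?xs)"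
      by simp
    also have "\<dots> = tagprod c m \<tau> ?xs"
    proof (rule tagprod_insort)
      show "m a b = m a z + m z b" if "a \<in> set ?xs" "b \<in> set ?xs" "a < z" "z < b" for a b
        using that subdiv_set(1)[OF part] z by (intro m_add) auto
      show "\<tau> z = \<tau> a" if "a \<in> set ?xs" "a < z" "set ?xs \<inter> {a<..<z} = {}" for a
      proof (rule \<tau>(1))
        show "0 \<le> a" using that(1) subdiv_set(1)[OF part] by auto
        show "set ts \<inter> {a<..z} = {}"
        proof (rule equals0I)
          fix w assume w: "w \<in> set ts \<inter> {a<..z}"
          then have "w \<in> set ?xs" "w \<noteq> z" using False by (auto simp: set)
          then show False using w that(3) by fastforce
        qed
      qed (rule that(2))
      show "sorted_wrt (<) ?xs" "hd ?xs < z" "z < last ?xs" using part z by (simp_all add: subdiv_def)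
      show "z \<notin> set ?xs" using False set by simp
    qed (rule \<tau>(2))
    also have "\<dots> = tagprod c m \<tau> ts" using insert by auto
    finally show ?thesis .
  qed
qed

text \<open>On a refinement, every subinterval inherits the tag of the interval of \<open>ts\<close> that contains it, which
  makes the tags a step function \<open>\<tau>\<close>. Intervals without mass may carry arbitrary tags; they are replaced by a
  fixed unit vector, as splitting an interval requires unit tags.\<close>

lemma step_function:
  assumes "fine_tags \<delta> ts n"
  shows "\<exists>\<tau>. oprod c ts n = tagprod c m \<tau> ts \<and>
     (\<forall>a z. 0 \<le> a \<longrightarrow> a < z \<longrightarrow> set ts \<inter> {a<..z} = {} \<longrightarrow> \<tau> z = \<tau> a) \<and>
     (\<forall>r. mink (\<tau> r) (\<tau> r) = 1 \<and> norm (\<tau> r) \<le> N) \<and>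
     (\<forall>a b. 0 \<le> a \<and> a < b \<and> b \<le> d \<and> set ts \<inter> {a<..<b} = {} \<and> m a b > 0 \<longrightarrow>
        (\<exists>r\<in>C. \<bar>r - a\<bar> < \<delta> \<and> \<tau> a = \<nu> r)) \<and>
     successively (\<lambda>a b. m a b > 0 \<longrightarrow> \<tau> a \<in> \<nu> ` (C \<inter> {a..b}) \<and> b - a < \<delta>) ts"
proof -
  have ts: "ts \<noteq> []" "sorted_wrt (<) ts" "hd ts = 0" "last ts = d" and sub: "subdiv ts"
    using assms by (auto simp: subdiv_def fine_tags_def)
  have sd: "sorted ts" "distinct ts" using ts(2) by (auto simp: strict_sorted_iff)
  have ends: "ts ! 0 = 0" "ts ! (length ts - 1) = d" using ts by (auto simp: hd_conv_nth last_conv_nth)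
  have less_iff: "ts ! i < ts ! j \<longleftrightarrow> i < j" if "i < length ts" "j < length ts" for i j
    using that ts(2) by (metis linorder_neqE_nat order_less_asym order_less_irrefl sorted_wrt_iff_nth_less)
  \<comment> \<open>the default tag\<close>
  define e :: "real^3" where "e = axis 3 1"
  have "norm e = 1" by (simp add: e_def)
  then have e: "mink e e = 1" "norm e \<le> N" using N_ge by (auto simp: e_def mink_def axis_def)
  define n' where "n' j = (if j < length ts - 1 \<and> m (ts ! j) (ts ! Suc j) > 0 then n j else e)" for j
  have tag: "n j \<in> \<nu> ` (C \<inter> {ts ! j..ts ! Suc j})" "ts ! Suc j - ts ! j < \<delta>"
    if "j < length ts - 1" "m (ts ! j) (ts ! Suc j) > 0" for j
    using assms that unfolding fine_tags_def by blast+
  have n': "mink (n' j) (n' j) = 1" "norm (n' j) \<le> N" for j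
    using tag[of j] e \<nu>_unit \<nu>_bound by (auto simp: n'_def)
  define idx where "idx r = {i. i < length ts \<and> ts ! i \<le> r}" for r
  define \<tau> where "\<tau> r = n' (Max (idx r))" for r
  have fin: "finite (idx r)" for r unfolding idx_def by simp
  have idx_nth: "Max (idx (ts ! j)) = j" if "j < length ts" for j
    using that less_iff fin by (intro Max_eqI) (auto simp: idx_def not_le[symmetric])
  have \<tau>_nth: "\<tau> (ts ! j) = n' j" if "j < length ts" for j using idx_nth[OF that] by (simp add: \<tau>_def)
  have "oprod c ts n = tagprod c m \<tau> ts"
    unfolding oprod_def
  proof (rule foldr_tagprod)
    fix j assume j: "j < length ts - 1"
    show "hexp (c * of_real (m (ts ! j) (ts ! Suc j))) (n j) = hexp (c * of_real (m (ts ! j) (ts ! Suc j))) (\<tau> (ts ! j))"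
    proof (cases "m (ts ! j) (ts ! Suc j) > 0")
      case True
      then show ?thesis using j \<tau>_nth[of j] by (simp add: n'_def)
    next
      case False
      then have "m (ts ! j) (ts ! Suc j) = 0" using m_nonneg[of "ts ! j" "ts ! Suc j"] by linarith
      then show ?thesis by simp
    qed
  qed
  moreover have "\<tau> z = \<tau> a" if "0 \<le> a" "a < z" "set ts \<inter> {a<..z} = {}" for a z
  proof -
    have "i \<in> idx z \<longleftrightarrow> i \<in> idx a" for i
    proof (cases "i < length ts")
      case True
      then have "\<not> (a < ts ! i \<and> ts ! i \<le> z)"
        using that(3) by (metis IntI empty_iff greaterThanAtMost_iff nth_mem)
      then show ?thesis using True that(2) by (auto simp: idx_def)
    qed (auto simp: idx_def)
    then have "idx z = idx a" by blast
    then show ?thesis by (simp add: \<tau>_def)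
  qed
  moreover have "mink (\<tau> r) (\<tau> r) = 1 \<and> norm (\<tau> r) \<le> N" for r
    using n' by (simp add: \<tau>_def)
  moreover have "\<exists>r\<in>C. \<bar>r - a\<bar> < \<delta> \<and> \<tau> a = \<nu> r"
    if ab: "0 \<le> a" "a < b" "b \<le> d" "set ts \<inter> {a<..<b} = {}" "m a b > 0" for a b
  proof -
    define j where "j = Max (idx a)"
    have "0 \<in> idx a" using ab(1) ts(1) ends by (auto simp: idx_def)
    then have j: "j \<in> idx a" unfolding j_def using Max_in[OF fin] by blast
    then have jl: "j < length ts" "ts ! j \<le> a" by (auto simp: idx_def)
    have j1: "j \<noteq> length ts - 1" using jl(2) ends ab by auto
    then have jl': "j < length ts - 1" using jl(1) by simp
    have "Suc j \<notin> idx a"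
      using Max_ge[OF fin, of "Suc j" a] unfolding j_def by auto
    then have "ts ! Suc j > a" using jl' by (auto simp: idx_def)
    moreover have "ts ! Suc j \<in> set ts" using jl' by simp
    ultimately have b: "b \<le> ts ! Suc j" using ab(4) by (auto simp: not_le[symmetric])
    have "0 \<le> ts ! j" "ts ! Suc j \<le> d"
      using subdiv_nth[OF sub, of j] subdiv_nth[OF sub, of "Suc j"] jl' by auto
    then have "m (ts ! j) (ts ! Suc j) > 0"
      using m_mono[of "ts ! j" a b "ts ! Suc j"] jl(2) b ab by simp
    with tag[OF jl' this] obtain r where "r \<in> C" "ts ! j \<le> r" "r \<le> ts ! Suc j" "n j = \<nu> r"
      "ts ! Suc j - ts ! j < \<delta>"
      by auto
    moreover from this have "\<bar>r - a\<bar> < \<delta>" using jl(2) \<open>ts ! Suc j > a\<close> by auto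
    ultimately show ?thesis using \<open>m (ts ! j) (ts ! Suc j) > 0\<close> jl'
      by (auto simp: \<tau>_def n'_def j_def[symmetric])
  qed
  moreover have "successively (\<lambda>a b. m a b > 0 \<longrightarrow> \<tau> a \<in> \<nu> ` (C \<inter> {a..b}) \<and> b - a < \<delta>) ts"
    unfolding successively_conv_nth
  proof (intro allI impI)
    fix j assume j: "Suc j < length ts" "m (ts ! j) (ts ! Suc j) > 0"
    then have "j < length ts - 1" by linarith
    then have "\<tau> (ts ! j) = n j" using \<tau>_nth[of j] j by (simp add: n'_def)
    then show "\<tau> (ts ! j) \<in> \<nu> ` (C \<inter> {ts ! j..ts ! Suc j}) \<and> ts ! Suc j - ts ! j < \<delta>"
      using tag[of j] j by auto
  qed
  ultimately show ?thesis by blast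
qed

text \<open>On the common refinement, the two step functions take values \<open>\<nu> r\<close> and \<open>\<nu> r'\<close> with \<open>r\<close> and \<open>r'\<close> at
  distance less than \<open>2 * \<delta>\<close> wherever there is mass.\<close>

lemma oprod_cauchy:
  assumes "fine_tags \<delta> ts n" "fine_tags \<delta> ts' n'" "\<delta> > 0"
  shows "nrm (oprod c ts n - oprod c ts' n') \<le> 3 * (K * (2 * \<delta>)) * (cmod c * m 0 d) * exp ((1 + 3 * N) * (cmod c * m 0 d))"
proof -
  have sub: "subdiv ts" "subdiv ts'" using assms by (auto simp: fine_tags_def)
  obtain \<tau> where \<tau>: "oprod c ts n = tagprod c m \<tau> ts"
     "\<And>a z. 0 \<le> a \<Longrightarrow> a < z \<Longrightarrow> set ts \<inter> {a<..z} = {} \<Longrightarrow> \<tau> z = \<tau> a"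
     "\<And>r. mink (\<tau> r) (\<tau> r) = 1" "\<And>r. norm (\<tau> r) \<le> N"
     "\<And>a b. 0 \<le> a \<Longrightarrow> a < b \<Longrightarrow> b \<le> d \<Longrightarrow> set ts \<inter> {a<..<b} = {} \<Longrightarrow> m a b > 0 \<Longrightarrow> (\<exists>r\<in>C. \<bar>r - a\<bar> < \<delta> \<and> \<tau> a = \<nu> r)"
    using step_function[OF assms(1), of c] by blast
  obtain \<tau>' where \<tau>': "oprod c ts' n' = tagprod c m \<tau>' ts'"
     "\<And>a z. 0 \<le> a \<Longrightarrow> a < z \<Longrightarrow> set ts' \<inter> {a<..z} = {} \<Longrightarrow> \<tau>' z = \<tau>' a"
     "\<And>r. mink (\<tau>' r) (\<tau>' r) = 1" "\<And>r. norm (\<tau>' r) \<le> N"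
     "\<And>a b. 0 \<le> a \<Longrightarrow> a < b \<Longrightarrow> b \<le> d \<Longrightarrow> set ts' \<inter> {a<..<b} = {} \<Longrightarrow> m a b > 0 \<Longrightarrow> (\<exists>r\<in>C. \<bar>r - a\<bar> < \<delta> \<and> \<tau>' a = \<nu> r)"
    using step_function[OF assms(2), of c] by blast
  define xs where "xs = sorted_list_of_set (set ts \<union> set ts')"
  have xs': "xs = sorted_list_of_set (set ts' \<union> set ts)" by (simp add: xs_def Un_commute)
  have p: "tagprod c m \<tau> xs = tagprod c m \<tau> ts"
    unfolding xs_def using \<tau> subdiv_set(1)[OF sub(2)] by (intro tagprod_refine[OF sub(1)]) auto
  have p': "tagprod c m \<tau>' xs = tagprod c m \<tau>' ts'"
    unfolding xs' using \<tau>' subdiv_set(1)[OF sub(1)] by (intro tagprod_refine[OF sub(2)]) auto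
  have subx: "subdiv xs" unfolding xs_def
    by (rule subdiv_refine[OF sub(1)]) (use subdiv_set(1)[OF sub(2)] in auto)
  have setx: "set xs = set ts \<union> set ts'" by (simp add: xs_def)
  have close: "successively (\<lambda>a b. m a b = 0 \<or> norm (\<tau> a - \<tau>' a) \<le> K * (2 * \<delta>)) xs"
    unfolding successively_conv_nth
  proof (intro allI impI)
    fix j assume j: "Suc j < length xs"
    let ?a = "xs ! j" and ?b = "xs ! Suc j"
    have less: "xs ! i < xs ! k \<longleftrightarrow> i < k" if "i < length xs" "k < length xs" for i k
      using that subx unfolding subdiv_def
        by (metis linorder_neqE_nat order_less_asym order_less_irrefl sorted_wrt_iff_nth_less)
    have ab: "0 \<le> ?a" "?a < ?b" "?b \<le> d"
      using j subdiv_nth[OF subx, of j] subdiv_nth[OF subx, of "Suc j"] less[of j "Suc j"] by auto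
    have "set xs \<inter> {?a<..<?b} = {}"
      using j less by (auto simp: in_set_conv_nth)
    then have disj: "set ts \<inter> {?a<..<?b} = {}" "set ts' \<inter> {?a<..<?b} = {}" using setx by auto
    show "m ?a ?b = 0 \<or> norm (\<tau> ?a - \<tau>' ?a) \<le> K * (2 * \<delta>)"
    proof (cases "m ?a ?b = 0")
      case False
      then have "m ?a ?b > 0" using m_nonneg[of ?a ?b] by linarith
      then obtain r r' where r: "r \<in> C" "\<bar>r - ?a\<bar> < \<delta>" "\<tau> ?a = \<nu> r" "r' \<in> C" "\<bar>r' - ?a\<bar> < \<delta>" "\<tau>' ?a = \<nu> r'"
        using \<tau>(5)[OF ab disj(1)] \<tau>'(5)[OF ab disj(2)] by blast
      then have "norm (\<tau> ?a - \<tau>' ?a) \<le> K * \<bar>r - r'\<bar>" using \<nu>_lip by simp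
      also have "\<dots> \<le> K * (2 * \<delta>)" using r K_nonneg by (intro mult_left_mono) auto
      finally show ?thesis by simp
    qed simp
  qed
  have tot: "total m xs = m 0 d" by (rule total_subdiv[OF subx]) (auto intro: m_add)
  show ?thesis
    using tagprod_compare[of m \<tau> N \<tau>' "K * (2 * \<delta>)" xs c] m_nonneg \<tau>(4) \<tau>'(4) close K_nonneg assms(3)
    unfolding \<tau>(1) \<tau>'(1) p p' tot by simp
qed

lemma tagsum_close:
  assumes "successively (\<lambda>a b. m a b > 0 \<longrightarrow> \<tau> a \<in> \<nu> ` (C \<inter> {a..b}) \<and> b - a < \<delta>) xs"
    "sorted_wrt (<) xs" "set xs \<subseteq> {0..d}"
  shows "norm (total J xs - tagsum m \<tau> xs) \<le> K * \<delta> * total m xs"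
  using assms
proof (induction xs rule: induct_list012)
  case (3 a b xs)
  have ab: "0 \<le> a" "a < b" "b \<le> d" using 3 by auto
  have "norm (J a b - m a b *\<^sub>R \<tau> a) \<le> K * \<delta> * m a b"
  proof (cases "m a b > 0")
    case True
    then obtain r where r: "r \<in> C" "a \<le> r" "r \<le> b" "\<tau> a = \<nu> r" "b - a < \<delta>" using 3 by auto
    then have "norm (J a b - m a b *\<^sub>R \<tau> a) \<le> K * (b - a) * m a b" using J_est ab by simp
    also have "\<dots> \<le> K * \<delta> * m a b" using r K_nonneg m_nonneg by (intro mult_right_mono mult_left_mono) auto
    finally show ?thesis .
  next
    case False
    then have "m a b = 0" using m_nonneg[of a b] by linarith
    then show ?thesis using J_null ab by simp
  qed
  moreover have "norm (total J (b # xs) - tagsum m \<tau> (b # xs)) \<le> K * \<delta> * total m (b # xs)"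
    using 3 by (intro 3(2)) auto
  moreover have eq: "total J (a # b # xs) - tagsum m \<tau> (a # b # xs) =
      (J a b - m a b *\<^sub>R \<tau> a) + (total J (b # xs) - tagsum m \<tau> (b # xs))" by simp
  moreover have "K * \<delta> * total m (a # b # xs) = K * \<delta> * m a b + K * \<delta> * total m (b # xs)"
    by (simp add: distrib_left)
  ultimately show ?case
    unfolding eq
    using norm_triangle_ineq[of "J a b - m a b *\<^sub>R \<tau> a" "total J (b # xs) - tagsum m \<tau> (b # xs)"]
    by linarith
qed auto

lemma oprod_first_order:
  assumes "fine_tags \<delta> ts n" "\<delta> > 0"
  defines "k \<equiv> 1 + 3 * N"
  shows "nrm (oprod c ts n - mat 1 - cscale c (genm (J 0 d))) \<le>
     exp (k * (cmod c * m 0 d)) - 1 - k * (cmod c * m 0 d) + 3 * cmod c * K * \<delta> * m 0 d"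
proof -
  have sub: "subdiv ts" using assms by (auto simp: fine_tags_def)
  obtain \<tau> where \<tau>: "oprod c ts n = tagprod c m \<tau> ts" "\<And>r. norm (\<tau> r) \<le> N"
     "successively (\<lambda>a b. m a b > 0 \<longrightarrow> \<tau> a \<in> \<nu> ` (C \<inter> {a..b}) \<and> b - a < \<delta>) ts"
    using step_function[OF assms(1), of c] by blast
  have tot: "total m ts = m 0 d" "total J ts = J 0 d"
    by (rule total_subdiv[OF sub]; auto intro: m_add J_add)+
  have sum: "norm (J 0 d - tagsum m \<tau> ts) \<le> K * \<delta> * m 0 d"
    using tagsum_close[OF \<tau>(3)] sub subdiv_set(1)[OF sub] unfolding tot by (auto simp: subdiv_def)
  have 1: "nrm (tagprod c m \<tau> ts - mat 1 - cscale c (genm (tagsum m \<tau> ts))) \<le>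
      exp (k * (cmod c * m 0 d)) - 1 - k * (cmod c * m 0 d)"
    using tagprod_first_order[of m \<tau> N c ts] m_nonneg \<tau>(2) unfolding k_def tot by blast
  have eq: "tagprod c m \<tau> ts - mat 1 - cscale c (genm (J 0 d)) =
      (tagprod c m \<tau> ts - mat 1 - cscale c (genm (tagsum m \<tau> ts))) + cscale (- c) (genm (J 0 d - tagsum m \<tau> ts))"
    by (rule mat2_eqI) (simp_all add: algebra_simps)
  have "nrm (cscale (- c) (genm (J 0 d - tagsum m \<tau> ts))) \<le> cmod c * (3 * norm (J 0 d - tagsum m \<tau> ts))"
    unfolding nrm_cscale by (simp only: norm_minus_cancel) (intro mult_left_mono nrm_genm norm_ge_zero)
  also have "\<dots> \<le> cmod c * (3 * (K * \<delta> * m 0 d))" using sum by (intro mult_left_mono) auto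
  finally show ?thesis unfolding \<tau>(1) eq using 1
    nrm_triangle[of "tagprod c m \<tau> ts - mat 1 - cscale c (genm (tagsum m \<tau> ts))"
      "cscale (- c) (genm (J 0 d - tagsum m \<tau> ts))"]
    by (simp add: algebra_simps)
qed

lemma exists_subdivision:
  assumes "\<delta> > 0"
  shows "\<exists>ts. subdiv ts \<and> (\<forall>j < length ts - 1. ts ! Suc j - ts ! j < \<delta>)"
proof -
  obtain k :: nat where k: "k > 0" "2 * d / \<delta> < k" using reals_Archimedean2[of "2 * d / \<delta>"] d_pos assms
    by (metis divide_pos_pos gr0I less_asym mult_pos_pos of_nat_0 zero_less_numeral)
  define h where "h = d / k"
  have h: "h > 0" "2 * h < \<delta>" "k * h = d" using k d_pos assms by (auto simp: h_def field_simps)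
  have "\<forall>i<k. \<exists>g. g \<in> G \<and> i * h < g \<and> g < Suc i * h"
  proof (intro allI impI)
    fix i assume "i < k"
    then have "Suc i * h \<le> k * h" using h(1) by (intro mult_right_mono) auto
    then show "\<exists>g. g \<in> G \<and> i * h < g \<and> g < Suc i * h"
      using G_dense[of "i * h" "Suc i * h"] h by (auto simp: algebra_simps)
  qed
  then obtain g where g: "\<And>i. i < k \<Longrightarrow> g i \<in> G \<and> i * h < g i \<and> g i < Suc i * h" by metis
  \<comment> \<open>one point of \<open>G\<close> from each of \<open>k\<close> equal intervals, so that neighbours are less than \<open>2 * h\<close> apart\<close>
  define f where "f j = (if j = 0 then 0 else if j = Suc k then d else g (j - 1))" for j
  define ts where "ts = map f [0..<k + 2]"
  have len: "length ts = k + 2" and nth: "\<And>j. j < k + 2 \<Longrightarrow> ts ! j = f j"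
    by (simp_all add: ts_def del: upt_Suc)
  have step: "f j < f (Suc j) \<and> f (Suc j) - f j < \<delta>" if j: "j < Suc k" for j
  proof -
    have "real j * h \<le> k * h" using j h(1) by (intro mult_right_mono) auto
    consider "j = 0" | "0 < j" "j < k" | "0 < j" "j = k" using j by linarith
    then show ?thesis
    proof cases
      case 1
      then show ?thesis using g[of 0] k h by (auto simp: f_def)
    next
      case 2
      then have "real (Suc (j - 1)) = j" by simp
      moreover have "j - 1 < k" using 2 by simp
      ultimately show ?thesis using 2 g[of "j - 1"] g[of j] h by (auto simp: f_def algebra_simps)
    next
      case 3
      then have "real (Suc (j - 1)) = j" by simp
      then show ?thesis using 3 g[of "j - 1"] h k(1) by (auto simp: f_def algebra_simps)
    qed
  qed
  have mono: "f i < f j" if "i < j" "j < k + 2" for i j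
    using that
  proof (induction j)
    case (Suc j)
    then show ?case using step[of j] by (cases "i = j") (auto simp: less_Suc_eq)
  qed simp
  have "sorted_wrt (<) ts"
    unfolding sorted_wrt_iff_nth_less using mono len nth by auto
  moreover have ne: "ts \<noteq> []" using len by auto
  moreover have "hd ts = 0" "last ts = d"
    using len nth[of 0] nth[of "Suc k"] by (simp_all add: hd_conv_nth[OF ne] last_conv_nth[OF ne] f_def)
  moreover have "ts ! j \<in> G" if "0 < j" "j < length ts - 1" for j
    using that g[of "j - 1"] len nth[of j] by (auto simp: f_def)
  ultimately have "subdiv ts" unfolding subdiv_def by blast
  moreover have "ts ! Suc j - ts ! j < \<delta>" if "j < length ts - 1" for j
    using that step[of j] len nth[of j] nth[of "Suc j"] by auto
  ultimately show ?thesis by blast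
qed

lemma exists_fine_tags:
  assumes "\<delta> > 0"
  shows "\<exists>ts n. fine_tags \<delta> ts n"
proof -
  obtain ts where ts: "subdiv ts" "\<forall>j < length ts - 1. ts ! Suc j - ts ! j < \<delta>"
    using exists_subdivision[OF assms] by blast
  have "\<exists>v. m (ts ! j) (ts ! Suc j) > 0 \<longrightarrow> v \<in> \<nu> ` (C \<inter> {ts ! j..ts ! Suc j})" if j: "j < length ts - 1" for j
  proof -
    have "ts ! j < ts ! Suc j" using j ts(1) by (auto simp: subdiv_def sorted_wrt_iff_nth_less)
    moreover have "0 \<le> ts ! j" "ts ! Suc j \<le> d"
      using j subdiv_nth[OF ts(1), of j] subdiv_nth[OF ts(1), of "Suc j"] by auto
    ultimately show ?thesis using m_crossing[of "ts ! j" "ts ! Suc j"] by blast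
  qed
  then obtain n where "\<And>j. j < length ts - 1 \<Longrightarrow> m (ts ! j) (ts ! Suc j) > 0 \<longrightarrow>
    n j \<in> \<nu> ` (C \<inter> {ts ! j..ts ! Suc j})"
    by metis
  then show ?thesis using ts unfolding fine_tags_def by blast
qed

text \<open>The limit of the ordered products exists because they form a Cauchy net, with the mesh as modulus. It
  inherits the first order estimate, in which the sum of the weighted tags has become the integral \<open>J 0 d\<close>.
  The error is of second order in \<open>c\<close>, which is where the scaling parameter of the lamination enters.\<close>

lemma oprod_converges:
  defines "k \<equiv> 1 + 3 * N"
  shows "\<exists>B. (\<forall>\<epsilon>>0. \<exists>\<delta>>0. \<forall>ts n. fine_tags \<delta> ts n \<longrightarrow> nrm (oprod c ts n - B) < \<epsilon>) \<and>
    nrm (B - mat 1 - cscale c (genm (J 0 d))) \<le> exp (k * (cmod c * m 0 d)) - 1 - k * (cmod c * m 0 d)"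
proof -
  \<comment> \<open>a modulus for the Cauchy property; the summand \<open>1\<close> keeps it positive if there is no mass\<close>
  define L where "L = 6 * K * (cmod c * m 0 d) * exp (k * (cmod c * m 0 d)) + 1"
  have L: "L > 0" using K_nonneg m_nonneg by (auto simp: L_def add_nonneg_pos)
  have cauchy: "nrm (oprod c ts n - oprod c ts' n') \<le> L * \<delta>"
    if "fine_tags \<delta> ts n" "fine_tags \<delta> ts' n'" "\<delta> > 0" for \<delta> ts n ts' n'
  proof -
    have "nrm (oprod c ts n - oprod c ts' n') \<le> (L - 1) * \<delta>"
      using oprod_cauchy[OF that, of c] by (simp add: L_def k_def algebra_simps)
    then show ?thesis using that(3) by (simp add: algebra_simps)
  qed
  have mono: "fine_tags \<delta>' ts n" if "fine_tags \<delta> ts n" "\<delta> \<le> \<delta>'" for \<delta> \<delta>' ts n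
    using that unfolding fine_tags_def by force
  have "\<forall>i. \<exists>p. fine_tags (1 / Suc i) (fst p) (snd p)"
    using exists_fine_tags by simp
  then obtain p where p: "\<And>i. fine_tags (1 / Suc i) (fst (p i)) (snd (p i))" by metis
  define X where "X i = oprod c (fst (p i)) (snd (p i))" for i
  have small: "\<exists>M. \<forall>i\<ge>M. 1 / Suc i < e" if e: "e > 0" for e :: real
  proof -
    obtain M where M: "inverse (real (Suc M)) < e" using reals_Archimedean[OF e] by auto
    have "1 / real (Suc i) \<le> 1 / real (Suc M)" if "i \<ge> M" for i
      using that by (intro divide_left_mono) auto
    then show ?thesis using M unfolding inverse_eq_divide by (meson le_less_trans)
  qed
  have "Cauchy X"
  proof (rule metric_CauchyI)
    fix e :: real assume e: "e > 0"
    then obtain M where M: "1 / real (Suc M) < e / (4 * L)" using small[of "e / (4 * L)"] L by auto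
    have "dist (X i) (X j) < e" if "i \<ge> M" "j \<ge> M" for i j
    proof -
      have "fine_tags (1 / Suc M) (fst (p i)) (snd (p i))" "fine_tags (1 / Suc M) (fst (p j)) (snd (p j))"
        using that by (auto intro!: mono[OF p] divide_left_mono)
      then have "nrm (X i - X j) \<le> L * (1 / Suc M)" unfolding X_def by (rule cauchy) simp
      also have "\<dots> < L * (e / (4 * L))" using M L by (intro mult_strict_left_mono) auto
      finally have "4 * nrm (X i - X j) < e" using L by simp
      then show ?thesis using norm_le_nrm[of "X i - X j"] by (simp add: dist_norm)
    qed
    then show "\<exists>M. \<forall>i\<ge>M. \<forall>j\<ge>M. dist (X i) (X j) < e" by blast
  qed
  then obtain B where B: "X \<longlonglongrightarrow> B" using Cauchy_convergent convergent_def by blast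
  have lim: "nrm (oprod c ts n - B) \<le> 2 * L * \<delta>" if f: "fine_tags \<delta> ts n" "\<delta> > 0" for ts n \<delta>
  proof -
    obtain M1 where M1: "\<forall>i\<ge>M1. dist (X i) B < L * \<delta> / 2" using B f L
      by (metis half_gt_zero lim_sequentially mult_pos_pos)
    obtain M2 where M2: "\<forall>i\<ge>M2. 1 / Suc i < \<delta>" using small f by blast
    let ?i = "max M1 M2"
    have "fine_tags \<delta> (fst (p ?i)) (snd (p ?i))"
      using mono[OF p[of ?i]] M2 by (simp add: less_imp_le)
    from cauchy[OF f(1) this f(2)] have "nrm (oprod c ts n - X ?i) \<le> L * \<delta>" by (simp add: X_def)
    moreover have "nrm (X ?i - B) \<le> L * \<delta>"
    proof -
      have "norm (X ?i - B) < L * \<delta> / 2" using M1 by (simp add: dist_norm)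
      then show ?thesis using nrm_le_norm[of "X ?i - B"] by linarith
    qed
    ultimately show ?thesis using nrm_triangle4[of "oprod c ts n" B "X ?i"] by simp
  qed
  have "\<exists>\<delta>>0. \<forall>ts n. fine_tags \<delta> ts n \<longrightarrow> nrm (oprod c ts n - B) < \<epsilon>" if "\<epsilon> > 0" for \<epsilon>
  proof (intro exI[of _ "\<epsilon> / (4 * L)"] conjI allI impI)
    show pos: "\<epsilon> / (4 * L) > 0" using that L by simp
    fix ts n assume "fine_tags (\<epsilon> / (4 * L)) ts n"
    from lim[OF this pos] show "nrm (oprod c ts n - B) < \<epsilon>" using L that by simp
  qed
  moreover have "nrm (B - mat 1 - cscale c (genm (J 0 d))) \<le> exp (k * (cmod c * m 0 d)) - 1 - k * (cmod c * m 0 d)"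
  proof (rule field_le_epsilon)
    fix e :: real assume e: "e > 0"
    define L' where "L' = 2 * L + 3 * cmod c * K * m 0 d"
    have L': "L' > 0" using L K_nonneg m_nonneg by (simp add: L'_def add_pos_nonneg)
    define \<delta> where "\<delta> = e / L'"
    have \<delta>: "\<delta> > 0" using e L' by (simp add: \<delta>_def)
    obtain ts n where f: "fine_tags \<delta> ts n" using exists_fine_tags[OF \<delta>] by blast
    have eq: "B - mat 1 - cscale c (genm (J 0 d)) = (B - oprod c ts n) + (oprod c ts n - mat 1 - cscale c (genm (J 0 d)))"
      by simp
    have "nrm (B - mat 1 - cscale c (genm (J 0 d))) \<le> 2 * L * \<delta> + (exp (k * (cmod c * m 0 d)) - 1 - k * (cmod c * m 0 d) + 3 * cmod c * K * \<delta> * m 0 d)"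
      unfolding eq
      using nrm_triangle[of "B - oprod c ts n" "oprod c ts n - mat 1 - cscale c (genm (J 0 d))"]
        lim[OF f \<delta>] oprod_first_order[OF f \<delta>, of c] nrm_minus_commute[of B "oprod c ts n"] unfolding k_def
          by linarith
    also have "\<dots> = exp (k * (cmod c * m 0 d)) - 1 - k * (cmod c * m 0 d) + L' * \<delta>"
      by (simp add: L'_def algebra_simps)
    also have "L' * \<delta> = e" using L' by (simp add: \<delta>_def)
    finally show "nrm (B - mat 1 - cscale c (genm (J 0 d))) \<le> exp (k * (cmod c * m 0 d)) - 1 - k * (cmod c * m 0 d) + e" .
  qed
  ultimately show ?thesis by blast
qed

end

section \<open>The leaves crossing a segment\<close>

lemma normal_of_geod_unique:
  assumes "mink n n = 1" "mink v v = 1" "\<And>w. w \<in> geod n \<Longrightarrow> mink v w = 0"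
  shows "v = n \<or> v = - n"
proof -
  obtain p u where pu: "unit_tangent p u" "lcross p u = n" using exists_frame[OF assms(1)] by blast
  have line: "mink v (geoline p u s) = 0" for s
    using assms(3) range_geoline[OF pu(1)] pu(2) by blast
  have p: "mink v p = 0" using line[of 0] by (simp add: geoline_def)
  then have "mink v u = 0" using line[of 1] by (simp add: geoline_def)
  then have e: "v = mink v n *\<^sub>R n" using frame_expansion[OF pu(1), of v] p pu(2) by simp
  then have "mink v v = mink v n * mink v n" by (metis mink_simps(6))
  then have "(mink v n)\<^sup>2 = 1" using assms(2) by (simp add: power2_eq_square)
  then show ?thesis using e by (metis power2_eq_1_iff scaleR_minus1_left scaleR_one)
qed

text \<open>The length of \<open>h\<close> is controlled by that of \<open>g\<close> and by the variation of \<open>f\<close>, which for a monotone function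
  telescopes.\<close>

lemma rectifiable_combine:
  fixes f :: "real \<Rightarrow> real"
  assumes g: "rectifiable g" and f: "mono_on {0..1} f \<or> antimono_on {0..1} f" and "A \<ge> 0" "C \<ge> 0"
    and h: "\<And>s t. s \<in> {0..1} \<Longrightarrow> t \<in> {0..1} \<Longrightarrow> norm (h s - h t) \<le> A * norm (g s - g t) + C * \<bar>f s - f t\<bar>"
  shows "rectifiable h"
proof -
  obtain B where B: "\<And>ts. sorted ts \<Longrightarrow> set ts \<subseteq> {0..1} \<Longrightarrow>
    (\<Sum>j<length ts - 1. dist (g (ts ! j)) (g (ts ! Suc j))) \<le> B"
    using g unfolding rectifiable_def by blast
  define e :: real where "e = (if mono_on {0..1} f then 1 else -1)"
  have ef: "e * f s \<le> e * f t" if "s \<in> {0..1}" "t \<in> {0..1}" "s \<le> t" for s t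
    using f that by (auto simp: e_def monotone_on_def)
  have abs: "\<bar>f s - f t\<bar> = e * f t - e * f s" if "s \<in> {0..1}" "t \<in> {0..1}" "s \<le> t" for s t
    using ef[OF that] by (auto simp: e_def abs_if split: if_splits)
  define D where "D = \<bar>e * f 1 - e * f 0\<bar>"
  have "(\<Sum>j<length ts - 1. dist (h (ts ! j)) (h (ts ! Suc j))) \<le> A * B + C * D"
    if ts: "sorted ts" "set ts \<subseteq> {0..1}" for ts
  proof -
    have pts: "ts ! j \<in> {0..1}" "ts ! Suc j \<in> {0..1}" "ts ! j \<le> ts ! Suc j" if "j < length ts - 1" for j
      using ts nth_mem[of j ts] nth_mem[of "Suc j" ts] that sorted_nth_mono[OF ts(1), of j "Suc j"]
        by (simp_all add: subset_iff)
    have "(\<Sum>j<length ts - 1. dist (h (ts ! j)) (h (ts ! Suc j))) \<le>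
        (\<Sum>j<length ts - 1. A * dist (g (ts ! j)) (g (ts ! Suc j)) + C * (e * f (ts ! Suc j) - e * f (ts ! j)))"
    proof (rule sum_mono)
      fix j assume "j \<in> {..<length ts - 1}"
      then have j: "j < length ts - 1" by simp
      show "dist (h (ts ! j)) (h (ts ! Suc j)) \<le> A * dist (g (ts ! j)) (g (ts ! Suc j)) + C * (e * f (ts ! Suc j) - e * f (ts ! j))"
        using h[OF pts(1,2)[OF j]] abs[OF pts[OF j]] by (simp add: dist_norm)
    qed
    also have "\<dots> = A * (\<Sum>j<length ts - 1. dist (g (ts ! j)) (g (ts ! Suc j))) + C * (e * f (ts ! (length ts - 1)) - e * f (ts ! 0))"
      by (simp only: sum.distrib sum_distrib_left[symmetric] sum_lessThan_telescope[of "\<lambda>j. e * f (ts ! j)"])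
    also have "\<dots> \<le> A * B + C * D"
    proof (intro add_mono mult_left_mono B ts assms)
      show "e * f (ts ! (length ts - 1)) - e * f (ts ! 0) \<le> D"
      proof (cases "ts = []")
        case False
        moreover have "ts ! i \<in> {0..1}" if "i < length ts" for i
          using subsetD[OF ts(2) nth_mem[OF that]] .
        ultimately have "ts ! 0 \<in> {0..1}" "ts ! (length ts - 1) \<in> {0..1}" by simp_all
        then have "e * f 0 \<le> e * f (ts ! 0)" "e * f (ts ! (length ts - 1)) \<le> e * f 1"
          using ef[of 0 "ts ! 0"] ef[of "ts ! (length ts - 1)" 1] by auto
        then show ?thesis unfolding D_def by linarith
      qed (simp add: D_def)
    qed
    finally show ?thesis .
  qed
  then show ?thesis unfolding rectifiable_def by blast
qed

lemma measured_laminationD: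
  assumes "measured_lamination \<Lambda>"
  shows "l \<in> leaves \<Lambda> \<Longrightarrow> \<exists>n. mink n n = 1 \<and> l = geod n"
    "l \<in> leaves \<Lambda> \<Longrightarrow> l' \<in> leaves \<Lambda> \<Longrightarrow> q \<in> l \<Longrightarrow> q \<in> l' \<Longrightarrow> l = l'"
    "closed (lam_support \<Lambda>)"
    "transverse_path (leaves \<Lambda>) g \<Longrightarrow> finite_measure (tmeasure \<Lambda> (path_image g))"
    "transverse_path (leaves \<Lambda>) g \<Longrightarrow> sets (tmeasure \<Lambda> (path_image g)) = sets borel"
    "transverse_path (leaves \<Lambda>) g \<Longrightarrow> measure_support (tmeasure \<Lambda> (path_image g)) \<subseteq> path_image g \<inter> lam_support \<Lambda>"
    "transverse_arc (leaves \<Lambda>) k \<Longrightarrow> transverse_arc (leaves \<Lambda>) k' \<Longrightarrow> k' \<subseteq> k \<Longrightarrow> A \<in> sets borel \<Longrightarrow> A \<subseteq> k' \<Longrightarrow>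
        emeasure (tmeasure \<Lambda> k') A = emeasure (tmeasure \<Lambda> k) A"
    "transverse_homotopy (leaves \<Lambda>) h \<Longrightarrow> T \<in> sets borel \<Longrightarrow> T \<subseteq> {0..1} \<Longrightarrow>
        emeasure (tmeasure \<Lambda> (path_image (h 1))) (h 1 ` T) = emeasure (tmeasure \<Lambda> (path_image (h 0))) (h 0 ` T)"
proof -
  have D: "\<forall>l\<in>leaves \<Lambda>. complete_geodesic l" "disjoint (leaves \<Lambda>)" "closed (lam_support \<Lambda>)"
    "transverse_measure (leaves \<Lambda>) (tmeasure \<Lambda>)"
    using assms unfolding measured_lamination_def by blast+
  show "l \<in> leaves \<Lambda> \<Longrightarrow> \<exists>n. mink n n = 1 \<and> l = geod n"
    using D(1) by (simp add: complete_geodesic_iff)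
  show "l \<in> leaves \<Lambda> \<Longrightarrow> l' \<in> leaves \<Lambda> \<Longrightarrow> q \<in> l \<Longrightarrow> q \<in> l' \<Longrightarrow> l = l'"
    using D(2) unfolding disjoint_def by blast
  show "closed (lam_support \<Lambda>)" by (rule D(3))
  note tm = D(4)[unfolded transverse_measure_def, folded lam_support_def]
  show "transverse_path (leaves \<Lambda>) g \<Longrightarrow> finite_measure (tmeasure \<Lambda> (path_image g))"
    "transverse_path (leaves \<Lambda>) g \<Longrightarrow> sets (tmeasure \<Lambda> (path_image g)) = sets borel"
    "transverse_path (leaves \<Lambda>) g \<Longrightarrow> measure_support (tmeasure \<Lambda> (path_image g)) \<subseteq> path_image g \<inter> lam_support \<Lambda>"
    using conjunct1[OF tm] by blast+
  show "transverse_arc (leaves \<Lambda>) k \<Longrightarrow> transverse_arc (leaves \<Lambda>) k' \<Longrightarrow> k' \<subseteq> k \<Longrightarrow> A \<in> sets borel \<Longrightarrow> A \<subseteq> k' \<Longrightarrow>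
        emeasure (tmeasure \<Lambda> k') A = emeasure (tmeasure \<Lambda> k) A"
    using conjunct1[OF conjunct2[OF tm]] by blast
  show "transverse_homotopy (leaves \<Lambda>) h \<Longrightarrow> T \<in> sets borel \<Longrightarrow> T \<subseteq> {0..1} \<Longrightarrow>
        emeasure (tmeasure \<Lambda> (path_image (h 1))) (h 1 ` T) = emeasure (tmeasure \<Lambda> (path_image (h 0))) (h 0 ` T)"
    using conjunct2[OF conjunct2[OF tm]] by blast
qed

text \<open>A segment whose endpoints lie in a common leaf is contained in it and crosses nothing. In all other
  cases each leaf that meets the segment crosses it, with \<open>x\<close> on one and \<open>y\<close> on the other closed side.\<close>

locale crossed_segment = seg +
  fixes \<Lambda> :: mlam
  assumes ml: "measured_lamination \<Lambda>"
    and not_in_leaf: "l \<in> leaves \<Lambda> \<Longrightarrow> \<not> (x \<in> l \<and> y \<in> l)"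
begin

lemma oriented_leaf:
  assumes "l \<in> leaves \<Lambda>" "\<sigma> r \<in> l" "r \<in> {0..d}"
  shows "\<exists>n C. mink n n = 1 \<and> l = geod n \<and> mink n x \<le> 0 \<and> mink n y \<ge> 0 \<and> C > 0 \<and>
     (\<forall>s. mink n (\<sigma> s) = C * sinh (s - r))"
proof -
  obtain n where n: "mink n n = 1" "l = geod n" using measured_laminationD(1)[OF ml assms(1)] by blast
  have r: "mink n (\<sigma> r) = 0" using assms(2) n(2) by (simp add: geod_def)
  obtain C where C: "\<And>s. mink n (\<sigma> s) = C * sinh (s - r)" using mink_\<sigma>[OF r] by blast
  have "C \<noteq> 0"
  proof
    assume "C = 0"
    then have "x \<in> geod n" "y \<in> geod n" using C[of 0] C[of d] xH yH by (auto simp: geod_def)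
    then show False using not_in_leaf assms(1) n(2) by blast
  qed
  define e where "e = sgn C"
  have e: "e * e = 1" "e * C > 0" using \<open>C \<noteq> 0\<close> by (auto simp: e_def sgn_if)
  have s: "mink (e *\<^sub>R n) (\<sigma> s) = (e * C) * sinh (s - r)" for s by (simp add: C)
  have "geod (e *\<^sub>R n) = l" using e n(2) by (auto simp: geod_def)
  moreover have "mink (e *\<^sub>R n) (e *\<^sub>R n) = 1" using e n(1) by simp
  moreover have "mink (e *\<^sub>R n) x = (e * C) * sinh (0 - r)" "mink (e *\<^sub>R n) y = (e * C) * sinh (d - r)"
    using s[of 0] s[of d] by (simp_all only: \<sigma>_0 \<sigma>_d)
  moreover have "(e * C) * sinh (0 - r) \<le> 0" "(e * C) * sinh (d - r) \<ge> 0"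
    using e(2) assms(3) by (auto intro: mult_nonneg_nonneg mult_nonneg_nonpos)
  ultimately show ?thesis using s e(2) by (intro exI[of _ "e *\<^sub>R n"] exI[of _ "e * C"]) auto
qed

definition Cr :: "real set" where
  "Cr = {r \<in> {0..d}. \<sigma> r \<in> lam_support \<Lambda>}"

definition \<nu> :: "real \<Rightarrow> real^3" where
  "\<nu> r = leaf_normal \<Lambda> x y (\<sigma> r)"

lemma leaf_normal_eqI:
  assumes "l \<in> leaves \<Lambda>" "q \<in> l" "mink n n = 1" "l = geod n" "mink n x \<le> 0" "mink n y \<ge> 0"
  shows "leaf_normal \<Lambda> x y q = n"
  unfolding leaf_normal_def
proof (rule the_equality)
  show "mink n n = 1 \<and> (\<exists>l\<in>leaves \<Lambda>. q \<in> l \<and> (\<forall>w\<in>l. mink n w = 0)) \<and> mink n x \<le> 0 \<and> mink n y \<ge> 0"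
    using assms by (auto simp: geod_def intro!: bexI[of _ l])
next
  fix v assume v: "mink v v = 1 \<and> (\<exists>l\<in>leaves \<Lambda>. q \<in> l \<and> (\<forall>w\<in>l. mink v w = 0)) \<and> mink v x \<le> 0 \<and> mink v y \<ge> 0"
  then obtain l' where l': "l' \<in> leaves \<Lambda>" "q \<in> l'" "\<And>w. w \<in> l' \<Longrightarrow> mink v w = 0" by blast
  have "l' = l" using measured_laminationD(2)[OF ml] l' assms by blast
  then have "v = n \<or> v = - n" using normal_of_geod_unique[OF assms(3)] v l'(3) assms(4) by blast
  moreover have "v \<noteq> - n"
  proof
    assume "v = - n"
    then have "mink n x = 0" "mink n y = 0" using v assms(5,6) by auto
    then have "x \<in> l" "y \<in> l" using assms(4) xH yH by (auto simp: geod_def)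
    then show False using not_in_leaf assms(1) by blast
  qed
  ultimately show "v = n" by blast
qed

lemma \<nu>_props:
  assumes "r \<in> Cr"
  shows "mink (\<nu> r) (\<nu> r) = 1" "geod (\<nu> r) \<in> leaves \<Lambda>" "mink (\<nu> r) x \<le> 0" "mink (\<nu> r) y \<ge> 0"
    "\<exists>C>0. \<forall>s. mink (\<nu> r) (\<sigma> s) = C * sinh (s - r)"
proof -
  obtain l where l: "l \<in> leaves \<Lambda>" "\<sigma> r \<in> l" "r \<in> {0..d}" using assms by (auto simp: Cr_def lam_support_def)
  obtain n C where n: "mink n n = 1" "l = geod n" "mink n x \<le> 0" "mink n y \<ge> 0" "C > 0"
     "\<forall>s. mink n (\<sigma> s) = C * sinh (s - r)"
    using oriented_leaf[OF l] by blast
  have "\<nu> r = n" unfolding \<nu>_def by (rule leaf_normal_eqI[OF l(1,2) n(1-4)])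
  then show "mink (\<nu> r) (\<nu> r) = 1" "geod (\<nu> r) \<in> leaves \<Lambda>" "mink (\<nu> r) x \<le> 0" "mink (\<nu> r) y \<ge> 0"
    "\<exists>C>0. \<forall>s. mink (\<nu> r) (\<sigma> s) = C * sinh (s - r)" using n l by auto
qed

lemma \<nu>_\<sigma>: "r \<in> Cr \<Longrightarrow> mink (\<nu> r) (\<sigma> r) = 0"
  using \<nu>_props(5)[of r] by auto

lemma \<nu>_geod: "r \<in> Cr \<Longrightarrow> \<sigma> r \<in> geod (\<nu> r)"
  using \<nu>_\<sigma> by (simp add: geod_def)

lemma \<nu>_nested:
  assumes "r \<in> Cr" "s \<in> Cr"
  shows "mink (\<nu> r) (\<nu> s) \<ge> 1"
proof (cases "r = s")
  case False
  obtain C where C: "C > 0" "\<forall>s. mink (\<nu> r) (\<sigma> s) = C * sinh (s - r)" using \<nu>_props(5)[OF assms(1)] by blast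
  have "\<sigma> s \<notin> geod (\<nu> r)" using C False by (simp add: geod_def)
  then have "geod (\<nu> r) \<noteq> geod (\<nu> s)" using \<nu>_geod[OF assms(2)] by blast
  then have disj: "geod (\<nu> r) \<inter> geod (\<nu> s) = {}"
    using measured_laminationD(2)[OF ml \<nu>_props(2)[OF assms(1)] \<nu>_props(2)[OF assms(2)]] by blast
  have "mink (\<nu> r) x = - (C * sinh r)" "mink (\<nu> r) y = C * sinh (d - r)"
    using C(2)[rule_format, of 0] C(2)[rule_format, of d] by auto
  moreover have "r > 0 \<or> r < d" using d_pos by linarith
  ultimately have "mink (\<nu> r) x < 0 \<or> mink (\<nu> r) y > 0" using C(1) by auto
  then show ?thesis
    using cooriented_ge_1[OF \<nu>_props(1)[OF assms(1)] \<nu>_props(1)[OF assms(2)] disj xH yH]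
      \<nu>_props(3,4)[OF assms(1)] \<nu>_props(3,4)[OF assms(2)] by blast
qed (use assms \<nu>_props(1) in simp)

text \<open>The difference of the normals at two crossings is causal because their product is at least \<open>1\<close>, so
  its sign on \<open>H2\<close> can be read off at a point of the segment: the half-planes bounded by successive leaves are
  strictly nested, even off the segment.\<close>

lemma \<nu>_decreasing:
  assumes "r \<in> Cr" "s \<in> Cr" "r < s" "z \<in> H2"
  shows "mink (\<nu> s) z < mink (\<nu> r) z"
proof -
  let ?v = "\<nu> s - \<nu> r"
  have c: "mink ?v ?v \<le> 0"
    using \<nu>_nested[OF assms(1,2)] \<nu>_props(1)[OF assms(1)] \<nu>_props(1)[OF assms(2)]
    by (simp add: mink_commute[of "\<nu> s" "\<nu> r"])
  obtain C where C: "C > 0" "\<forall>t. mink (\<nu> s) (\<sigma> t) = C * sinh (t - s)" using \<nu>_props(5)[OF assms(2)] by blast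
  have "mink ?v (\<sigma> r) < 0" using C assms(3) \<nu>_\<sigma>[OF assms(1)] by (simp add: mult_pos_neg)
  then have "mink ?v z < 0" by (rule causal_neg[OF c \<sigma>_H2 _ assms(4)])
  then show ?thesis by simp
qed

text \<open>The normals at crossings are unit vectors tangent at points of a compact segment, hence bounded; their
  Lipschitz continuity is that of nested normals.\<close>

lemma \<nu>_estimates: "\<exists>N K. N \<ge> 1 \<and> K \<ge> 0 \<and> (\<forall>r\<in>Cr. norm (\<nu> r) \<le> N) \<and>
  (\<forall>r\<in>Cr. \<forall>s\<in>Cr. norm (\<nu> r - \<nu> s) \<le> K * \<bar>r - s\<bar>)"
proof -
  have "bounded (segment x y)" by (rule compact_imp_bounded[OF compact_segment])
  then obtain R where R: "R > 0" "\<And>r. r \<in> {0..d} \<Longrightarrow> norm (\<sigma> r) \<le> R"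
    unfolding bounded_pos segment_eq by blast
  obtain C where C: "C > 0" "\<And>s t. s \<in> {0..d} \<Longrightarrow> t \<in> {0..d} \<Longrightarrow> norm (\<sigma> s - \<sigma> t) \<le> C * \<bar>s - t\<bar>"
    using \<sigma>_lipschitz by blast
  define N where "N = 1 + 2 * R"
  have Crd: "r \<in> {0..d}" if "r \<in> Cr" for r using that by (simp add: Cr_def)
  have first: "\<bar>\<sigma> r $ 1\<bar> \<le> R" if "r \<in> Cr" for r
    using component_le_norm_cart[of "\<sigma> r" 1] R(2)[OF Crd[OF that]] by simp
  have N: "norm (\<nu> r) \<le> N" if r: "r \<in> Cr" for r
  proof -
    have "mink (\<sigma> r) (\<nu> r) = 0" using \<nu>_\<sigma>[OF r] by (simp add: mink_commute)
    from tangent_norm[OF \<sigma>_H2 this] have "(norm (\<nu> r))\<^sup>2 \<le> 2 * (\<sigma> r $ 1)\<^sup>2"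
      using \<nu>_props(1)[OF r] by simp
    also have "(\<sigma> r $ 1)\<^sup>2 \<le> R\<^sup>2" using first[OF r] R(1) by (simp add: abs_le_square_iff[symmetric])
    also have "2 * R\<^sup>2 \<le> N\<^sup>2" using R(1) by (simp add: N_def power2_eq_square algebra_simps)
    finally show ?thesis using R(1) by (auto simp: N_def intro: power2_le_imp_le)
  qed
  define K where "K = 6 * R * N * C"
  have K: "K \<ge> 0" using R C by (simp add: K_def N_def)
  have lip: "norm (\<nu> r - \<nu> s) \<le> K * \<bar>r - s\<bar>" if r: "r \<in> Cr" and s: "s \<in> Cr" for r s
  proof -
    have "norm (\<nu> r - \<nu> s) \<le> 3 * (\<sigma> s $ 1 + norm (\<sigma> s)) * \<bar>mink (\<nu> r) (\<sigma> s)\<bar>"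
      by (rule normals_close[OF \<nu>_props(1)[OF s] \<nu>_props(1)[OF r] \<nu>_nested[OF s r] \<sigma>_H2 \<nu>_\<sigma>[OF s]])
    also have "mink (\<nu> r) (\<sigma> s) = mink (\<nu> r) (\<sigma> s - \<sigma> r)" by (simp add: \<nu>_\<sigma>[OF r])
    also have "3 * (\<sigma> s $ 1 + norm (\<sigma> s)) * \<bar>mink (\<nu> r) (\<sigma> s - \<sigma> r)\<bar> \<le> 6 * R * (N * (C * \<bar>r - s\<bar>))"
    proof (rule mult_mono)
      show "3 * (\<sigma> s $ 1 + norm (\<sigma> s)) \<le> 6 * R"
        using first[OF s] R(2)[OF Crd[OF s]] by simp
      have "\<bar>mink (\<nu> r) (\<sigma> s - \<sigma> r)\<bar> \<le> norm (\<nu> r) * norm (\<sigma> s - \<sigma> r)" by (rule abs_mink_le)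
      also have "\<dots> \<le> N * (C * \<bar>s - r\<bar>)"
        using N[OF r] C(2)[OF Crd[OF s] Crd[OF r]] by (intro mult_mono) (auto simp: N_def R(1) less_imp_le)
      finally show "\<bar>mink (\<nu> r) (\<sigma> s - \<sigma> r)\<bar> \<le> N * (C * \<bar>r - s\<bar>)" by (simp add: abs_minus_commute)
    qed (use R in simp_all)
    finally show ?thesis by (simp add: K_def algebra_simps)
  qed
  show ?thesis using N K lip R(1) by (intro exI[of _ N] exI[of _ K]) (auto simp: N_def)
qed

subsection \<open>Transversality\<close>

definition unit_path :: "real \<Rightarrow> real^3" where "unit_path t = \<sigma> (d * t)"

lemma path_image_unit_path: "path_image unit_path = segment x y"
proof -
  have "(\<lambda>t. d * t) ` {0..1} = {0..d}"
    using d_pos image_mult_atLeastAtMost[of d 0 1] by simp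
  moreover have "path_image unit_path = \<sigma> ` (\<lambda>t. d * t) ` {0..1}"
    by (simp add: path_image_def unit_path_def[abs_def] image_image)
  ultimately show ?thesis by (simp add: segment_eq)
qed

text \<open>The sign \<open>e\<close> selects the orientation: arcs may run in the direction of the segment or against it.\<close>

lemma oriented_frame:
  assumes "mink n n = 1" and e: "e = 1 \<or> e = (-1 :: real)"
  shows "\<exists>p u. unit_tangent p u \<and> geod n = range (geoline p u) \<and> (\<forall>q. side p u q = e * mink n q)"
proof -
  have "mink (- e *\<^sub>R n) (- e *\<^sub>R n) = 1" using assms by auto
  then obtain p u where pu: "unit_tangent p u" "lcross p u = - e *\<^sub>R n" using exists_frame by blast
  have "geod n = geod (- e *\<^sub>R n)" using e by (auto simp: geod_def)
  then show ?thesis using pu range_geoline[OF pu(1)]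
    by (intro exI[of _ p] exI[of _ u]) (auto simp: side_eq)
qed

lemma transverse_unit_path: "transverse_path (leaves \<Lambda>) unit_path"
  unfolding transverse_path_def
proof (intro conjI ballI)
  show "arc unit_path"
    unfolding arc_def path_def unit_path_def
    using \<sigma>_inj d_pos by (auto intro!: continuous_intros inj_onI dest: injD)
  show "path_image unit_path \<subseteq> H2" unfolding path_image_unit_path segment_eq by auto
  show "rectifiable unit_path"
  proof -
    obtain C where C: "C > 0" "\<And>s t. s \<in> {0..d} \<Longrightarrow> t \<in> {0..d} \<Longrightarrow> norm (\<sigma> s - \<sigma> t) \<le> C * \<bar>s - t\<bar>"
      using \<sigma>_lipschitz by blast
    show ?thesis
    proof (rule rectifiable_combine[where g = "\<lambda>_. 0" and A = 0 and C = C and f = "\<lambda>t. d * t"])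
      show "rectifiable (\<lambda>_. 0)" by (auto simp: rectifiable_def)
      show "mono_on {0..1} (\<lambda>t. d * t) \<or> antimono_on {0..1} (\<lambda>t. d * t)"
        using d_pos by (auto simp: monotone_on_def)
      fix s t :: real assume "s \<in> {0..1}" "t \<in> {0..1}"
      then have "d * s \<in> {0..d}" "d * t \<in> {0..d}" using d_pos by (auto simp: mult_le_cancel_left2)
      then show "norm (unit_path s - unit_path t) \<le> 0 * norm (0 - 0 :: real^3) + C * \<bar>d * s - d * t\<bar>"
        using C(2) by (simp add: unit_path_def)
    qed (use C in auto)
  qed
  fix t0 :: real
  have "\<exists>p u. unit_tangent p u \<and> l = range (geoline p u) \<and>
           (\<forall>s\<in>{0..1}. \<bar>s - t0\<bar> < 1 \<longrightarrow> sgn (side p u (unit_path s)) = sgn (t - s))"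
    if t: "t \<in> {0..1}" "l \<in> leaves \<Lambda>" "unit_path t \<in> l" for t l
  proof -
    have "d * t \<in> {0..d}" using t(1) d_pos by (auto simp: mult_le_cancel_left2)
    then obtain n C where n: "mink n n = 1" "l = geod n" "C > 0" "\<forall>s. mink n (\<sigma> s) = C * sinh (s - d * t)"
      using oriented_leaf[OF t(2), of "d * t"] t(3) unfolding unit_path_def by blast
    obtain p u where pu: "unit_tangent p u" "geod n = range (geoline p u)" "\<forall>q. side p u q = (-1) * mink n q"
      using oriented_frame[OF n(1), of "-1"] by blast
    have "sgn (side p u (unit_path s)) = sgn (t - s)" for s
    proof -
      have "side p u (unit_path s) = C * sinh (d * (t - s))"
        using pu(3) n(4) by (simp add: unit_path_def right_diff_distrib flip: sinh_minus)
           (metis minus_diff_eq mult_minus_right sinh_minus)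
      then show ?thesis using n(3) d_pos by (auto simp: sgn_if mult_less_0_iff zero_less_mult_iff)
    qed
    then show ?thesis using pu n(2) by blast
  qed
  then show "\<exists>\<epsilon>>0. \<forall>t\<in>{0..1}. \<forall>l\<in>leaves \<Lambda>. \<bar>t - t0\<bar> < \<epsilon> \<and> unit_path t \<in> l \<longrightarrow>
        (\<exists>p u. unit_tangent p u \<and> l = range (geoline p u) \<and>
           (\<forall>s\<in>{0..1}. \<bar>s - t0\<bar> < \<epsilon> \<longrightarrow> sgn (side p u (unit_path s)) = sgn (t - s)))"
    by (intro exI[of _ 1]) auto
qed

lemma transverse_segment: "transverse_arc (leaves \<Lambda>) (segment x y)"
  unfolding transverse_arc_def using transverse_unit_path path_image_unit_path by metis

subsection \<open>The transverse measure of the segment\<close>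

abbreviation M where "M \<equiv> tmeasure \<Lambda> (segment x y)"

lemma seg_measure_M: "seg_measure \<Lambda> x y = M"
  by (simp add: seg_measure_def transverse_segment)

lemma finite_M: "finite_measure M" and sets_M [simp, measurable_cong]: "sets M = sets borel"
  and support_M: "measure_support M \<subseteq> segment x y \<inter> lam_support \<Lambda>"
  using measured_laminationD(4-6)[OF ml transverse_unit_path] by (simp_all add: path_image_unit_path)

lemma space_M [simp]: "space M = UNIV"
  using sets_eq_imp_space_eq[OF sets_M] by simp

lemma S_eq: "segment x y \<inter> lam_support \<Lambda> = \<sigma> ` Cr"
  by (auto simp: segment_eq Cr_def)

lemma compact_S: "compact (segment x y \<inter> lam_support \<Lambda>)"
  by (intro compact_Int_closed compact_segment measured_laminationD(3)[OF ml])

lemma sets_compl_S: "- (segment x y \<inter> lam_support \<Lambda>) \<in> sets borel"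
  by (rule borel_comp) (rule borel_compact[OF compact_S])

text \<open>Every point outside the support has a null neighbourhood, and countably many of them cover the complement.\<close>

lemma null_off_support: "emeasure M (- (segment x y \<inter> lam_support \<Lambda>)) = 0"
proof -
  let ?F = "{U. open U \<and> emeasure M U = 0}"
  obtain F' where F': "F' \<subseteq> ?F" "countable F'" "\<Union>F' = \<Union>?F"
    using Lindelof[of ?F] by (metis (mono_tags, lifting) mem_Collect_eq)
  have "- (segment x y \<inter> lam_support \<Lambda>) \<subseteq> \<Union>?F"
  proof
    fix q assume "q \<in> - (segment x y \<inter> lam_support \<Lambda>)"
    then have "q \<notin> measure_support M" using support_M by blast
    then show "q \<in> \<Union>?F" by (auto simp: measure_support_def)
  qed
  moreover have "(\<Union>U\<in>F'. U) \<in> null_sets M"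
  proof (rule null_sets_UN'[OF F'(2)])
    fix U assume "U \<in> F'"
    then show "U \<in> null_sets M" using F'(1) by (auto simp: null_sets_def)
  qed
  then have "\<Union>F' \<in> null_sets M" by simp
  moreover have "- (segment x y \<inter> lam_support \<Lambda>) \<in> sets M"
    using sets_compl_S by (simp only: sets_M)
  ultimately have "- (segment x y \<inter> lam_support \<Lambda>) \<in> null_sets M"
    unfolding F'(3)[symmetric] by (blast intro: null_sets_subset)
  then show ?thesis by auto
qed

definition m :: "real \<Rightarrow> real \<Rightarrow> real" where
  "m a b = measure M (\<sigma> ` {a..b})"

definition atomless :: "real set" where
  "atomless = {r \<in> {0..d}. measure M {\<sigma> r} = 0}"

definition J :: "real \<Rightarrow> real \<Rightarrow> real^3" where
  "J a b = (LINT q : \<sigma> ` {a..b} \<inter> lam_support \<Lambda> | M. leaf_normal \<Lambda> x y q)"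

lemma sets_arc [measurable, simp]: "\<sigma> ` {a..b} \<in> sets borel"
  by (intro borel_closed compact_imp_closed compact_continuous_image continuous_intros) auto

lemma sets_L [measurable, simp]: "lam_support \<Lambda> \<in> sets borel"
  by (intro borel_closed measured_laminationD(3)[OF ml])

lemma arc_split:
  assumes "a < z" "z < b"
  shows "\<sigma> ` {a..b} = \<sigma> ` {a..z} \<union> \<sigma> ` {z..b}" "\<sigma> ` {a..z} \<inter> \<sigma> ` {z..b} = {\<sigma> z}"
proof -
  have "{a..b} = {a..z} \<union> {z..b}" "{a..z} \<inter> {z..b} = {z}" using assms by auto
  then show "\<sigma> ` {a..b} = \<sigma> ` {a..z} \<union> \<sigma> ` {z..b}" "\<sigma> ` {a..z} \<inter> \<sigma> ` {z..b} = {\<sigma> z}"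
    by (simp_all add: image_Un image_Int[OF \<sigma>_inj, symmetric])
qed

lemma AE_no_overlap:
  assumes "a < z" "z < b" "z \<in> atomless"
  shows "AE q in M. \<not> (q \<in> \<sigma> ` {a..z} \<and> q \<in> \<sigma> ` {z..b})"
proof (rule AE_I')
  interpret finite_measure M by (rule finite_M)
  show "{\<sigma> z} \<in> null_sets M" using assms(3) by (auto simp: null_sets_def atomless_def emeasure_eq_measure)
  show "{q \<in> space M. \<not> \<not> (q \<in> \<sigma> ` {a..z} \<and> q \<in> \<sigma> ` {z..b})} \<subseteq> {\<sigma> z}"
    using arc_split(2)[OF assms(1,2)] by auto
qed

lemma m_add: "a < z \<Longrightarrow> z < b \<Longrightarrow> z \<in> atomless \<Longrightarrow> m a b = m a z + m z b"
proof -
  assume az: "a < z" "z < b" "z \<in> atomless"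
  interpret finite_measure M by (rule finite_M)
  have e: "\<sigma> ` {a..b} = \<sigma> ` {a..z} \<union> (\<sigma> ` {z..b} - {\<sigma> z})" "\<sigma> ` {a..z} \<inter> (\<sigma> ` {z..b} - {\<sigma> z}) = {}"
    using arc_split[OF az(1,2)] by auto
  have "m a b = measure M (\<sigma> ` {a..z}) + measure M (\<sigma> ` {z..b} - {\<sigma> z})"
    unfolding m_def e(1) by (rule finite_measure_Union) (use e(2) in auto)
  also have "measure M (\<sigma> ` {z..b} - {\<sigma> z}) = measure M (\<sigma> ` {z..b}) - measure M {\<sigma> z}"
    using az by (intro finite_measure_Diff) auto
  finally show ?thesis using az by (simp add: m_def atomless_def)
qed

lemma m_mono: "a' \<le> a \<Longrightarrow> b \<le> b' \<Longrightarrow> m a b \<le> m a' b'"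
  unfolding m_def by (intro finite_measure.finite_measure_mono[OF finite_M] image_mono) auto

lemma measure_arc_L: "measure M (\<sigma> ` {a..b} \<inter> lam_support \<Lambda>) = m a b" if "0 \<le> a" "b \<le> d"
proof -
  have "measure M (\<sigma> ` {a..b}) = measure M (\<sigma> ` {a..b} \<inter> lam_support \<Lambda>)"
  proof (rule measure_eq_AE)
    have "- (segment x y \<inter> lam_support \<Lambda>) \<in> null_sets M"
      using null_off_support sets_compl_S unfolding null_sets_def sets_M by blast
    moreover have "{q \<in> space M. \<not> (q \<in> \<sigma> ` {a..b} \<longleftrightarrow> q \<in> \<sigma> ` {a..b} \<inter> lam_support \<Lambda>)} \<subseteq> - (segment x y \<inter> lam_support \<Lambda>)"
      using that by auto
    ultimately show "AE q in M. q \<in> \<sigma> ` {a..b} \<longleftrightarrow> q \<in> \<sigma> ` {a..b} \<inter> lam_support \<Lambda>"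
      by (rule AE_I')
  qed auto
  then show ?thesis by (simp add: m_def)
qed

lemma m_crossing:
  assumes "0 \<le> a" "b \<le> d" "m a b > 0"
  shows "Cr \<inter> {a..b} \<noteq> {}"
proof
  assume "Cr \<inter> {a..b} = {}"
  moreover have "r \<in> Cr" if "r \<in> {a..b}" "\<sigma> r \<in> lam_support \<Lambda>" for r
    using that assms(1,2) by (auto simp: Cr_def)
  ultimately have "\<sigma> ` {a..b} \<inter> lam_support \<Lambda> = {}" by blast
  then show False using measure_arc_L[OF assms(1,2)] assms(3) by simp
qed

lemma continuous_leaf_normal: "continuous_on (segment x y \<inter> lam_support \<Lambda>) (leaf_normal \<Lambda> x y)"
proof -
  obtain K where K: "K \<ge> 0" "\<And>r s. r \<in> Cr \<Longrightarrow> s \<in> Cr \<Longrightarrow> norm (\<nu> r - \<nu> s) \<le> K * \<bar>r - s\<bar>"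
    using \<nu>_estimates by blast
  have c\<nu>: "continuous_on Cr \<nu>"
    by (rule continuous_on_subset[OF lipschitz_on_continuous_on[of K Cr \<nu>]])
       (auto intro!: lipschitz_onI simp: K dist_norm)
  define \<tau> where "\<tau> = inv_into UNIV \<sigma>"
  have inv: "\<tau> (\<sigma> r) = r" for r unfolding \<tau>_def using \<sigma>_inj by simp
  have "continuous_on (\<sigma> ` {0..d}) \<tau>"
    by (rule continuous_on_inv) (auto intro!: continuous_intros simp: inv)
  then have "continuous_on (\<sigma> ` Cr) \<tau>" by (rule continuous_on_subset) (auto simp: Cr_def)
  moreover have "\<tau> ` \<sigma> ` Cr = Cr" by (auto simp: inv image_image)
  ultimately have "continuous_on (\<sigma> ` Cr) (\<lambda>q. \<nu> (\<tau> q))"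
    using continuous_on_compose[of "\<sigma> ` Cr" \<tau> \<nu>] c\<nu> by (simp add: o_def)
  then show ?thesis unfolding S_eq
    by (rule continuous_on_eq) (auto simp: inv \<nu>_def)
qed

lemma integrable_leaf_normal: "set_integrable M (segment x y \<inter> lam_support \<Lambda>) (leaf_normal \<Lambda> x y)"
proof -
  interpret finite_measure M by (rule finite_M)
  let ?S = "segment x y \<inter> lam_support \<Lambda>"
  obtain N where N: "N \<ge> 1" "\<And>r. r \<in> Cr \<Longrightarrow> norm (\<nu> r) \<le> N" using \<nu>_estimates by blast
  show ?thesis unfolding set_integrable_def
  proof (rule integrable_const_bound)
    have "?S \<in> sets borel" by (simp add: borel_compact compact_S)
    from borel_measurable_continuous_on_indicator[OF this continuous_leaf_normal]
    show "(\<lambda>q. indicator ?S q *\<^sub>R leaf_normal \<Lambda> x y q) \<in> borel_measurable M"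
      by (subst measurable_cong_sets[OF sets_M refl]) 
    show "AE q in M. norm (indicator ?S q *\<^sub>R leaf_normal \<Lambda> x y q) \<le> N"
      using N unfolding S_eq by (intro AE_I2) (auto simp: indicator_def \<nu>_def)
  qed
qed

lemma integrable_arc: "set_integrable M (\<sigma> ` {a..b} \<inter> lam_support \<Lambda>) (leaf_normal \<Lambda> x y)" if "0 \<le> a" "b \<le> d"
proof (rule set_integrable_subset[OF integrable_leaf_normal])
  have "\<sigma> ` {a..b} \<subseteq> segment x y" unfolding segment_eq using that by auto
  then show "\<sigma> ` {a..b} \<inter> lam_support \<Lambda> \<subseteq> segment x y \<inter> lam_support \<Lambda>" by blast
qed simp

lemma J_add:
  assumes "0 \<le> a" "a < z" "z < b" "b \<le> d" "z \<in> atomless"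
  shows "J a b = J a z + J z b"
proof -
  have "\<sigma> ` {a..b} \<inter> lam_support \<Lambda> = (\<sigma> ` {a..z} \<inter> lam_support \<Lambda>) \<union> (\<sigma> ` {z..b} \<inter> lam_support \<Lambda>)"
    using arc_split(1)[OF assms(2,3)] by auto
  moreover have "AE q in M. \<not> (q \<in> \<sigma> ` {a..z} \<inter> lam_support \<Lambda> \<and> q \<in> \<sigma> ` {z..b} \<inter> lam_support \<Lambda>)"
    using AE_no_overlap[OF assms(2,3,5)] by eventually_elim auto
  ultimately show ?thesis unfolding J_def using assms
    by (simp only:) (intro set_integral_Un_AE integrable_arc, auto)
qed

lemma J_est:
  assumes "K \<ge> 0" "\<And>r s. r \<in> Cr \<Longrightarrow> s \<in> Cr \<Longrightarrow> norm (\<nu> r - \<nu> s) \<le> K * \<bar>r - s\<bar>"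
    and "0 \<le> a" "a < b" "b \<le> d" "r \<in> Cr" "a \<le> r" "r \<le> b"
  shows "norm (J a b - m a b *\<^sub>R \<nu> r) \<le> K * (b - a) * m a b"
proof -
  interpret finite_measure M by (rule finite_M)
  let ?A = "\<sigma> ` {a..b} \<inter> lam_support \<Lambda>" and ?f = "leaf_normal \<Lambda> x y"
  have A: "?A \<in> sets M" by simp
  have const: "(LINT q:?A|M. c) = m a b *\<^sub>R c" for c :: "'b::{banach,second_countable_topology}"
  proof -
    have "(LINT q:?A|M. c) = measure M ?A *\<^sub>R c"
      by (rule set_integral_const[OF A]) (simp add: emeasure_eq_measure)
    then show ?thesis using measure_arc_L[of a b] assms by simp
  qed
  have ic: "set_integrable M ?A (\<lambda>_. c)" for c :: "'b::{banach,second_countable_topology}"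
    unfolding set_integrable_def using A
      by (intro integrable_scaleR_left integrable_real_indicator) (auto simp: emeasure_eq_measure)
  have if1: "set_integrable M ?A ?f" by (rule integrable_arc) (use assms in auto)
  have if2: "set_integrable M ?A (\<lambda>q. ?f q - \<nu> r)" by (rule set_integral_diff(1)[OF if1 ic])
  have "J a b - m a b *\<^sub>R \<nu> r = (LINT q:?A|M. ?f q - \<nu> r)"
    unfolding set_integral_diff(2)[OF if1 ic] by (simp add: J_def const)
  also have "norm \<dots> \<le> (LINT q:?A|M. norm (?f q - \<nu> r))"
    by (rule set_integral_norm_bound[OF if2])
  also have "\<dots> \<le> (LINT q:?A|M. K * (b - a))"
  proof (rule set_integral_mono)
    show "set_integrable M ?A (\<lambda>q. norm (?f q - \<nu> r))"
      by (rule set_integrable_norm[OF if2])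
    fix q assume "q \<in> ?A"
    then obtain s where s: "s \<in> {a..b}" "q = \<sigma> s" "s \<in> Cr" using assms by (auto simp: Cr_def)
    have "norm (?f q - \<nu> r) \<le> K * \<bar>s - r\<bar>" using assms(2)[OF s(3) assms(6)] s(2) by (simp add: \<nu>_def)
    also have "\<dots> \<le> K * (b - a)" using assms(1,7,8) s(1) by (intro mult_left_mono) auto
    finally show "norm (?f q - \<nu> r) \<le> K * (b - a)" .
  qed (rule ic)
  also have "\<dots> = K * (b - a) * m a b" by (simp add: const)
  finally show ?thesis .
qed

lemma J_null: "0 \<le> a \<Longrightarrow> b \<le> d \<Longrightarrow> m a b = 0 \<Longrightarrow> J a b = 0"
proof -
  assume ab: "0 \<le> a" "b \<le> d" "m a b = 0"
  interpret finite_measure M by (rule finite_M)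
  have "\<sigma> ` {a..b} \<inter> lam_support \<Lambda> \<in> null_sets M"
    using measure_arc_L[OF ab(1,2)] ab(3) by (auto simp: null_sets_def emeasure_eq_measure)
  then have "AE q in M. q \<notin> \<sigma> ` {a..b} \<inter> lam_support \<Lambda>" by (rule AE_not_in)
  then show ?thesis unfolding J_def set_lebesgue_integral_def
    by (intro integral_eq_zero_AE) (auto elim!: eventually_mono simp: indicator_def)
qed

lemma J_full: "J 0 d = (LINT q : segment x y \<inter> lam_support \<Lambda> | M. leaf_normal \<Lambda> x y q)"
  by (simp add: J_def segment_eq)

lemma crossing_of_dense:
  assumes "U \<subseteq> atomless" "\<And>a b. 0 \<le> a \<Longrightarrow> a < b \<Longrightarrow> b \<le> d \<Longrightarrow> U \<inter> {a<..<b} \<noteq> {}"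
  shows "\<exists>K N. crossing d m U Cr \<nu> J K N"
proof -
  obtain N K where NK: "N \<ge> 1" "K \<ge> 0" "\<And>r. r \<in> Cr \<Longrightarrow> norm (\<nu> r) \<le> N"
    "\<And>r s. r \<in> Cr \<Longrightarrow> s \<in> Cr \<Longrightarrow> norm (\<nu> r - \<nu> s) \<le> K * \<bar>r - s\<bar>"
    using \<nu>_estimates by blast
  have "crossing d m U Cr \<nu> J K N"
    apply (unfold_locales)
    subgoal by (rule d_pos)
    subgoal by (simp add: m_def)
    subgoal using assms(1) m_add by blast
    subgoal by (rule m_mono)
    subgoal by (rule m_crossing)
    subgoal using assms(1) J_add by blast
    subgoal by (rule J_null)
    subgoal by (rule J_est[OF NK(2,4)])
    subgoal by (auto simp: Cr_def)
    subgoal by (rule \<nu>_props(1))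
    subgoal by (rule NK(3))
    subgoal by (rule NK(4))
    subgoal by (rule NK(2))
    subgoal by (rule NK(1))
    subgoal by (rule assms(2))
    done
  then show ?thesis by blast
qed

end

section \<open>Leaves carrying an atom\<close>

text \<open>Off the lamination this holds because the measure is supported on it, on the lamination by definition
  of the weighted part.\<close>

lemma no_atom:
  assumes ml: "measured_lamination \<Lambda>" and k: "transverse_arc (leaves \<Lambda>) k"
    and q: "q \<in> k" "q \<notin> weighted_part \<Lambda>"
  shows "emeasure (tmeasure \<Lambda> k) {q} = 0"
proof (cases "q \<in> lam_support \<Lambda>")
  case True
  then obtain l where l: "l \<in> leaves \<Lambda>" "q \<in> l" by (auto simp: lam_support_def)
  show ?thesis
  proof (rule ccontr)
    assume "emeasure (tmeasure \<Lambda> k) {q} \<noteq> 0"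
    then have "emeasure (tmeasure \<Lambda> k) {q} > 0" by (simp add: zero_less_iff_neq_zero)
    then have "q \<in> weighted_part \<Lambda>" unfolding weighted_part_def using l k q(1) by blast
    then show False using q(2) by blast
  qed
next
  case False
  obtain g where g: "transverse_path (leaves \<Lambda>) g" "k = path_image g" using k by (auto simp: transverse_arc_def)
  have "q \<notin> measure_support (tmeasure \<Lambda> k)" using measured_laminationD(6)[OF ml g(1)] g(2) False by blast
  then obtain U where U: "open U" "q \<in> U" "emeasure (tmeasure \<Lambda> k) U = 0"
    by (auto simp: measure_support_def)
  have "emeasure (tmeasure \<Lambda> k) {q} \<le> emeasure (tmeasure \<Lambda> k) U"
    using U measured_laminationD(5)[OF ml g(1)] g(2) by (intro emeasure_mono) auto
  then show ?thesis using U(3) by simp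
qed

text \<open>If both endpoints of a chord lie on a leaf, the chord stays in the plane of the leaf and its
  radial projection moves from one endpoint to the other inside the leaf.\<close>

definition chord :: "real^3 \<Rightarrow> real^3 \<Rightarrow> real \<Rightarrow> real^3" where
  "chord p q s = (1 - s) *\<^sub>R p + s *\<^sub>R q"

definition radial :: "real^3 \<Rightarrow> real^3" where
  "radial v = (1 / sqrt (- mink v v)) *\<^sub>R v"

lemma chord_timelike:
  assumes "p \<in> H2" "q \<in> H2" "s \<in> {0..1}"
  shows "- mink (chord p q s) (chord p q s) \<ge> 1" "chord p q s $ 1 > 0"
proof -
  have "- mink (chord p q s) (chord p q s) = (1 - s)\<^sup>2 + s\<^sup>2 + 2 * (s * (1 - s)) * (- mink p q)"
    by (simp add: chord_def H2D[OF assms(1)] H2D[OF assms(2)] mink_commute[of q p] power2_eq_square algebra_simps)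
  also have "\<dots> \<ge> (1 - s)\<^sup>2 + s\<^sup>2 + 2 * (s * (1 - s)) * 1"
    using assms(3) mink_H2_le[OF assms(1,2)] by (intro add_left_mono mult_left_mono) auto
  finally show "- mink (chord p q s) (chord p q s) \<ge> 1" by (simp add: power2_eq_square algebra_simps)
  have "chord p q s $ 1 = (1 - s) * p $ 1 + s * q $ 1" by (simp add: chord_def)
  also have "\<dots> \<ge> (1 - s) * 1 + s * 1"
    using assms(3) H2_1_ge[OF assms(1)] H2_1_ge[OF assms(2)] by (intro add_mono mult_left_mono) auto
  finally show "chord p q s $ 1 > 0" by simp
qed

lemma radial_H2:
  assumes "- mink v v \<ge> 1" "v $ 1 > 0"
  shows "radial v \<in> H2"
proof -
  have "sqrt (- mink v v) > 0" "sqrt (- mink v v) * sqrt (- mink v v) = - mink v v"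
    using assms(1) by auto
  then show ?thesis using assms by (auto simp: radial_def H2_def field_simps)
qed

lemma radial_lipschitz:
  assumes "- mink v v \<ge> 1" "- mink w w \<ge> 1" "norm v \<le> R" "norm w \<le> R"
  shows "norm (radial v - radial w) \<le> (1 + 2 * R\<^sup>2) * norm (v - w)"
proof -
  define a where "a = sqrt (- mink v v)"
  define b where "b = sqrt (- mink w w)"
  have ab: "a \<ge> 1" "b \<ge> 1" using assms(1,2) by (auto simp: a_def b_def)
  have R: "R \<ge> 0" using assms(3) norm_ge_zero order_trans by blast
  have "\<bar>1 / a - 1 / b\<bar> = \<bar>b - a\<bar> / (a * b)" using ab by (simp add: field_simps abs_divide)
  also have "\<dots> \<le> \<bar>b - a\<bar>"
  proof -
    have "a * b \<ge> 1 * 1" using ab by (intro mult_mono) auto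
    then show ?thesis by (simp add: divide_le_eq mult_le_cancel_left1)
  qed
  also have "\<dots> \<le> \<bar>b - a\<bar> * (b + a)" using ab by (simp add: mult_le_cancel_left1)
  also have "\<dots> = \<bar>b\<^sup>2 - a\<^sup>2\<bar>"   proof -
    have "b\<^sup>2 - a\<^sup>2 = (b - a) * (b + a)" by (simp add: power2_eq_square algebra_simps)
    then show ?thesis using ab by (simp add: abs_mult)
  qed
  also have "b\<^sup>2 - a\<^sup>2 = mink v (v - w) + mink (v - w) w"
    using assms(1,2) by (simp add: a_def b_def)
  also have "\<bar>\<dots>\<bar> \<le> norm v * norm (v - w) + norm (v - w) * norm w"
    using abs_mink_le[of v "v - w"] abs_mink_le[of "v - w" w] by linarith
  also have "\<dots> \<le> R * norm (v - w) + norm (v - w) * R"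
    using assms by (intro add_mono mult_right_mono mult_left_mono) auto
  finally have 1: "\<bar>1 / a - 1 / b\<bar> \<le> 2 * R * norm (v - w)" by simp
  have "radial v - radial w = (1 / a) *\<^sub>R (v - w) + (1 / a - 1 / b) *\<^sub>R w"
    by (simp add: radial_def a_def b_def algebra_simps)
  then have "norm (radial v - radial w) \<le> \<bar>1 / a\<bar> * norm (v - w) + \<bar>1 / a - 1 / b\<bar> * norm w"
    by (metis norm_scaleR norm_triangle_ineq)
  also have "\<dots> \<le> 1 * norm (v - w) + (2 * R * norm (v - w)) * R"
    using ab 1 assms R by (intro add_mono mult_mono) auto
  finally show ?thesis by (simp add: power2_eq_square algebra_simps)
qed

lemma rectifiable_reparam:
  assumes "rectifiable g" "0 \<le> \<alpha>" "\<alpha> \<le> \<beta>" "\<beta> \<le> 1"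
  shows "rectifiable (\<lambda>t. g (\<alpha> + (\<beta> - \<alpha>) * t))"
proof -
  let ?w = "\<lambda>t. \<alpha> + (\<beta> - \<alpha>) * t"
  obtain B where B: "\<And>ts. sorted ts \<Longrightarrow> set ts \<subseteq> {0..1} \<Longrightarrow>
    (\<Sum>j<length ts - 1. dist (g (ts ! j)) (g (ts ! Suc j))) \<le> B"
    using assms(1) unfolding rectifiable_def by blast
  have w01: "?w t \<in> {0..1}" if "t \<in> {0..1}" for t
  proof -
    have "0 \<le> (\<beta> - \<alpha>) * t" using that assms by simp
    moreover have "(\<beta> - \<alpha>) * t \<le> (\<beta> - \<alpha>) * 1"
      by (rule mult_left_mono) (use that assms in auto)
    ultimately show ?thesis using assms by auto
  qed
  have "(\<Sum>j<length ts - 1. dist (g (?w (ts ! j))) (g (?w (ts ! Suc j)))) \<le> B"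
    if ts: "sorted ts" "set ts \<subseteq> {0..1}" for ts
  proof -
    have "sorted (map ?w ts)"
      using ts(1) assms by (auto simp: sorted_map intro!: sorted_wrt_mono_rel[OF _ ts(1)] mult_left_mono)
    moreover have "set (map ?w ts) \<subseteq> {0..1}" using ts(2) w01 by auto
    ultimately have "(\<Sum>j<length (map ?w ts) - 1. dist (g (map ?w ts ! j)) (g (map ?w ts ! Suc j))) \<le> B"
      by (rule B)
    also have "(\<Sum>j<length (map ?w ts) - 1. dist (g (map ?w ts ! j)) (g (map ?w ts ! Suc j))) =
        (\<Sum>j<length ts - 1. dist (g (?w (ts ! j))) (g (?w (ts ! Suc j))))"
      by (intro sum.cong) auto
    finally show ?thesis .
  qed
  then show ?thesis unfolding rectifiable_def by blast
qed

context crossed_segment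
begin

lemma geod_\<nu>_sign:
  assumes "r \<in> Cr" "r' \<in> Cr" "z \<in> geod (\<nu> r')"
  shows "sgn (mink (\<nu> r) z) = sgn (r' - r)"
proof -
  have z: "z \<in> H2" "mink (\<nu> r') z = 0" using assms(3) by (auto simp: geod_def)
  consider "r < r'" | "r = r'" | "r' < r" by linarith
  then show ?thesis
    by cases (use \<nu>_decreasing[OF assms(1,2) _ z(1)] \<nu>_decreasing[OF assms(2,1) _ z(1)] z in auto)
qed

text \<open>As the half-planes bounded by the leaves are nested, the side of a leaf on which a point of another leaf
  lies is decided by the order of their parameters. An arc crosses the leaves in the direction in which
  \<open>\<rho>\<close> moves.\<close>

lemma transverse_of_monotone:
  assumes cont: "continuous_on {0..1} f" and rect: "rectifiable f"
    and \<rho>: "\<And>t. t \<in> {0..1} \<Longrightarrow> \<rho> t \<in> Cr \<and> f t \<in> geod (\<nu> (\<rho> t))"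
    and mono: "strict_mono_on {0..1} \<rho> \<or> strict_antimono_on {0..1} \<rho>"
  shows "transverse_path (leaves \<Lambda>) f"
  unfolding transverse_path_def
proof (intro conjI ballI)
  obtain e :: real where e: "e = 1 \<or> e = -1" "\<And>s t. s \<in> {0..1} \<Longrightarrow> t \<in> {0..1} \<Longrightarrow> sgn (\<rho> s - \<rho> t) = e * sgn (s - t)"
  proof (cases "strict_mono_on {0..1} \<rho>")
    case True
    have "sgn (\<rho> s - \<rho> t) = 1 * sgn (s - t)" if "s \<in> {0..1}" "t \<in> {0..1}" for s t
      using monotone_onD[OF True that] monotone_onD[OF True that(2,1)] by (cases s t rule: linorder_cases) auto
    then show ?thesis using that by blast
  next
    case False
    then have *: "strict_antimono_on {0..1} \<rho>" using mono by blast
    have "sgn (\<rho> s - \<rho> t) = -1 * sgn (s - t)" if "s \<in> {0..1}" "t \<in> {0..1}" for s t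
      using monotone_onD[OF * that] monotone_onD[OF * that(2,1)] by (cases s t rule: linorder_cases) auto
    then show ?thesis using that by blast
  qed
  have sign: "sgn (mink (\<nu> (\<rho> t)) (f s)) = e * sgn (s - t)" if "s \<in> {0..1}" "t \<in> {0..1}" for s t
    using geod_\<nu>_sign[of "\<rho> t" "\<rho> s" "f s"] \<rho> e(2) that by auto
  show "arc f"
    unfolding arc_def path_def
  proof (intro conjI cont inj_onI)
    fix s t assume st: "s \<in> {0..1}" "t \<in> {0..1}" "f s = f t"
    then have "mink (\<nu> (\<rho> t)) (f s) = 0" using \<rho>[of t] by (simp add: geod_def)
    then show "s = t" using sign[OF st(1,2)] e(1) by (auto simp: sgn_if split: if_splits)
  qed
  show "path_image f \<subseteq> H2" using \<rho> by (auto simp: path_image_def geod_def)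
  show "rectifiable f" by (rule rect)
  fix t0 :: real
  have "\<exists>p u. unit_tangent p u \<and> l = range (geoline p u) \<and>
           (\<forall>s\<in>{0..1}. sgn (side p u (f s)) = sgn (t - s))"
    if t: "t \<in> {0..1}" "l \<in> leaves \<Lambda>" "f t \<in> l" for t l
  proof -
    have C: "\<rho> t \<in> Cr" "f t \<in> geod (\<nu> (\<rho> t))" using \<rho>[OF t(1)] by auto
    have l: "l = geod (\<nu> (\<rho> t))"
      by (rule measured_laminationD(2)[OF ml t(2) \<nu>_props(2)[OF C(1)] t(3) C(2)])
    obtain p u where pu: "unit_tangent p u" "geod (\<nu> (\<rho> t)) = range (geoline p u)"
        "\<forall>q. side p u q = (- e) * mink (\<nu> (\<rho> t)) q"
      using oriented_frame[OF \<nu>_props(1)[OF C(1)], of "- e"] e(1) by auto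
    have "sgn (side p u (f s)) = sgn (t - s)" if "s \<in> {0..1}" for s
    proof -
      have "sgn (side p u (f s)) = - (e * sgn (mink (\<nu> (\<rho> t)) (f s)))" using pu(3) e(1) by (auto simp: sgn_mult)
      also have "\<dots> = - sgn (s - t)" using sign[OF that t(1)] e(1) by auto
      also have "\<dots> = sgn (t - s)" by (metis minus_diff_eq sgn_minus)
      finally show ?thesis .
    qed
    then show ?thesis using pu l by blast
  qed
  then show "\<exists>\<epsilon>>0. \<forall>t\<in>{0..1}. \<forall>l\<in>leaves \<Lambda>. \<bar>t - t0\<bar> < \<epsilon> \<and> f t \<in> l \<longrightarrow>
        (\<exists>p u. unit_tangent p u \<and> l = range (geoline p u) \<and>
           (\<forall>s\<in>{0..1}. \<bar>s - t0\<bar> < \<epsilon> \<longrightarrow> sgn (side p u (f s)) = sgn (t - s)))"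
    by (intro exI[of _ 1]) (meson zero_less_one)
qed

text \<open>The transverse measure may have its atom on an arc far away from the segment. Where the leaves foliate a
  neighbourhood of \<open>\<sigma> r0\<close>, a short piece of that arc around the atom meets, at time \<open>t\<close>, the leaf through a
  unique point \<open>\<sigma> (\<rho> t)\<close>, since the normals are strictly decreasing along the segment. Moving each point inside its
  leaf to this point of the segment is a homotopy of transverse arcs, which carries the atom along. Here \<open>\<rho>\<close> is
  continuous and injective, hence monotone, and this makes all intermediate arcs rectifiable and transverse.\<close>

lemma atom_transport:
  assumes ab: "0 \<le> a" "a < b" "b \<le> d" and fol: "{a<..<b} \<subseteq> Cr" and r0: "r0 \<in> {a<..<b}"
    and w: "\<sigma> r0 \<in> weighted_part \<Lambda>"
  shows "emeasure M {\<sigma> r0} > 0"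
proof -
  have I: "r \<in> Cr" if "a < r" "r < b" for r using fol that by auto
  have r0C: "r0 \<in> Cr" using r0 fol by auto
  obtain l k q where l: "l \<in> leaves \<Lambda>" "\<sigma> r0 \<in> l" and k: "transverse_arc (leaves \<Lambda>) k" "q \<in> k" "q \<in> l"
    "emeasure (tmeasure \<Lambda> k) {q} > 0"
    using w by (auto simp: weighted_part_def)
  have lg: "l = geod (\<nu> r0)"
    by (rule measured_laminationD(2)[OF ml l(1) \<nu>_props(2)[OF r0C] l(2) \<nu>_geod[OF r0C]])
  obtain g where g: "transverse_path (leaves \<Lambda>) g" "k = path_image g" using k(1)
    by (auto simp: transverse_arc_def)
  obtain t0 where t0: "t0 \<in> {0..1}" "q = g t0" using k(2) g(2) by (auto simp: path_image_def)
  have gc: "continuous_on {0..1} g" and grect: "rectifiable g" and gH: "\<And>t. t \<in> {0..1} \<Longrightarrow> g t \<in> H2"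
    using g(1) by (auto simp: transverse_path_def arc_def path_def path_image_def)
  obtain a1 b1 where a1: "a < a1" "a1 < r0" and b1: "r0 < b1" "b1 < b"
    using r0 dense[of a r0] dense[of r0 b] by auto
  have q0: "mink (\<nu> r0) q = 0" "q \<in> H2" using k(3) lg by (auto simp: geod_def)
  have sg: "mink (\<nu> a1) (g t0) > 0" "mink (\<nu> b1) (g t0) < 0"
    using \<nu>_decreasing[OF I[of a1] r0C, of q] \<nu>_decreasing[OF r0C I[of b1], of q] a1 b1 r0 q0 t0(2) by auto
  obtain \<epsilon>1 where \<epsilon>1: "\<epsilon>1 > 0" "\<And>t. t \<in> {0..1} \<Longrightarrow> \<bar>t - t0\<bar> < \<epsilon>1 \<Longrightarrow> mink (\<nu> a1) (g t) > 0 \<and> mink (\<nu> b1) (g t) < 0"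
  proof -
    have "((\<lambda>t. mink (\<nu> c) (g t)) \<longlongrightarrow> mink (\<nu> c) (g t0)) (at t0 within {0..1})" for c
      using continuous_on_mink[OF continuous_on_const gc] t0(1) by (auto simp: continuous_on_def)
    then have "\<forall>\<^sub>F t in at t0 within {0..1}. mink (\<nu> a1) (g t) > 0 \<and> mink (\<nu> b1) (g t) < 0"
      using sg by (intro eventually_conj order_tendstoD) auto
    then obtain \<epsilon>1 where "\<epsilon>1 > 0" "\<And>t. t \<in> {0..1} \<Longrightarrow> t \<noteq> t0 \<Longrightarrow> \<bar>t - t0\<bar> < \<epsilon>1 \<Longrightarrow> mink (\<nu> a1) (g t) > 0 \<and>
      mink (\<nu> b1) (g t) < 0"
      unfolding eventually_at by (auto simp: dist_real_def)
    then have "mink (\<nu> a1) (g t) > 0 \<and> mink (\<nu> b1) (g t) < 0" if "t \<in> {0..1}" "\<bar>t - t0\<bar> < \<epsilon>1" for t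
      using that sg by (cases "t = t0") auto
    then show ?thesis using \<open>\<epsilon>1 > 0\<close> that by blast
  qed
  note local = g(1)[unfolded transverse_path_def, THEN conjunct2, THEN conjunct2, THEN conjunct2]
  obtain \<epsilon>2 where \<epsilon>2: "\<epsilon>2 > 0" "\<forall>t\<in>{0..1}. \<forall>l\<in>leaves \<Lambda>. \<bar>t - t0\<bar> < \<epsilon>2 \<and> g t \<in> l \<longrightarrow>
        (\<exists>p u. unit_tangent p u \<and> l = range (geoline p u) \<and>
           (\<forall>s\<in>{0..1}. \<bar>s - t0\<bar> < \<epsilon>2 \<longrightarrow> sgn (side p u (g s)) = sgn (t - s)))"
    using bspec[OF local t0(1)] by (elim exE conjE)
  define \<epsilon> where "\<epsilon> = min \<epsilon>1 \<epsilon>2 / 2"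
  define \<alpha> where "\<alpha> = max 0 (t0 - \<epsilon>)"
  define \<beta> where "\<beta> = min 1 (t0 + \<epsilon>)"
  have \<epsilon>: "\<epsilon> > 0" "\<epsilon> < \<epsilon>1" "\<epsilon> < \<epsilon>2" using \<epsilon>1(1) \<epsilon>2(1) by (auto simp: \<epsilon>_def min_def)
  have \<alpha>\<beta>: "0 \<le> \<alpha>" "\<alpha> < \<beta>" "\<beta> \<le> 1" "\<alpha> \<le> t0" "t0 \<le> \<beta>"
    using \<epsilon>(1) t0(1) by (auto simp: \<alpha>_def \<beta>_def)
  have near: "t \<in> {0..1}" "\<bar>t - t0\<bar> < \<epsilon>1" "\<bar>t - t0\<bar> < \<epsilon>2" if "t \<in> {\<alpha>..\<beta>}" for t
    using that \<epsilon> by (auto simp: \<alpha>_def \<beta>_def)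
  have \<nu>c: "continuous_on Cr \<nu>"
  proof -
    obtain K where K: "K \<ge> 0" "\<And>r s. r \<in> Cr \<Longrightarrow> s \<in> Cr \<Longrightarrow> norm (\<nu> r - \<nu> s) \<le> K * \<bar>r - s\<bar>"
      using \<nu>_estimates by blast
    show ?thesis
      by (rule lipschitz_on_continuous_on[of K]) (auto intro!: lipschitz_onI simp: K dist_norm)
  qed
  \<comment> \<open>the leaves through \<open>\<sigma> a1\<close> and \<open>\<sigma> b1\<close> separate \<open>g t\<close> from the ends, so some leaf between them contains it\<close>
  have "\<exists>r. a1 < r \<and> r < b1 \<and> mink (\<nu> r) (g t) = 0" if t: "t \<in> {\<alpha>..\<beta>}" for t
  proof -
    have s: "mink (\<nu> a1) (g t) > 0" "mink (\<nu> b1) (g t) < 0" using \<epsilon>1(2) near[OF t] by auto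
    have "continuous_on {a1..b1} (\<lambda>r. mink (\<nu> r) (g t))"
      by (intro continuous_intros continuous_on_subset[OF \<nu>c]) (use I a1 b1 in auto)
    then obtain r where r: "a1 \<le> r" "r \<le> b1" "mink (\<nu> r) (g t) = 0"
      using IVT2'[of "\<lambda>r. mink (\<nu> r) (g t)" b1 0 a1] s a1 b1 by auto
    then have "r \<noteq> a1" "r \<noteq> b1" using s by auto
    then show ?thesis using r by force
  qed
  then obtain \<rho> where \<rho>: "\<And>t. t \<in> {\<alpha>..\<beta>} \<Longrightarrow> a1 < \<rho> t \<and> \<rho> t < b1 \<and> mink (\<nu> (\<rho> t)) (g t) = 0" by metis
  have \<rho>C: "\<rho> t \<in> Cr" and \<rho>g: "g t \<in> geod (\<nu> (\<rho> t))" if "t \<in> {\<alpha>..\<beta>}" for t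
    using \<rho>[OF that] a1 b1 I gH near(1)[OF that] by (auto simp: geod_def)
  have \<rho>0: "\<rho> t0 = r0"
    using geod_\<nu>_sign[OF r0C \<rho>C \<rho>g, of t0] \<alpha>\<beta> q0(1) t0(2) by (simp add: sgn_if split: if_splits)
  have \<rho>sign: "sgn (mink (\<nu> r) (g t)) = sgn (\<rho> t - r)" if "t \<in> {\<alpha>..\<beta>}" "r \<in> Cr" for t r
    by (rule geod_\<nu>_sign[OF that(2) \<rho>C[OF that(1)] \<rho>g[OF that(1)]])
  have \<rho>cont: "continuous_on {\<alpha>..\<beta>} \<rho>"
    unfolding continuous_on_def
  proof (intro ballI order_tendstoI)
    fix t assume t: "t \<in> {\<alpha>..\<beta>}"
    have lim: "((\<lambda>t. mink (\<nu> c) (g t)) \<longlongrightarrow> mink (\<nu> c) (g t)) (at t within {\<alpha>..\<beta>})" for c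
      using continuous_on_mink[OF continuous_on_const continuous_on_subset[OF gc], of "{\<alpha>..\<beta>}" "\<nu> c"] t near(1)
      by (auto simp: continuous_on_def)
    have ev: "\<forall>\<^sub>F t' in at t within {\<alpha>..\<beta>}. t' \<in> {\<alpha>..\<beta>}" by (simp add: eventually_at_filter)
    show "\<forall>\<^sub>F t' in at t within {\<alpha>..\<beta>}. c < \<rho> t'" if c: "c < \<rho> t" for c
    proof (cases "c \<le> a1")
      case True
      show ?thesis using ev by eventually_elim (use \<rho> True in force)
    next
      case False
      then have C: "c \<in> Cr" using c \<rho>[OF t] a1 b1 by (intro I) auto
      have "mink (\<nu> c) (g t) > 0" using \<rho>sign[OF t C] c by (simp add: sgn_if split: if_splits)
      then have "\<forall>\<^sub>F t' in at t within {\<alpha>..\<beta>}. mink (\<nu> c) (g t') > 0" using lim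
        by (rule order_tendstoD(1)[rotated])
      then show ?thesis using ev
      proof eventually_elim
        case (elim t')
        then show ?case using \<rho>sign[OF elim(2) C] by (simp add: sgn_if split: if_splits)
      qed
    qed
    show "\<forall>\<^sub>F t' in at t within {\<alpha>..\<beta>}. \<rho> t' < c" if c: "\<rho> t < c" for c
    proof (cases "b1 \<le> c")
      case True
      show ?thesis using ev by eventually_elim (use \<rho> True in force)
    next
      case False
      then have C: "c \<in> Cr" using c \<rho>[OF t] a1 b1 by (intro I) auto
      have "mink (\<nu> c) (g t) < 0" using \<rho>sign[OF t C] c by (simp add: sgn_if split: if_splits)
      then have "\<forall>\<^sub>F t' in at t within {\<alpha>..\<beta>}. mink (\<nu> c) (g t') < 0" using lim
        by (rule order_tendstoD(2)[rotated])
      then show ?thesis using ev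
      proof eventually_elim
        case (elim t')
        then show ?case using \<rho>sign[OF elim(2) C] by (simp add: sgn_if split: if_splits)
      qed
    qed
  qed
  have \<rho>inj: "inj_on \<rho> {\<alpha>..\<beta>}"
  proof (rule inj_onI)
    fix s t assume st: "s \<in> {\<alpha>..\<beta>}" "t \<in> {\<alpha>..\<beta>}" "\<rho> s = \<rho> t"
    obtain p u where pu: "unit_tangent p u" "geod (\<nu> (\<rho> t)) = range (geoline p u)"
      "\<forall>s\<in>{0..1}. \<bar>s - t0\<bar> < \<epsilon>2 \<longrightarrow> sgn (side p u (g s)) = sgn (t - s)"
      using \<epsilon>2(2)[rule_format, OF near(1)[OF st(2)] \<nu>_props(2)[OF \<rho>C[OF st(2)]] conjI[OF near(3)[OF st(2)] \<rho>g[OF st(2)]]] by blast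
    have "g s \<in> geod (lcross p u)" using \<rho>g[OF st(1)] st(3) pu(2) range_geoline[OF pu(1)] by simp
    then have "side p u (g s) = 0" by (simp add: side_eq geod_def)
    then have "sgn (t - s) = 0" using pu(3) near[OF st(1)] by (metis sgn_zero)
    then show "s = t" by (simp add: sgn_zero_iff)
  qed
  have \<rho>mono: "strict_mono_on {\<alpha>..\<beta>} \<rho> \<or> strict_antimono_on {\<alpha>..\<beta>} \<rho>"
    using injective_eq_monotone_map[of "{\<alpha>..\<beta>}" \<rho>] \<rho>cont \<rho>inj by (simp add: is_interval_cc)
  \<comment> \<open>the piece \<open>[\<alpha>, \<beta>]\<close> of the arc, reparametrized on the unit interval\<close>
  define w where "w t = \<alpha> + (\<beta> - \<alpha>) * t" for t
  have wr: "w t \<in> {\<alpha>..\<beta>}" if "t \<in> {0..1}" for t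
  proof -
    have "0 \<le> (\<beta> - \<alpha>) * t" using that \<alpha>\<beta> by simp
    moreover have "(\<beta> - \<alpha>) * t \<le> (\<beta> - \<alpha>) * 1"
      by (rule mult_left_mono) (use that \<alpha>\<beta> in auto)
    ultimately show ?thesis by (auto simp: w_def)
  qed
  have wm: "w s < w t" if "s < t" for s t using that \<alpha>\<beta> by (simp add: w_def)
  have wc: "continuous_on {0..1} w" unfolding w_def by (intro continuous_intros)
  have g'c: "continuous_on {0..1} (\<lambda>t. g (w t))"
    using continuous_on_compose2[OF gc wc] wr near(1) by blast
  have \<rho>'c: "continuous_on {0..1} (\<lambda>t. \<rho> (w t))"
    using continuous_on_compose2[OF \<rho>cont wc] wr by blast
  have \<rho>'mono: "strict_mono_on {0..1} (\<lambda>t. \<rho> (w t)) \<or> strict_antimono_on {0..1} (\<lambda>t. \<rho> (w t))"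
    using \<rho>mono wr wm unfolding monotone_on_def by blast
  define V where "V s t = chord (g (w t)) (\<sigma> (\<rho> (w t))) s" for s t
  define h where "h s t = radial (V s t)" for s t
  have H2s: "g (w t) \<in> H2" if "t \<in> {0..1}" for t using gH near(1) wr that by blast
  have tl: "- mink (V s t) (V s t) \<ge> 1"
     "V s t $ 1 > 0" if "s \<in> {0..1}" "t \<in> {0..1}" for s t
    using chord_timelike[OF H2s[OF that(2)] \<sigma>_H2 that(1)] unfolding V_def by auto
  have h_geod: "\<rho> (w t) \<in> Cr \<and> h s t \<in> geod (\<nu> (\<rho> (w t)))" if "s \<in> {0..1}" "t \<in> {0..1}" for s t
  proof -
    have C: "\<rho> (w t) \<in> Cr" by (rule \<rho>C[OF wr[OF that(2)]])
    have "h s t \<in> H2" unfolding h_def by (rule radial_H2[OF tl[OF that]])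
    moreover have "mink (\<nu> (\<rho> (w t))) (h s t) = 0"
      using \<nu>_\<sigma>[OF C] \<rho>[OF wr[OF that(2)]] by (simp add: h_def radial_def V_def chord_def)
    ultimately show ?thesis using C by (simp add: geod_def)
  qed
  have h0: "h 0 t = g (w t)" if "t \<in> {0..1}" for t
    using H2D(1)[OF H2s[OF that]] by (simp add: h_def V_def chord_def radial_def)
  have h1: "h 1 t = \<sigma> (\<rho> (w t))" for t
    using H2D(1)[OF \<sigma>_H2] by (simp add: h_def V_def chord_def radial_def)
  have hc: "continuous_on ({0..1} \<times> {0..1}) (\<lambda>(s, t). h s t)"
  proof -
    have c1: "continuous_on ({0..1} \<times> {0..1}) (\<lambda>x. g (w (snd x)))"
      by (rule continuous_on_compose2[OF g'c]) (auto intro!: continuous_intros)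
    have c2: "continuous_on ({0..1} \<times> {0..1}) (\<lambda>x. \<sigma> (\<rho> (w (snd x))))"
      by (intro continuous_\<sigma> continuous_on_compose2[OF \<rho>'c]) (auto intro!: continuous_intros)
    have c3: "continuous_on ({0..1} \<times> {0..1}) (\<lambda>x. V (fst x) (snd x))"
      unfolding V_def chord_def by (intro continuous_intros c1 c2)
    have "sqrt (- mink (V (fst x) (snd x)) (V (fst x) (snd x))) \<noteq> 0"
      if "x \<in> {0..1} \<times> {0..1}" for x
      using tl(1)[of "fst x" "snd x"] that by auto
    then show ?thesis
      unfolding h_def radial_def case_prod_beta by (intro continuous_intros c3) auto
  qed
  have htrans: "transverse_path (leaves \<Lambda>) (h s)" if s: "s \<in> {0..1}" for s
  proof (rule transverse_of_monotone[OF _ _ h_geod[OF s] \<rho>'mono])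
    have "continuous_on {0..1} (\<lambda>t. (\<lambda>(s, t). h s t) (s, t))"
      by (rule continuous_on_compose2[OF hc]) (use s in \<open>auto intro!: continuous_intros\<close>)
    then show "continuous_on {0..1} (h s)" by simp
    have "compact ((\<lambda>t. g (w t)) ` {0..1} \<union> segment x y)"
      by (intro compact_Un compact_segment compact_continuous_image g'c) auto
    from compact_imp_bounded[OF this]
    obtain R where R: "R > 0" "\<And>v. v \<in> (\<lambda>t. g (w t)) ` {0..1} \<union> segment x y \<Longrightarrow> norm v \<le> R"
      unfolding bounded_pos by blast
    obtain C where C: "C > 0" "\<And>s t. s \<in> {0..d} \<Longrightarrow> t \<in> {0..d} \<Longrightarrow> norm (\<sigma> s - \<sigma> t) \<le> C * \<bar>s - t\<bar>"
      using \<sigma>_lipschitz by blast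
    let ?L = "1 + 2 * (2 * R)\<^sup>2"
    show "rectifiable (h s)"
    proof (rule rectifiable_combine[where g = "\<lambda>t. g (w t)" and f = "\<lambda>t. \<rho> (w t)" and A = ?L and C = "?L * C"])
      show "rectifiable (\<lambda>t. g (w t))"
        unfolding w_def using \<alpha>\<beta> by (intro rectifiable_reparam grect) auto
      show "mono_on {0..1} (\<lambda>t. \<rho> (w t)) \<or> antimono_on {0..1} (\<lambda>t. \<rho> (w t))"
        using \<rho>'mono unfolding monotone_on_def by (metis order_le_less)
      fix t t' :: real assume tt: "t \<in> {0..1}" "t' \<in> {0..1}"
      have rd: "\<rho> (w t) \<in> {0..d}" "\<rho> (w t') \<in> {0..d}"
        using h_geod[OF s] tt by (auto simp: Cr_def)
      have bd: "norm (V s t) \<le> 2 * R" if "t \<in> {0..1}" "\<rho> (w t) \<in> {0..d}" for t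
      proof -
        have "norm (V s t) \<le> \<bar>1 - s\<bar> * norm (g (w t)) + \<bar>s\<bar> * norm (\<sigma> (\<rho> (w t)))"
          unfolding V_def chord_def by (metis norm_scaleR norm_triangle_ineq)
        also have "\<dots> \<le> 1 * R + 1 * R"
          using s R that by (intro add_mono mult_mono) (auto simp: segment_eq)
        finally show ?thesis by simp
      qed
      have diff: "V s t - V s t' =
          (1 - s) *\<^sub>R (g (w t) - g (w t')) + s *\<^sub>R (\<sigma> (\<rho> (w t)) - \<sigma> (\<rho> (w t')))"
        by (simp add: V_def chord_def algebra_simps)
      have "norm (h s t - h s t') \<le> ?L * norm (V s t - V s t')"
        unfolding h_def by (rule radial_lipschitz) (use tl(1)[OF s] bd tt rd in auto)
      also have "\<dots> \<le> ?L * (\<bar>1 - s\<bar> * norm (g (w t) - g (w t')) + \<bar>s\<bar> * norm (\<sigma> (\<rho> (w t)) - \<sigma> (\<rho> (w t'))))"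
        unfolding diff by (intro mult_left_mono) (metis norm_scaleR norm_triangle_ineq, simp)
      also have "\<dots> \<le> ?L * (1 * norm (g (w t) - g (w t')) + 1 * (C * \<bar>\<rho> (w t) - \<rho> (w t')\<bar>))"
        using s C rd by (intro mult_left_mono add_mono mult_mono) auto
      finally show "norm (h s t - h s t') \<le> ?L * norm (g (w t) - g (w t')) + ?L * C * \<bar>\<rho> (w t) - \<rho> (w t')\<bar>"
        by (simp add: algebra_simps)
    qed (use C(1) in auto)
  qed
  have hl: "h s t \<in> l' \<longleftrightarrow> h 0 t \<in> l'" if "s \<in> {0..1}" "t \<in> {0..1}" "l' \<in> leaves \<Lambda>" for s t l'
  proof -
    have "h s t \<in> geod (\<nu> (\<rho> (w t)))" "h 0 t \<in> geod (\<nu> (\<rho> (w t)))" "geod (\<nu> (\<rho> (w t))) \<in> leaves \<Lambda>"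
      using h_geod[OF that(1,2)] h_geod[of 0 t] that(2) \<nu>_props(2) by auto
    then show ?thesis using measured_laminationD(2)[OF ml that(3)] by metis
  qed
  have "transverse_homotopy (leaves \<Lambda>) h"
    unfolding transverse_homotopy_def using hc htrans hl by blast
  moreover define \<tau>0 where "\<tau>0 = (t0 - \<alpha>) / (\<beta> - \<alpha>)"
  have \<tau>0: "\<tau>0 \<in> {0..1}" "w \<tau>0 = t0" using \<alpha>\<beta> by (auto simp: \<tau>0_def w_def field_simps)
  ultimately have eq: "emeasure (tmeasure \<Lambda> (path_image (h 1))) {\<sigma> r0} = emeasure (tmeasure \<Lambda> (path_image (h 0))) {q}"
    using measured_laminationD(8)[OF ml, of h "{\<tau>0}"] h0[OF \<tau>0(1)] h1[of \<tau>0] \<rho>0 t0(2) by auto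
  have arcs: "transverse_arc (leaves \<Lambda>) (path_image (h 0))" "transverse_arc (leaves \<Lambda>) (path_image (h 1))"
    using htrans[of 0] htrans[of 1] unfolding transverse_arc_def by auto
  have "path_image (h 0) \<subseteq> k"
    using h0 wr near(1) unfolding g(2) path_image_def by fastforce
  moreover have "q \<in> path_image (h 0)"
    using h0[OF \<tau>0(1)] \<tau>0 t0(2) unfolding path_image_def by (metis image_eqI)
  ultimately have e0: "emeasure (tmeasure \<Lambda> (path_image (h 0))) {q} = emeasure (tmeasure \<Lambda> k) {q}"
    by (intro measured_laminationD(7)[OF ml k(1) arcs(1)]) auto
  have "path_image (h 1) \<subseteq> segment x y"
    using h1 h_geod[of 1] unfolding path_image_def segment_eq Cr_def by auto
  moreover have "\<sigma> r0 \<in> path_image (h 1)"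
    using h1[of \<tau>0] \<tau>0 \<rho>0 unfolding path_image_def by (metis image_eqI)
  ultimately have e1: "emeasure (tmeasure \<Lambda> (path_image (h 1))) {\<sigma> r0} = emeasure M {\<sigma> r0}"
    by (intro measured_laminationD(7)[OF ml transverse_segment arcs(2)]) auto
  show ?thesis using eq e0 e1 k(4) by simp
qed

text \<open>The points at which a subdivision of the segment is allowed to cut. They are dense, since an interval
  in their complement would be foliated by leaves with atoms, each of which would give an atom of the finite
  measure of the segment.\<close>

definition unweighted :: "real set" where
  "unweighted = {r \<in> {0..d}. \<sigma> r \<notin> weighted_part \<Lambda>}"

lemma unweighted_atomless: "unweighted \<subseteq> atomless"
proof
  fix r assume "r \<in> unweighted"
  then have r: "r \<in> {0..d}" "\<sigma> r \<notin> weighted_part \<Lambda>" by (auto simp: unweighted_def)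
  then have "emeasure M {\<sigma> r} = 0"
    by (intro no_atom[OF ml transverse_segment]) (auto simp: segment_eq)
  then show "r \<in> atomless" using r by (simp add: atomless_def measure_def)
qed

lemma unweighted_dense:
  assumes "0 \<le> a" "a < b" "b \<le> d"
  shows "unweighted \<inter> {a<..<b} \<noteq> {}"
proof
  assume *: "unweighted \<inter> {a<..<b} = {}"
  have w: "\<sigma> r \<in> weighted_part \<Lambda>" if "r \<in> {a<..<b}" for r
  proof (rule ccontr)
    assume "\<sigma> r \<notin> weighted_part \<Lambda>"
    then have "r \<in> unweighted" using that assms by (auto simp: unweighted_def)
    then show False using * that by blast
  qed
  have "weighted_part \<Lambda> \<subseteq> lam_support \<Lambda>" by (auto simp: weighted_part_def lam_support_def)
  then have fol: "{a<..<b} \<subseteq> Cr" using w assms by (force simp: Cr_def)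
  have "{a<..<b} \<subseteq> \<sigma> -` {q. measure M {q} \<noteq> 0}"
  proof
    fix r assume r: "r \<in> {a<..<b}"
    interpret finite_measure M by (rule finite_M)
    have "emeasure M {\<sigma> r} > 0" by (rule atom_transport[OF assms fol r w[OF r]])
    then show "r \<in> \<sigma> -` {q. measure M {q} \<noteq> 0}" by (simp add: emeasure_eq_measure)
  qed
  moreover have "countable (\<sigma> -` {q. measure M {q} \<noteq> 0})"
  proof (rule countable_image_inj_on)
    show "countable (\<sigma> ` (\<sigma> -` {q. measure M {q} \<noteq> 0}))"
      by (rule countable_subset[OF image_vimage_subset finite_measure.countable_support[OF finite_M]])
    show "inj_on \<sigma> (\<sigma> -` {q. measure M {q} \<noteq> 0})" by (rule inj_on_subset[OF \<sigma>_inj]) simp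
  qed
  ultimately have "countable {a<..<b}" by (rule countable_subset)
  then show False using assms(2) uncountable_open_interval by blast
qed

lemma crossing_segment: "\<exists>K N. crossing d m unweighted Cr \<nu> J K N"
  by (rule crossing_of_dense[OF unweighted_atomless unweighted_dense])

end

section \<open>The cocycle\<close>

text \<open>The filter base along which the limit in \<^const>\<open>cocycle\<close> is taken.\<close>

definition fine_choice :: "mlam \<Rightarrow> real^3 \<Rightarrow> real^3 \<Rightarrow> real \<Rightarrow> real list \<Rightarrow> (nat \<Rightarrow> real^3) \<Rightarrow> (nat \<Rightarrow> real^3) \<Rightarrow> bool" where
  "fine_choice \<Lambda> x y \<delta> ts p u \<longleftrightarrow> subdivision \<Lambda> x y ts \<and> (\<forall>j < length ts - 1. ts ! Suc j - ts ! j < \<delta>) \<and>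
     leaf_choice \<Lambda> x y ts p u"

text \<open>A limit in \<open>SL(2,\<complex>)\<close> of the products is a limit of their classes. It is the only one: two
  limit classes have representatives at arbitrarily small distance, up to sign. For this, tagged
  subdivisions of every mesh have to exist.\<close>

lemma cocycle_eqI:
  assumes "det B = 1"
    and lim: "\<And>\<epsilon>. \<epsilon> > 0 \<Longrightarrow> \<exists>\<delta>>0. \<forall>ts p u. fine_choice \<Lambda> x y \<delta> ts p u \<longrightarrow>
        dist (ordered_product c \<Lambda> x y ts p u) B < \<epsilon>"
    and ex: "\<And>\<delta>. \<delta> > 0 \<Longrightarrow> \<exists>ts p u. fine_choice \<Lambda> x y \<delta> ts p u"
  shows "cocycle c \<Lambda> x y = psl B"
proof -
  let ?fc = "fine_choice \<Lambda> x y" and ?P = "ordered_product c \<Lambda> x y"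
  have unfold: "(subdivision \<Lambda> x y ts \<and> (\<forall>j < length ts - 1. ts ! Suc j - ts ! j < \<delta>) \<and>
    leaf_choice \<Lambda> x y ts p u)
      = ?fc \<delta> ts p u" for \<delta> ts p u
    by (simp add: fine_choice_def)
  have neg: "dist (- A) (- C) = dist A C" for A C :: "complex^2^2"
    by (simp add: dist_norm norm_minus_commute)
  show ?thesis
    unfolding cocycle_def unfold
  proof (rule the_equality)
    show "psl B \<in> carrier PSL2C \<and> (\<forall>B'\<in>psl B. \<forall>\<epsilon>>0. \<exists>\<delta>>0. \<forall>ts p u. ?fc \<delta> ts p u \<longrightarrow>
        (\<exists>A\<in>psl (?P ts p u). dist A B' < \<epsilon>))"
    proof (intro conjI ballI allI impI)
      show "psl B \<in> carrier PSL2C" using assms(1) by (auto simp: carrier_PSL2C)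
      fix B' \<epsilon> assume B': "B' \<in> psl B" and "\<epsilon> > (0 :: real)"
      obtain \<delta> where \<delta>: "\<delta> > 0" "\<And>ts p u. ?fc \<delta> ts p u \<Longrightarrow> dist (?P ts p u) B < \<epsilon>"
        using lim[OF \<open>\<epsilon> > 0\<close>] by blast
      have "\<exists>A\<in>psl (?P ts p u). dist A B' < \<epsilon>" if "?fc \<delta> ts p u" for ts p u
        using \<delta>(2)[OF that] B' neg by (auto simp: psl_eq)
      then show "\<exists>\<delta>>0. \<forall>ts p u. ?fc \<delta> ts p u \<longrightarrow> (\<exists>A\<in>psl (?P ts p u). dist A B' < \<epsilon>)"
        using \<delta>(1) by blast
    qed
  next
    fix P assume P: "P \<in> carrier PSL2C \<and> (\<forall>B\<in>P. \<forall>\<epsilon>>0. \<exists>\<delta>>0. \<forall>ts p u. ?fc \<delta> ts p u \<longrightarrow>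
        (\<exists>A\<in>psl (?P ts p u). dist A B < \<epsilon>))"
    then obtain B' where B': "P = psl B'" by (auto simp: carrier_PSL2C)
    show "P = psl B"
    proof (rule ccontr)
      assume "P \<noteq> psl B"
      then have ne: "B \<noteq> B'" "- B \<noteq> B'" using B' by (auto simp: psl_eq)
      define \<epsilon> where "\<epsilon> = min (dist B B') (dist (- B) B') / 2"
      have \<epsilon>: "\<epsilon> > 0" using ne by (simp add: \<epsilon>_def)
      have "B' \<in> P" using B' by (simp add: psl_eq)
      then obtain \<delta>1 where \<delta>1: "\<delta>1 > 0" "\<And>ts p u. ?fc \<delta>1 ts p u \<Longrightarrow> \<exists>A\<in>psl (?P ts p u). dist A B' < \<epsilon>"
        using P \<epsilon> by blast
      obtain \<delta>2 where \<delta>2: "\<delta>2 > 0" "\<And>ts p u. ?fc \<delta>2 ts p u \<Longrightarrow> dist (?P ts p u) B < \<epsilon>"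
        using lim[OF \<epsilon>] by blast
      obtain ts p u where "?fc (min \<delta>1 \<delta>2) ts p u" using ex[of "min \<delta>1 \<delta>2"] \<delta>1(1) \<delta>2(1) by auto
      then have "?fc \<delta>1 ts p u" "?fc \<delta>2 ts p u" by (auto simp: fine_choice_def)
      then obtain A where A: "A \<in> psl (?P ts p u)" "dist A B' < \<epsilon>"
        "dist (?P ts p u) B < \<epsilon>" using \<delta>1(2) \<delta>2(2) by blast
      then have "dist A B < \<epsilon> \<or> dist A (- B) < \<epsilon>" using neg by (auto simp: psl_eq)
      then have "dist B B' < 2 * \<epsilon> \<or> dist (- B) B' < 2 * \<epsilon>"
        using A(2) dist_triangle2[of B B' A] dist_triangle2[of "- B" B' A] dist_triangle3[of B B' A] dist_triangle3[of "- B" B' A] by linarith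
      then show False by (auto simp: \<epsilon>_def)
    qed
  qed
qed

lemma mexp_zero: "mexp (cscale 0 X) = mat 1"
proof -
  have "mink (axis 3 1) (axis 3 1) = 1" by (simp add: mink_def axis_def)
  moreover have "cscale 0 X = cscale 0 (genm (axis 3 1))" by (rule mat2_eqI) simp_all
  ultimately show ?thesis using mexp_hexp[of "axis 3 1" 0] by simp
qed

lemma foldr_mat_1: "(\<And>j. j \<in> set js \<Longrightarrow> f j = mat 1) \<Longrightarrow> foldr (**) (map f js) (mat 1 :: complex^2^2) = mat 1"
  by (induction js) auto

lemma foldr_det: "(\<And>j. j \<in> set js \<Longrightarrow> det (f j) = 1) \<Longrightarrow> det (foldr (**) (map f js) (mat 1 :: complex^2^2)) = 1"
  by (induction js) (auto simp: det_mul)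

lemma foldr_real: "(\<And>j. j \<in> set js \<Longrightarrow> real_entries (f j)) \<Longrightarrow> real_entries (foldr (**) (map f js) (mat 1))"
  by (induction js) (auto simp: real_entries_mult real_entries_mat_1)

lemma cocycle_trivial:
  assumes "\<And>A. seg_mass \<Lambda> x y A = 0" and "\<And>\<delta>. \<delta> > 0 \<Longrightarrow> \<exists>ts. subdivision \<Lambda> x y ts \<and>
      (\<forall>j < length ts - 1. ts ! Suc j - ts ! j < \<delta>)"
  shows "cocycle c \<Lambda> x y = psl (mat 1)"
proof (rule cocycle_eqI)
  have one: "ordered_product c \<Lambda> x y ts p u = mat 1" for ts p u
    unfolding ordered_product_def by (rule foldr_mat_1) (simp add: assms(1) mexp_zero)
  show "\<exists>\<delta>>0. \<forall>ts p u. fine_choice \<Lambda> x y \<delta> ts p u \<longrightarrow>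
    dist (ordered_product c \<Lambda> x y ts p u) (mat 1) < \<epsilon>" if "\<epsilon> > 0" for \<epsilon>
    using that by (intro exI[of _ 1]) (simp add: one)
  show "\<exists>ts p u. fine_choice \<Lambda> x y \<delta> ts p u" if "\<delta> > 0" for \<delta>
    using assms(2)[OF that] by (auto simp: fine_choice_def leaf_choice_def assms(1))
qed simp

text \<open>Determinant \<open>1\<close> and reality of the entries are closed conditions.\<close>

lemma closed_limit:
  assumes "\<And>\<epsilon>. \<epsilon> > 0 \<Longrightarrow> \<exists>A. Q A \<and> nrm (A - B) < \<epsilon>"
  shows "(\<And>A. Q A \<Longrightarrow> det A = 1) \<Longrightarrow> det B = 1" "(\<And>A. Q A \<Longrightarrow> real_entries A) \<Longrightarrow> real_entries B"
proof -
  have "\<forall>k. \<exists>A. Q A \<and> nrm (A - B) < 1 / Suc k" using assms by simp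
  then obtain A where A: "\<And>k. Q (A k)" "\<And>k. nrm (A k - B) < 1 / Suc k" by metis
  have lim: "(\<lambda>k. A k $ i $ j) \<longlonglongrightarrow> B $ i $ j" for i j
  proof (rule Lim_transform_bound[OF _ _, THEN LIM_zero_cancel])
    show "\<forall>\<^sub>F k in sequentially. norm (A k $ i $ j - B $ i $ j) \<le> norm (1 / real (Suc k))"
      using cmod_le_nrm[of "A _ - B" i j] A(2)
        by (intro always_eventually allI) (force intro: order_trans less_imp_le)
    show "(\<lambda>k. 1 / real (Suc k)) \<longlonglongrightarrow> 0" by (rule LIMSEQ_Suc[OF lim_1_over_n])
  qed
  show "det B = 1" if "\<And>A. Q A \<Longrightarrow> det A = 1"
  proof -
    have "(\<lambda>k. det (A k)) \<longlonglongrightarrow> det B" unfolding det_2 by (intro tendsto_intros lim)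
    then show ?thesis using that A(1) by (simp add: LIMSEQ_const_iff)
  qed
  show "real_entries B" if "\<And>A. Q A \<Longrightarrow> real_entries A"
  proof -
    have "B $ i $ j \<in> \<real>" for i j
      by (rule closed_sequentially[OF closed_complex_Reals _ lim]) (use that A(1) in \<open>auto simp: real_entriesD\<close>)
    then show ?thesis by (simp add: real_entries_def)
  qed
qed

lemma leaves_scale_lam [simp]: "leaves (scale_lam t \<Lambda>) = leaves \<Lambda>"
  by (simp add: scale_lam_def)

lemma lam_support_scale_lam [simp]: "lam_support (scale_lam t \<Lambda>) = lam_support \<Lambda>"
  by (simp add: lam_support_def)

lemma leaf_normal_scale_lam [simp]: "leaf_normal (scale_lam t \<Lambda>) = leaf_normal \<Lambda>"
  by (intro ext) (simp add: leaf_normal_def)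

lemma seg_measure_scale_lam: "seg_measure (scale_lam t \<Lambda>) x y = scale_measure (ennreal t) (seg_measure \<Lambda> x y)"
  by (simp add: seg_measure_def scale_lam_def)

lemma seg_mass_scale_lam: "t \<ge> 0 \<Longrightarrow> seg_mass (scale_lam t \<Lambda>) x y A = t * seg_mass \<Lambda> x y A"
  by (simp add: seg_mass_def seg_measure_scale_lam right_diff_distrib)

lemma weighted_part_scale_lam:
  "weighted_part (scale_lam t \<Lambda>) \<subseteq> weighted_part \<Lambda>" "t > 0 \<Longrightarrow> weighted_part (scale_lam t \<Lambda>) = weighted_part \<Lambda>"
  unfolding weighted_part_def by (auto simp: scale_lam_def ennreal_zero_less_mult_iff)

text \<open>Along a transverse arc, the side function of the leaf through a point changes sign at this point, whereas
  it vanishes identically inside the leaf.\<close>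

lemma not_transverse_in_leaf:
  assumes "l \<in> leaves \<Lambda>" "segment x y \<subseteq> l"
  shows "seg_measure \<Lambda> x y = null_measure borel"
proof -
  have "\<not> transverse_arc (leaves \<Lambda>) (segment x y)"
  proof
    assume "transverse_arc (leaves \<Lambda>) (segment x y)"
    then obtain g where g: "transverse_path (leaves \<Lambda>) g" "segment x y = path_image g"
      by (auto simp: transverse_arc_def)
    have in_l: "g t \<in> l" if "t \<in> {0..1}" for t using g(2) assms(2) that by (auto simp: path_image_def)
    note local = g(1)[unfolded transverse_path_def, THEN conjunct2, THEN conjunct2, THEN conjunct2]
    obtain \<epsilon> where \<epsilon>: "\<epsilon> > 0" "\<forall>t\<in>{0..1}. \<forall>l\<in>leaves \<Lambda>. \<bar>t - 0\<bar> < \<epsilon> \<and> g t \<in> l \<longrightarrow>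
        (\<exists>p u. unit_tangent p u \<and> l = range (geoline p u) \<and>
           (\<forall>s\<in>{0..1}. \<bar>s - 0\<bar> < \<epsilon> \<longrightarrow> sgn (side p u (g s)) = sgn (t - s)))"
    proof -
      have "(0 :: real) \<in> {0..1}" by simp
      from bspec[OF local this] show ?thesis using that by (elim exE conjE)
    qed
    have "\<exists>p u. unit_tangent p u \<and> l = range (geoline p u) \<and>
           (\<forall>s\<in>{0..1}. \<bar>s - 0\<bar> < \<epsilon> \<longrightarrow> sgn (side p u (g s)) = sgn (0 - s))"
      using \<epsilon>(2)[rule_format, of 0 l] in_l[of 0] assms(1) \<epsilon>(1) by auto
    then obtain p u where pu: "unit_tangent p u" "l = range (geoline p u)"
      "\<And>s. s \<in> {0..1} \<Longrightarrow> \<bar>s - 0\<bar> < \<epsilon> \<Longrightarrow> sgn (side p u (g s)) = sgn (0 - s)" by blast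
    define s where "s = min 1 (\<epsilon> / 2)"
    have s: "s \<in> {0..1}" "\<bar>s - 0\<bar> < \<epsilon>" "s > 0" using \<epsilon>(1) by (auto simp: s_def)
    have "side p u (g s) = 0"
      using in_l[OF s(1)] pu(2) range_geoline[OF pu(1)] by (simp add: side_eq geod_def)
    then show False using pu(3)[OF s(1,2)] s(3) by simp
  qed
  then show ?thesis by (simp add: seg_measure_def)
qed

lemma (in seg) segment_subset_geod: "mink n x = 0 \<Longrightarrow> mink n y = 0 \<Longrightarrow> segment x y \<subseteq> geod n"
  by (auto simp: segment_eq geod_def) (simp add: geoseg_eq geoline_def dir_def)

text \<open>\<open>B\<close> lies, up to second order in the time \<open>t\<close>, on the path through \<open>1\<close> whose velocity is \<open>c / 2\<close> times the
  generator given by \<open>W\<close>. The constant \<open>k\<close> controls the error uniformly in \<open>t\<close> and \<open>c\<close>.\<close>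

definition first_order_at :: "complex \<Rightarrow> real^3 \<Rightarrow> real \<Rightarrow> real \<Rightarrow> complex^2^2 \<Rightarrow> bool" where
  "first_order_at c W k t B \<longleftrightarrow> det B = 1 \<and> (c \<in> \<real> \<longrightarrow> real_entries B) \<and>
     nrm (B - mat 1 - cscale (c * of_real (t / 2)) (genm W)) \<le> exp (k * t) - 1 - k * t"

context crossed_segment
begin

lemma unweighted_iff: "r \<in> unweighted \<longleftrightarrow> 0 \<le> r \<and> r \<le> d \<and> \<sigma> r \<notin> weighted_part \<Lambda>"
  by (simp add: unweighted_def)

text \<open>For \<open>t > 0\<close>, tagged subdivisions of the scaled lamination are those of \<open>\<Lambda>\<close>, and their ordered products
  are those of the locale \<^locale>\<open>crossing\<close> with coefficient \<open>c * t / 2\<close>: atoms at the endpoints being absent,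
  the mass of a subinterval is \<open>t\<close> times its measure, and the generator of a leaf is given by its normal. For
  \<open>t = 0\<close> every point is allowed as a subdivision point, but all factors are \<open>1\<close>.\<close>

lemma cocycle_first_order:
  assumes nx: "x \<notin> weighted_part \<Lambda>" and ny: "emeasure M {y} = 0"
  shows "\<exists>k. \<forall>t c. t \<ge> 0 \<and> cmod c = 1 \<longrightarrow> 
     (\<exists>B. first_order_at c (J 0 d) k t B \<and> cocycle c (scale_lam t \<Lambda>) x y = psl B)"
proof -
  obtain K N where "crossing d m unweighted Cr \<nu> J K N" using crossing_segment by blast
  then interpret cr: crossing d m unweighted Cr \<nu> J K N .
  define k where "k = (1 + 3 * N) * m 0 d / 2"
  have sd: "subdivision (scale_lam t \<Lambda>) x y ts" if "cr.subdiv ts" for t ts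
    using that weighted_part_scale_lam(1)[of t \<Lambda>] unfolding cr.subdiv_def subdivision_def unweighted_iff
      by blast
  have atoms: "measure M {x} = 0" "measure M {y} = 0"
    using ny no_atom[OF ml transverse_segment _ nx] \<sigma>_0 d_pos unfolding segment_eq
    by (force simp: measure_def)+
  have mass: "seg_mass \<Lambda> x y (subinterval x y ts j) = m (ts ! j) (ts ! Suc j)" for ts j
  proof -
    interpret finite_measure M by (rule finite_M)
    have "measure M (\<sigma> ` {ts ! j..ts ! Suc j} \<inter> {x, y}) \<le> measure M ({x} \<union> {y})"
      by (intro finite_measure_mono) auto
    also have "\<dots> \<le> measure M {x} + measure M {y}" by (rule measure_Un_le) auto
    finally have "measure M (\<sigma> ` {ts ! j..ts ! Suc j} \<inter> {x, y}) = 0" using atoms by (simp add: measure_le_0_iff)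
    then show ?thesis by (simp add: seg_mass_def seg_measure_M subinterval_def m_def)
  qed
  have massT: "seg_mass (scale_lam t \<Lambda>) x y (subinterval x y ts j) = t * m (ts ! j) (ts ! Suc j)" if "t \<ge> 0" for t ts j
    using that by (simp add: seg_mass_scale_lam mass)
  show ?thesis
  proof (intro exI[of _ k] allI impI, elim conjE)
    fix t :: real and c :: complex assume t: "t \<ge> 0" and c: "cmod c = 1"
    show "\<exists>B. first_order_at c (J 0 d) k t B \<and> cocycle c (scale_lam t \<Lambda>) x y = psl B"
    proof (cases "t = 0")
      case True
      have "cocycle c (scale_lam t \<Lambda>) x y = psl (mat 1)"
      proof (rule cocycle_trivial)
        show "seg_mass (scale_lam t \<Lambda>) x y A = 0" for A using seg_mass_scale_lam[of t] True by simp
        show "\<exists>ts. subdivision (scale_lam t \<Lambda>) x y ts \<and>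
          (\<forall>j < length ts - 1. ts ! Suc j - ts ! j < \<delta>)" if "\<delta> > 0" for \<delta>
          using cr.exists_subdivision[OF that] sd by blast
      qed
      moreover have "cscale 0 A = 0" for A by (rule mat2_eqI) simp_all
      ultimately show ?thesis using True
        by (intro exI[of _ "mat 1"]) (auto simp: first_order_at_def real_entries_mat_1)
    next
      case False
      then have t: "t > 0" using t by simp
      define c' where "c' = c * of_real (t / 2)"
      let ?fc = "fine_choice (scale_lam t \<Lambda>) x y" and ?P = "ordered_product c (scale_lam t \<Lambda>) x y"
      have fine: "\<exists>n. cr.fine_tags \<delta> ts n \<and> ?P ts p u = cr.oprod c' ts n
          \<and> det (cr.oprod c' ts n) = 1 \<and> (c \<in> \<real> \<longrightarrow> real_entries (cr.oprod c' ts n))"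
        if f: "?fc \<delta> ts p u" for \<delta> ts p u
      proof -
        have sub: "subdivision (scale_lam t \<Lambda>) x y ts" and mesh: "\<And>j. j < length ts - 1 \<Longrightarrow>
          ts ! Suc j - ts ! j < \<delta>"
          and lc: "leaf_choice (scale_lam t \<Lambda>) x y ts p u" using f by (auto simp: fine_choice_def)
        have st: "ts \<noteq> []" "sorted_wrt (<) ts" "hd ts = 0" "last ts = d" using sub
          by (auto simp: subdivision_def)
        have in_d: "ts ! j \<in> {0..d}" if "j < length ts" for j
        proof -
          have "sorted ts" using st(2) by (simp add: strict_sorted_iff)
          then have "ts ! 0 \<le> ts ! j" "ts ! j \<le> ts ! (length ts - 1)"
            using that st(1) by (auto intro!: sorted_nth_mono)
          then show ?thesis using st by (auto simp: hd_conv_nth last_conv_nth)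
        qed
        have sub': "cr.subdiv ts"
          using sub in_d unfolding cr.subdiv_def subdivision_def weighted_part_scale_lam(2)[OF t] unweighted_iff by auto
        define n where "n j = lcross (p j) (u j)" for j
        have tag: "unit_tangent (p j) (u j) \<and> n j \<in> \<nu> ` (Cr \<inter> {ts ! j..ts ! Suc j})"
          if j: "j < length ts - 1" "m (ts ! j) (ts ! Suc j) > 0" for j
        proof -
          have l: "unit_tangent (p j) (u j)" "range (geoline (p j) (u j)) \<in> leaves \<Lambda>"
            "range (geoline (p j) (u j)) \<inter> subinterval x y ts j \<noteq> {}" "side (p j) (u j) x \<ge> 0"
              "side (p j) (u j) y \<le> 0"
            using lc j t unfolding leaf_choice_def by (auto simp: massT)
          have "geod (n j) \<inter> \<sigma> ` {ts ! j..ts ! Suc j} \<noteq> {}"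
            using l(3) unfolding range_geoline[OF l(1)] n_def subinterval_def .
          then obtain r where r: "r \<in> {ts ! j..ts ! Suc j}" "\<sigma> r \<in> geod (n j)" by blast
          have lv: "geod (n j) \<in> leaves \<Lambda>" using l(1,2) by (simp add: range_geoline n_def)
          have "j < length ts" "Suc j < length ts" using j(1) by linarith+
          then have "r \<in> Cr" using r in_d[of j] in_d[of "Suc j"] lv by (auto simp: Cr_def lam_support_def)
          moreover have "n j = \<nu> r"
            unfolding \<nu>_def
            by (rule leaf_normal_eqI[OF lv r(2), symmetric]) (use l in \<open>auto simp: n_def lcross_unit side_eq\<close>)
          ultimately show ?thesis using l(1) r(1) by blast
        qed
        have ft: "cr.fine_tags \<delta> ts n" unfolding cr.fine_tags_def using sub' mesh tag by blast
        have factor: "mexp (cscale (c * of_real (seg_mass (scale_lam t \<Lambda>) x y (subinterval x y ts j)) / 2) (transl_gen (p j) (u j)))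
            = hexp (c' * of_real (m (ts ! j) (ts ! Suc j))) (n j)
          \<and> det (hexp (c' * of_real (m (ts ! j) (ts ! Suc j))) (n j)) = 1" if j: "j < length ts - 1" for j
        proof (cases "m (ts ! j) (ts ! Suc j) > 0")
          case True
          have ut: "unit_tangent (p j) (u j)" using tag[OF j True] by blast
          have e: "c * of_real (t * m (ts ! j) (ts ! Suc j)) / 2 = c' * of_real (m (ts ! j) (ts ! Suc j))"
            by (simp add: c'_def)
          show ?thesis unfolding massT[OF less_imp_le[OF t]] e transl_gen_eq[OF ut] n_def
            by (simp add: mexp_hexp lcross_unit[OF ut] det_hexp)
        next
          case False
          then have "m (ts ! j) (ts ! Suc j) = 0" using cr.m_nonneg[of "ts ! j" "ts ! Suc j"] by linarith
          then show ?thesis using massT[OF less_imp_le[OF t], of ts j] by (simp add: mexp_zero)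
        qed
        have "?P ts p u = cr.oprod c' ts n"
          unfolding ordered_product_def cr.oprod_def using factor
            by (intro arg_cong[where f = "\<lambda>l. foldr (**) l (mat 1)"] map_cong) auto
        moreover have "det (cr.oprod c' ts n) = 1"
          unfolding cr.oprod_def using factor by (intro foldr_det) auto
        moreover have "real_entries (cr.oprod c' ts n)" if "c \<in> \<real>"
          unfolding cr.oprod_def using that by (intro foldr_real real_entries_hexp) (simp add: c'_def)
        ultimately show ?thesis using ft by blast
      qed
      have exf: "\<exists>ts p u. ?fc \<delta> ts p u" if mesh: "\<delta> > 0" for \<delta>
      proof -
        obtain ts n where f: "cr.fine_tags \<delta> ts n" using cr.exists_fine_tags[OF mesh] by blast
        then have sub: "cr.subdiv ts" by (simp add: cr.fine_tags_def)
        let ?leaf = "\<lambda>j p u. unit_tangent p u \<and> range (geoline p u) \<in> leaves \<Lambda> \<and>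
          range (geoline p u) \<inter> subinterval x y ts j \<noteq> {} \<and> side p u x \<ge> 0 \<and> side p u y \<le> 0"
        have "\<exists>pu. m (ts ! j) (ts ! Suc j) > 0 \<longrightarrow> ?leaf j (fst pu) (snd pu)" if j: "j < length ts - 1" for j
        proof (cases "m (ts ! j) (ts ! Suc j) > 0")
          case True
          then obtain r where r: "r \<in> Cr" "r \<in> {ts ! j..ts ! Suc j}" using f j by (auto simp: cr.fine_tags_def)
          obtain p u where pu: "unit_tangent p u" "lcross p u = \<nu> r"
            using exists_frame[OF \<nu>_props(1)[OF r(1)]] by blast
          have "\<sigma> r \<in> range (geoline p u) \<inter> subinterval x y ts j"
            using \<nu>_geod[OF r(1)] r(2) by (simp add: range_geoline[OF pu(1)] pu(2) subinterval_def)
          then show ?thesis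
            using \<nu>_props(2-4)[OF r(1)] pu by (intro exI[of _ "(p, u)"]) (auto simp: range_geoline side_eq)
        qed simp
        then obtain pu where pu: "\<And>j. j < length ts - 1 \<Longrightarrow> m (ts ! j) (ts ! Suc j) > 0 \<longrightarrow>
          ?leaf j (fst (pu j)) (snd (pu j))"
          by metis
        have "leaf_choice (scale_lam t \<Lambda>) x y ts (\<lambda>j. fst (pu j)) (\<lambda>j. snd (pu j))"
          unfolding leaf_choice_def using pu t by (simp add: massT zero_less_mult_iff)
        then show ?thesis using sd[OF sub] f unfolding fine_choice_def cr.fine_tags_def by blast
      qed
      obtain B where B: "\<And>\<epsilon>. \<epsilon> > 0 \<Longrightarrow> \<exists>\<delta>>0. \<forall>ts n. cr.fine_tags \<delta> ts n \<longrightarrow> nrm (cr.oprod c' ts n - B) < \<epsilon>"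
        "nrm (B - mat 1 - cscale c' (genm (J 0 d))) \<le> exp ((1 + 3 * N) * (cmod c' * m 0 d)) - 1 - (1 + 3 * N) * (cmod c' * m 0 d)"
        using cr.oprod_converges[of c'] by blast
      have kt: "(1 + 3 * N) * (cmod c' * m 0 d) = k * t" using c t by (simp add: c'_def k_def norm_mult)
      define Q where "Q A \<longleftrightarrow> det A = 1 \<and> (c \<in> \<real> \<longrightarrow> real_entries A)" for A
      have "\<exists>A. Q A \<and> nrm (A - B) < \<epsilon>" if e: "\<epsilon> > 0" for \<epsilon>
      proof -
        obtain \<delta> where \<delta>: "\<delta> > 0" "\<And>ts n. cr.fine_tags \<delta> ts n \<Longrightarrow> nrm (cr.oprod c' ts n - B) < \<epsilon>"
          using B(1)[OF e] by blast
        obtain ts p u where "?fc \<delta> ts p u" using exf[OF \<delta>(1)] by blast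
        from fine[OF this] show ?thesis using \<delta>(2) unfolding Q_def by blast
      qed
      from closed_limit[OF this] have "det B = 1" "c \<in> \<real> \<longrightarrow> real_entries B" unfolding Q_def by blast+
      moreover have "cocycle c (scale_lam t \<Lambda>) x y = psl B"
      proof (rule cocycle_eqI[OF \<open>det B = 1\<close> _ exf])
        fix \<epsilon> :: real assume e: "\<epsilon> > 0"
        then obtain \<delta> where \<delta>: "\<delta> > 0" "\<And>ts n. cr.fine_tags \<delta> ts n \<Longrightarrow> nrm (cr.oprod c' ts n - B) < \<epsilon> / 4"
          using B(1)[of "\<epsilon> / 4"] by auto
        have "dist (?P ts p u) B < \<epsilon>" if fc: "?fc \<delta> ts p u" for ts p u
        proof -
          obtain n where n: "cr.fine_tags \<delta> ts n" "?P ts p u = cr.oprod c' ts n"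
            using fine[OF fc] by blast
          show ?thesis using norm_le_nrm[of "cr.oprod c' ts n - B"] \<delta>(2)[OF n(1)] by (simp add: n(2) dist_norm)
        qed
        then show "\<exists>\<delta>>0. \<forall>ts p u. ?fc \<delta> ts p u \<longrightarrow> dist (?P ts p u) B < \<epsilon>"
          using \<delta>(1) by blast
      qed
      moreover have "nrm (B - mat 1 - cscale (c * of_real (t / 2)) (genm (J 0 d))) \<le> exp (k * t) - 1 - k * t"
        using B(2) unfolding kt unfolding c'_def .
      ultimately show ?thesis unfolding first_order_at_def by blast
    qed
  qed
qed

lemma integral_scaled:
  assumes "t \<ge> 0"
  shows "(LINT q : segment x y \<inter> lam_support \<Lambda> | scale_measure (ennreal t) M. leaf_normal \<Lambda> x y q) = t *\<^sub>R J 0 d"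
proof -
  let ?f = "\<lambda>q. indicator (segment x y \<inter> lam_support \<Lambda>) q *\<^sub>R leaf_normal \<Lambda> x y q"
  have "scale_measure (ennreal t) M = density M (\<lambda>_. ennreal t)"
    by (rule measure_eqI) (auto simp: emeasure_density_const)
  moreover have "?f \<in> borel_measurable M"
    using integrable_leaf_normal unfolding set_integrable_def by (rule borel_measurable_integrable)
  then have "(LINT q | density M (\<lambda>_. ennreal t). ?f q) = (LINT q | M. t *\<^sub>R ?f q)"
    by (rule integral_density) (use assms in auto)
  ultimately show ?thesis
    unfolding J_full set_lebesgue_integral_def by (simp only: integral_scaleR_right)
qed

end

section \<open>Holonomies and their first variation\<close>

lemma has_vector_derivative_of_bound:
  fixes f :: "real \<Rightarrow> 'a::real_normed_vector"
  assumes "\<phi> 0 = 0" "(\<phi> has_real_derivative 0) (at 0)"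
    and bound: "\<And>t. t \<ge> 0 \<Longrightarrow> norm (f t - f 0 - t *\<^sub>R D) \<le> \<phi> t"
  shows "(f has_vector_derivative D) (at 0 within {0..})"
  unfolding has_vector_derivative_def has_derivative_within
proof
  show "bounded_linear (\<lambda>x. x *\<^sub>R D)" by (rule bounded_linear_scaleR_left)
  show "((\<lambda>t. (1 / norm (t - 0)) *\<^sub>R (f t - (f 0 + (t - 0) *\<^sub>R D))) \<longlongrightarrow> 0) (at 0 within {0..})"
  proof (rule Lim_null_comparison)
    have "((\<lambda>h. \<phi> h / h) \<longlongrightarrow> 0) (at 0)" using assms(1,2) by (simp add: DERIV_def)
    then show "((\<lambda>h. \<phi> h / h) \<longlongrightarrow> 0) (at 0 within {0..})" by (rule tendsto_within_subset) simp
    have "norm ((1 / norm (t - 0)) *\<^sub>R (f t - (f 0 + (t - 0) *\<^sub>R D))) \<le> \<phi> t / t" if "t \<in> {0..}" "t \<noteq> 0" for t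
    proof -
      have "norm ((1 / norm (t - 0)) *\<^sub>R (f t - (f 0 + (t - 0) *\<^sub>R D))) = norm (f t - f 0 - t *\<^sub>R D) / t"
        using that by (simp add: diff_diff_eq)
      also have "\<dots> \<le> \<phi> t / t" using bound[of t] that by (intro divide_right_mono) auto
      finally show ?thesis .
    qed
    then show "\<forall>\<^sub>F t in at 0 within {0..}. norm ((1 / norm (t - 0)) *\<^sub>R (f t - (f 0 + (t - 0) *\<^sub>R D))) \<le> \<phi> t / t"
      by (auto simp: eventually_at_filter)
  qed
qed

lemma act_leaf:
  assumes "lam_invariant \<Lambda> \<Gamma>" "psl A \<in> \<Gamma>" "l \<in> leaves \<Lambda>"
  shows "mact A ` l \<in> leaves \<Lambda>"
proof -
  have "(\<lambda>l. act (psl A) ` l) ` leaves \<Lambda> = leaves \<Lambda>" using assms(1,2) unfolding lam_invariant_def by blast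
  then show ?thesis using assms(3) by (metis (no_types, lifting) act_psl image_cong image_eqI)
qed

text \<open>If a leaf contains both \<open>x\<close> and its image \<open>y\<close>, nothing is crossed. Otherwise \<open>y\<close> carries no mass, like
  \<open>x\<close>: \<open>A\<close> maps the segment from \<open>z\<close>, the preimage of \<open>x\<close>, to \<open>x\<close> onto the segment from \<open>x\<close> to \<open>y\<close> and
  preserves the transverse measure.\<close>

lemma holonomy_first_order:
  assumes ml: "measured_lamination \<Lambda>" and inv: "lam_invariant \<Lambda> \<Gamma>" "psl A \<in> \<Gamma>"
    and A: "det A = 1" "real_entries A" and x: "x \<in> H2" "x \<notin> weighted_part \<Lambda>" and moved: "mact A x \<noteq> x"
  shows "\<exists>k. \<forall>t c. t \<ge> 0 \<and> cmod c = 1 \<longrightarrow> 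
     (\<exists>B. first_order_at c (translation_part \<Lambda> x (psl A)) k t B \<and>
       hol c (scale_lam t \<Lambda>) x (psl A) = psl (B ** A))"
    and "t \<ge> 0 \<Longrightarrow> translation_part (scale_lam t \<Lambda>) x (psl A) = t *\<^sub>R translation_part \<Lambda> x (psl A)"
proof -
  define y where "y = mact A x"
  interpret seg x y
    by unfold_locales (use x(1) moved mact_H2[OF A(2,1)] in \<open>auto simp: y_def\<close>)
  have hol: "hol c \<Lambda>' x (psl A) = psl (B ** A)" if "cocycle c \<Lambda>' x y = psl B" "det B = 1" for c \<Lambda>' B
    using that A by (simp add: hol_def y_def psl_mult)
  have tp: "translation_part \<Lambda>' x (psl A) = (LINT q : segment x y \<inter> lam_support \<Lambda>' | seg_measure \<Lambda>' x y. leaf_normal \<Lambda>' x y q)" for \<Lambda>'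
    by (simp add: translation_part_def y_def)
  have "(\<exists>k. \<forall>t c. t \<ge> 0 \<and> cmod c = 1 \<longrightarrow> 
     (\<exists>B. first_order_at c (translation_part \<Lambda> x (psl A)) k t B \<and> cocycle c (scale_lam t \<Lambda>) x y = psl B))
     \<and> (\<forall>t\<ge>0. translation_part (scale_lam t \<Lambda>) x (psl A) = t *\<^sub>R translation_part \<Lambda> x (psl A))"
  proof (cases "\<exists>l\<in>leaves \<Lambda>. x \<in> l \<and> y \<in> l")
    case True
    then obtain l where l: "l \<in> leaves \<Lambda>" "x \<in> l" "y \<in> l" by blast
    obtain n where n: "mink n n = 1" "l = geod n" using measured_laminationD(1)[OF ml l(1)] by blast
    have sub: "segment x y \<subseteq> l" unfolding n(2) by (rule segment_subset_geod) (use l n in \<open>auto simp: geod_def\<close>)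
    have null: "seg_measure \<Lambda> x y = null_measure borel" by (rule not_transverse_in_leaf[OF l(1) sub])
    have nullt: "seg_measure (scale_lam t \<Lambda>) x y = null_measure borel" for t
      by (simp add: seg_measure_scale_lam null)
    have w: "q \<notin> weighted_part \<Lambda>" if "q \<in> l" for q
    proof
      assume "q \<in> weighted_part \<Lambda>"
      then obtain l' where l': "l' \<in> leaves \<Lambda>" "q \<in> l'" "l' \<subseteq> weighted_part \<Lambda>" unfolding weighted_part_def
        by blast
      have "l' = l" by (rule measured_laminationD(2)[OF ml l'(1) l(1) l'(2) that])
      then show False using l' l(2) x(2) by blast
    qed
    have tp0: "translation_part (scale_lam t \<Lambda>) x (psl A) = 0" "translation_part \<Lambda> x (psl A) = 0" for t
      unfolding tp null nullt by (simp_all add: set_lebesgue_integral_def integral_null_measure)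
    have "cocycle c (scale_lam t \<Lambda>) x y = psl (mat 1)" for c t
    proof (rule cocycle_trivial)
      show "seg_mass (scale_lam t \<Lambda>) x y A = 0" for A by (simp add: seg_mass_def nullt)
      show "\<exists>ts. subdivision (scale_lam t \<Lambda>) x y ts \<and>
        (\<forall>j < length ts - 1. ts ! Suc j - ts ! j < \<delta>)" if "\<delta> > 0" for \<delta>
      proof -
        \<comment> \<open>a transversal without mass, for which all points are allowed as subdivision points\<close>
        interpret triv: crossing d "\<lambda>_ _. 0" "{0..d}" "{}" "\<lambda>_. 0" "\<lambda>_ _. 0" 0 1
        proof unfold_locales
          show "{0..d} \<inter> {a<..<b} \<noteq> {}" if "0 \<le> a" "a < b" "b \<le> d" for a b
          proof -
            have "(a + b) / 2 \<in> {0..d} \<inter> {a<..<b}" using that by auto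
            then show ?thesis by blast
          qed
        qed (use d_pos in auto)
        obtain ts where ts: "triv.subdiv ts" "\<forall>j < length ts - 1. ts ! Suc j - ts ! j < \<delta>"
          using triv.exists_subdivision[OF \<open>\<delta> > 0\<close>] by blast
        have "\<sigma> r \<notin> weighted_part (scale_lam t \<Lambda>)" if "r \<in> {0..d}" for r
          using w sub that weighted_part_scale_lam(1)[of t \<Lambda>] unfolding segment_eq by blast
        then show ?thesis using ts unfolding triv.subdiv_def subdivision_def by blast
      qed
    qed
    moreover have "cscale c (genm 0) = 0" for c by (rule mat2_eqI) simp_all
    ultimately show ?thesis
      by (intro conjI exI[of _ 0] allI impI exI[of _ "mat 1"]) (simp_all add: tp0 real_entries_mat_1 first_order_at_def)
  next
    case False
    then interpret crossed_segment x y \<Lambda>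
      by unfold_locales (use ml in auto)
    define z where "z = mact (adj2 A) x"
    have Az: "mact A z = x" by (simp add: z_def mact_adj2 A)
    have zx: "z \<noteq> x" using Az moved by auto
    interpret z: seg z x
      by unfold_locales (use x zx mact_H2[of "adj2 A" x] A in \<open>auto simp: z_def real_entries_adj2 det_adj2\<close>)
    interpret z: crossed_segment z x \<Lambda>
    proof unfold_locales
      fix l assume l: "l \<in> leaves \<Lambda>"
      show "\<not> (z \<in> l \<and> x \<in> l)"
      proof
        assume "z \<in> l \<and> x \<in> l"
        then have "x \<in> mact A ` l" "y \<in> mact A ` l" using Az by (auto simp: y_def)
        then show False using not_in_leaf[OF act_leaf[OF inv l]] by blast
      qed
    qed (rule ml)
    have ny: "emeasure M {y} = 0"
    proof -
      have xs: "x \<in> segment z x"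
        using imageI[of z.d "{0..z.d}" z.\<sigma>] z.d_pos unfolding z.segment_eq by simp
      have "emeasure (tmeasure \<Lambda> (act (psl A) ` segment z x)) (act (psl A) ` {x}) = emeasure (tmeasure \<Lambda> (segment z x)) {x}"
        by (rule inv(1)[unfolded lam_invariant_def, THEN bspec, OF inv(2), THEN conjunct2, THEN spec, THEN spec, THEN mp])
           (use z.transverse_segment xs in auto)
      moreover have "act (psl A) ` segment z x = segment x y"
        using segment_mact[OF A(2,1), of z x] Az by (simp add: y_def)
      moreover have "act (psl A) ` {x} = {y}" by (simp add: y_def)
      ultimately show ?thesis using no_atom[OF ml z.transverse_segment xs x(2)] by simp
    qed
    have tpJ: "translation_part \<Lambda> x (psl A) = J 0 d" unfolding tp J_full seg_measure_M ..
    have tpt: "translation_part (scale_lam t \<Lambda>) x (psl A) = t *\<^sub>R J 0 d" if "t \<ge> 0" for t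
      unfolding tp seg_measure_scale_lam seg_measure_M using integral_scaled[OF that] by simp
    show ?thesis using cocycle_first_order[OF x(2) ny] tpt unfolding tpJ by blast
  qed
  note result = this
  from conjunct1[OF result] obtain k where k: "\<forall>t c. 0 \<le> t \<and> cmod c = 1 \<longrightarrow> 
     (\<exists>B. first_order_at c (translation_part \<Lambda> x (psl A)) k t B \<and> cocycle c (scale_lam t \<Lambda>) x y = psl B)"
    by (elim exE)
  show "\<exists>k. \<forall>t c. t \<ge> 0 \<and> cmod c = 1 \<longrightarrow> 
     (\<exists>B. first_order_at c (translation_part \<Lambda> x (psl A)) k t B \<and>
       hol c (scale_lam t \<Lambda>) x (psl A) = psl (B ** A))"
  proof (intro exI[of _ k] allI impI)
    fix t :: real and c :: complex
    assume "t \<ge> 0 \<and> cmod c = 1"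
    from k[rule_format, OF this] obtain B where B: "first_order_at c (translation_part \<Lambda> x (psl A)) k t B"
      "cocycle c (scale_lam t \<Lambda>) x y = psl B"
      by (elim exE conjE)
    have "det B = 1" using B(1) by (simp add: first_order_at_def)
    then show "\<exists>B. first_order_at c (translation_part \<Lambda> x (psl A)) k t B \<and>
      hol c (scale_lam t \<Lambda>) x (psl A) = psl (B ** A)"
      by (intro exI[of _ B] conjI B hol)
  qed
  show "t \<ge> 0 \<Longrightarrow> translation_part (scale_lam t \<Lambda>) x (psl A) = t *\<^sub>R translation_part \<Lambda> x (psl A)"
    using conjunct2[OF result] by (elim allE impE)
qed

lemma cmod_trace_le: "cmod (trace A) \<le> 2 * nrm A"
  using norm_triangle_ineq[of "A $ 1 $ 1" "A $ 2 $ 2"] cmod_le_nrm[of A 1 1] cmod_le_nrm[of A 2 2]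
  by (simp add: trace_2)

text \<open>Here the two spectra meet: the trace of a product of two generators is twice the Lorentzian product of
  their vectors, so the first variation of the trace is \<open>c * sinh (e / 2)\<close> times the product of \<open>W\<close> with the
  normal \<open>n\<close> to the axis.\<close>

lemma trace_derivative:
  assumes A: "A = hexp (of_real (e / 2)) n"
    and fo: "\<And>t. t \<ge> 0 \<Longrightarrow> first_order_at c W k t (B t)"
  shows "trace (B 0 ** A) = of_real (2 * cosh (e / 2))"
    "((\<lambda>t. trace (B t ** A)) has_vector_derivative c * of_real (sinh (e / 2) * mink n W)) (at 0 within {0..})"
proof -
  note B = fo[unfolded first_order_at_def, THEN conjunct2, THEN conjunct2]
  have B0: "B 0 = mat 1"
  proof -
    have "cscale (c * of_real (0 / 2)) (genm W) = 0" by (rule mat2_eqI) simp_all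
    then have "nrm (B 0 - mat 1) \<le> 0" using B[of 0] by simp
    then have "norm (B 0 - mat 1) \<le> 0" using norm_le_nrm[of "B 0 - mat 1"] by linarith
    then show ?thesis by simp
  qed
  then show t0: "trace (B 0 ** A) = of_real (2 * cosh (e / 2))"
    unfolding A by (simp only: matrix_mul_lid trace_hexp)
  have tr: "trace (cscale (c * of_real (t / 2)) (genm W) ** A) = of_real t * (c * of_real (sinh (e / 2) * mink n W))" for t
  proof -
    have "A = cscale (of_real (cosh (e / 2))) (mat 1) + cscale (of_real (sinh (e / 2))) (genm n)"
      by (simp only: A hexp_def cosh_of_real sinh_of_real)
    then show ?thesis
      by (simp add: trace_2 mink_def algebra_simps)
  qed
  define \<phi> where "\<phi> t = (exp (k * t) - 1 - k * t) * (2 * nrm A)" for t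
  show "((\<lambda>t. trace (B t ** A)) has_vector_derivative c * of_real (sinh (e / 2) * mink n W)) (at 0 within {0..})"
  proof (rule has_vector_derivative_of_bound[where \<phi> = \<phi>])
    show "\<phi> 0 = 0" by (simp add: \<phi>_def)
    show "(\<phi> has_real_derivative 0) (at 0)"
      unfolding \<phi>_def by (auto intro!: derivative_eq_intros)
    fix t :: real assume t: "t \<ge> 0"
    have "trace (B t ** A) - trace (B 0 ** A) - t *\<^sub>R (c * of_real (sinh (e / 2) * mink n W)) =
        trace ((B t - mat 1 - cscale (c * of_real (t / 2)) (genm W)) ** A)"
      unfolding scaleR_conv_of_real tr[symmetric] B0 by (simp add: trace_2 algebra_simps)
    then have "cmod (trace (B t ** A) - trace (B 0 ** A) - t *\<^sub>R (c * of_real (sinh (e / 2) * mink n W))) \<le>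
        2 * nrm ((B t - mat 1 - cscale (c * of_real (t / 2)) (genm W)) ** A)"
      using cmod_trace_le by simp
    also have "\<dots> \<le> 2 * (nrm (B t - mat 1 - cscale (c * of_real (t / 2)) (genm W)) * nrm A)"
      by (intro mult_left_mono nrm_mult) simp
    also have "\<dots> \<le> 2 * ((exp (k * t) - 1 - k * t) * nrm A)"
      by (intro mult_left_mono mult_right_mono B t) auto
    finally show "cmod (trace (B t ** A) - trace (B 0 ** A) - t *\<^sub>R (c * of_real (sinh (e / 2) * mink n W))) \<le> \<phi> t"
      by (simp add: \<phi>_def algebra_simps)
  qed
qed

text \<open>As the trace starts at \<open>2 cosh (e / 2) > 2\<close>, the complex length is a holomorphic function of it for small
  times, and the chain rule applies. The same holds for the translation length of real matrices.\<close>

lemma complex_length_derivative: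
  assumes "e > 0" and M: "\<And>t. t \<ge> 0 \<Longrightarrow> det (M t) = 1" and t0: "trace (M 0) = of_real (2 * cosh (e / 2))"
    and der: "((\<lambda>t. trace (M t)) has_vector_derivative D) (at 0 within {0..})"
  shows "\<exists>\<delta>>0. \<forall>t. 0 \<le> t \<and> t < \<delta> \<longrightarrow> loxodromic (psl (M t))"
    "((\<lambda>t. complex_length (psl (M t))) has_vector_derivative D / of_real (sinh (e / 2))) (at 0 within {0..})"
proof -
  let ?f = "\<lambda>t. length_of_trace (trace (M t))"
  have c: "(length_of_trace has_field_derivative 1 / of_real (sinh (e / 2))) (at (trace (M 0)))"
    unfolding t0 by (rule length_of_trace_real) (use assms(1) in simp)
  then have d: "(?f has_vector_derivative D / of_real (sinh (e / 2))) (at 0 within {0..})"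
    using field_vector_diff_chain_within[OF der has_field_derivative_at_within[OF c]] by (simp add: o_def)
  have f0: "?f 0 = of_real e" unfolding t0 using length_of_trace_real(1)[of "e / 2"] assms(1) by simp
  have "(?f \<longlongrightarrow> ?f 0) (at 0 within {0..})"
    using has_vector_derivative_continuous[OF d] by (simp add: continuous_within)
  then have lim: "((\<lambda>t. Re (?f t)) \<longlongrightarrow> e) (at 0 within {0..})" "((\<lambda>t. Im (?f t)) \<longlongrightarrow> 0) (at 0 within {0..})"
    unfolding f0 by (auto dest: tendsto_Re tendsto_Im)
  have "((\<lambda>t. \<bar>Im (?f t)\<bar>) \<longlongrightarrow> 0) (at 0 within {0..})" using tendsto_rabs[OF lim(2)] by simp
  note lim = lim(1) this
  have "\<forall>\<^sub>F t in at 0 within {0..}. Re (?f t) > 0 \<and> \<bar>Im (?f t)\<bar> < pi"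
    using order_tendstoD(1)[OF lim(1) assms(1)] order_tendstoD(2)[OF lim(2) pi_gt_zero]
      by (rule eventually_conj)
  then obtain \<delta> where \<delta>: "\<delta> > 0" "\<And>t. t \<ge> 0 \<Longrightarrow> t \<noteq> 0 \<Longrightarrow> t < \<delta> \<Longrightarrow> Re (?f t) > 0 \<and> \<bar>Im (?f t)\<bar> < pi"
    unfolding eventually_at by (auto simp: dist_real_def)
  have pos: "Re (?f t) > 0 \<and> \<bar>Im (?f t)\<bar> < pi" if "0 \<le> t" "t < \<delta>" for t
    using \<delta>(2)[of t] that f0 assms(1) by (cases "t = 0") auto
  have eq: "loxodromic (psl (M t))" "complex_length (psl (M t)) = ?f t" if "0 \<le> t" "t < \<delta>" for t
    using complex_length_eqI[OF M[OF that(1)] length_of_trace_cosh[symmetric]] pos[OF that] by auto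
  then show "\<exists>\<delta>>0. \<forall>t. 0 \<le> t \<and> t < \<delta> \<longrightarrow> loxodromic (psl (M t))" using \<delta>(1) by blast
  show "((\<lambda>t. complex_length (psl (M t))) has_vector_derivative D / of_real (sinh (e / 2))) (at 0 within {0..})"
    by (rule has_vector_derivative_transform_within[OF d \<delta>(1)]) (auto simp: eq dist_real_def)
qed

lemma transl_length_derivative:
  assumes "e > 0" and M: "\<And>t. t \<ge> 0 \<Longrightarrow> det (M t) = 1" "\<And>t. t \<ge> 0 \<Longrightarrow> real_entries (M t)"
    and t0: "trace (M 0) = of_real (2 * cosh (e / 2))"
    and der: "((\<lambda>t. trace (M t)) has_vector_derivative of_real D) (at 0 within {0..})"
  shows "((\<lambda>t. transl_length (psl (M t))) has_real_derivative D / sinh (e / 2)) (at 0 within {0..})"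
proof -
  let ?h = "\<lambda>t. Re (trace (M t)) / 2"
  have h0: "?h 0 = cosh (e / 2)" unfolding t0 by simp
  have s: "sinh (e / 2) > 0" using assms(1) by simp
  have c1: "cosh (e / 2) > 1"
    using s cosh_square_eq[of "e / 2"] by (smt (verit) cosh_real_ge_1 one_power2 zero_less_power)
  have dh: "(?h has_real_derivative D / 2) (at 0 within {0..})"
  proof (rule DERIV_cdivide)
    show "((\<lambda>t. Re (trace (M t))) has_real_derivative D) (at 0 within {0..})"
      using bounded_linear.has_vector_derivative[OF bounded_linear_Re der]
      by (simp add: has_real_derivative_iff_has_vector_derivative)
  qed
  have "((\<lambda>t. 2 * arcosh (?h t)) has_real_derivative 2 * (1 / sqrt ((cosh (e / 2))\<^sup>2 - 1) * (D / 2))) (at 0 within {0..})"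
    using DERIV_cmult[OF DERIV_chain2[OF arcosh_real_has_field_derivative dh], of 2] c1 unfolding h0 by simp
  moreover have "sqrt ((cosh (e / 2))\<^sup>2 - 1) = sinh (e / 2)" using s by (simp add: cosh_square_eq)
  ultimately have d: "((\<lambda>t. 2 * arcosh (?h t)) has_real_derivative D / sinh (e / 2)) (at 0 within {0..})"
    by simp
  have "(?h \<longlongrightarrow> cosh (e / 2)) (at 0 within {0..})"
    using has_field_derivative_imp_has_derivative[OF dh] has_derivative_continuous h0
      unfolding continuous_within by metis
  then have "\<forall>\<^sub>F t in at 0 within {0..}. ?h t > 1" using c1 by (rule order_tendstoD)
  then obtain \<delta> where \<delta>: "\<delta> > 0" "\<And>t. t \<ge> 0 \<Longrightarrow> t \<noteq> 0 \<Longrightarrow> t < \<delta> \<Longrightarrow> ?h t > 1"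
    unfolding eventually_at by (auto simp: dist_real_def)
  have "transl_length (psl (M t)) = 2 * arcosh (?h t)" if "0 \<le> t" "t < \<delta>" for t
  proof -
    have "?h t > 1" using \<delta>(2)[of t] that h0 c1 by (cases "t = 0") auto
    then show ?thesis using M that by (intro transl_length_trace) auto
  qed
  then show ?thesis
    by (intro has_field_derivative_transform_within[OF d \<delta>(1)]) (auto simp: dist_real_def)
qed

theorem proposition7p6:
  fixes \<Lambda> :: mlam
    and \<Gamma> :: "(complex^2^2) set set"
    and \<gamma> :: "(complex^2^2) set"
    and x\<^sub>0 :: "real^3"
  assumes "measured_lamination \<Lambda>"
    and "subgroup \<Gamma> PSL2C" and "\<Gamma> \<subseteq> PSL2R"
    and "acts_freely \<Gamma>" and "acts_properly \<Gamma>"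
    and "lam_invariant \<Lambda> \<Gamma>"
    and "x\<^sub>0 \<in> H2 - weighted_part \<Lambda>"
    and "\<gamma> \<in> \<Gamma>" and "hyperbolic \<gamma>"
  shows "(\<exists>t. 0 < t \<and> t < 1 \<and>
            (\<forall>s. 0 \<le> s \<and> s < t \<longrightarrow> loxodromic (hol_dS (scale_lam s \<Lambda>) x\<^sub>0 \<gamma>))) \<and>
         (\<forall>\<kappa>\<in>{0, 1, - 1}.
            ((\<lambda>t. length_spectrum \<kappa> (scale_lam t \<Lambda>) x\<^sub>0 \<gamma>) has_real_derivative 0) (at 0 within {0..}) \<and>
            ((\<lambda>t. measure_spectrum \<kappa> (scale_lam t \<Lambda>) x\<^sub>0 \<gamma>) has_real_derivative
               measure_spectrum 0 \<Lambda> x\<^sub>0 \<gamma>) (at 0 within {0..}))"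
proof -
  obtain n e where n: "mink n n = 1" and e: "e > 0" and \<gamma>: "\<gamma> = psl (hexp (of_real (e / 2)) n)"
    using hyperbolic_imp_hexp[OF assms(9)] by blast
  define A where "A = hexp (of_real (e / 2)) n"
  have A: "det A = 1" "real_entries A" unfolding A_def using n by (auto intro: det_hexp real_entries_hexp)
  have x: "x\<^sub>0 \<in> H2" "x\<^sub>0 \<notin> weighted_part \<Lambda>" using assms(7) by auto
  \<comment> \<open>a free action moves \<open>x\<^sub>0\<close>, as the trace of a hyperbolic element is not that of the identity\<close>
  have moved: "mact A x\<^sub>0 \<noteq> x\<^sub>0"
  proof
    assume "mact A x\<^sub>0 = x\<^sub>0"
    then have "psl A = psl (mat 1)"
      using assms(4,8) x(1) unfolding acts_freely_def \<gamma> A_def[symmetric] one_PSL2C by (metis act_psl)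
    then have "trace A = 2 \<or> trace A = -2" by (auto simp: psl_eq_iff trace_2)
    moreover have "trace A = of_real (2 * cosh (e / 2))" unfolding A_def by (rule trace_hexp)
    ultimately have "2 * cosh (e / 2) = 2 \<or> 2 * cosh (e / 2) = -2"
      by (metis of_real_eq_iff of_real_minus of_real_numeral)
    moreover have "cosh (e / 2) > 1" using e cosh_real_nonneg_less_iff[of 0 "e / 2"] by simp
    ultimately show False by auto
  qed
  define W where "W = translation_part \<Lambda> x\<^sub>0 \<gamma>"
  have inA: "psl A \<in> \<Gamma>" using assms(8) \<gamma> by (simp add: A_def)
  note hfo = holonomy_first_order[OF assms(1,6) inA A x moved]
  obtain k where k: "\<And>t c. t \<ge> 0 \<Longrightarrow> cmod c = 1 \<Longrightarrow> 
     \<exists>B. first_order_at c W k t B \<and> hol c (scale_lam t \<Lambda>) x\<^sub>0 \<gamma> = psl (B ** A)"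
    using hfo(1) unfolding W_def \<gamma> A_def by blast
  have tp: "translation_part (scale_lam t \<Lambda>) x\<^sub>0 \<gamma> = t *\<^sub>R W" if "t \<ge> 0" for t
    using hfo(2)[OF that] unfolding W_def \<gamma> A_def .
  have family: "\<exists>M. (\<forall>t\<ge>0. det (M t) = 1 \<and> hol c (scale_lam t \<Lambda>) x\<^sub>0 \<gamma> = psl (M t) \<and> (c \<in> \<real> \<longrightarrow>
    real_entries (M t))) \<and>
     trace (M 0) = of_real (2 * cosh (e / 2)) \<and>
     ((\<lambda>t. trace (M t)) has_vector_derivative c * of_real (sinh (e / 2) * mink n W)) (at 0 within {0..})"
    if c: "cmod c = 1" for c
  proof -
    have "\<forall>t. \<exists>B. t \<ge> 0 \<longrightarrow> first_order_at c W k t B \<and> hol c (scale_lam t \<Lambda>) x\<^sub>0 \<gamma> = psl (B ** A)"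
      using k[OF _ c] by blast
    then obtain B where B: "\<And>t. t \<ge> 0 \<Longrightarrow> first_order_at c W k t (B t)"
       "\<And>t. t \<ge> 0 \<Longrightarrow> hol c (scale_lam t \<Lambda>) x\<^sub>0 \<gamma> = psl (B t ** A)"
      by metis
    then have "det (B t) = 1" "c \<in> \<real> \<longrightarrow> real_entries (B t)" if "t \<ge> 0" for t
      using that unfolding first_order_at_def by blast+
    then show ?thesis
      using trace_derivative[OF A_def B(1)] B(2) A
      by (intro exI[of _ "\<lambda>t. B t ** A"]) (auto simp: det_mul real_entries_mult)
  qed
  have s: "sinh (e / 2) > 0" using e by simp
  have axis: "axis_right_normal \<gamma> = n" unfolding \<gamma> by (rule axis_right_normal_hexp[OF n e])
  have M0: "measure_spectrum 0 \<Lambda> x\<^sub>0 \<gamma> = mink n W"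
    by (simp add: measure_spectrum_def W_def axis)

  obtain Mi where Mi: "\<And>t. t \<ge> 0 \<Longrightarrow> det (Mi t) = 1" "\<And>t. t \<ge> 0 \<Longrightarrow> hol_dS (scale_lam t \<Lambda>) x\<^sub>0 \<gamma> = psl (Mi t)"
     "trace (Mi 0) = of_real (2 * cosh (e / 2))"
     "((\<lambda>t. trace (Mi t)) has_vector_derivative \<i> * of_real (sinh (e / 2) * mink n W)) (at 0 within {0..})"
    using family[of \<i>] by auto
  note cl = complex_length_derivative[OF e Mi(1,3,4)]
  obtain \<delta> where \<delta>: "\<delta> > 0" "\<And>t. 0 \<le> t \<Longrightarrow> t < \<delta> \<Longrightarrow> loxodromic (psl (Mi t))" using cl(1) by blast
  have lox: "\<exists>t. 0 < t \<and> t < 1 \<and> (\<forall>s. 0 \<le> s \<and> s < t \<longrightarrow> loxodromic (hol_dS (scale_lam s \<Lambda>) x\<^sub>0 \<gamma>))"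
    using \<delta> Mi(2) by (intro exI[of _ "min \<delta> (1 / 2)"]) auto
  have "\<i> * of_real (sinh (e / 2) * mink n W) / of_real (sinh (e / 2)) = \<i> * of_real (mink n W)"
    using s by simp
  then have "((\<lambda>t. complex_length (psl (Mi t))) has_vector_derivative \<i> * of_real (mink n W)) (at 0 within {0..})"
    using cl(2) by simp
  then have dS: "((\<lambda>t. complex_length (hol_dS (scale_lam t \<Lambda>) x\<^sub>0 \<gamma>)) has_vector_derivative \<i> * of_real (mink n W)) (at 0 within {0..})"
    by (rule has_vector_derivative_transform_within[OF _ zero_less_one]) (auto simp: Mi(2))
  have k1: "((\<lambda>t. length_spectrum 1 (scale_lam t \<Lambda>) x\<^sub>0 \<gamma>) has_real_derivative 0) (at 0 within {0..})"
    "((\<lambda>t. measure_spectrum 1 (scale_lam t \<Lambda>) x\<^sub>0 \<gamma>) has_real_derivative mink n W) (at 0 within {0..})"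
    using bounded_linear.has_vector_derivative[OF bounded_linear_Re dS] bounded_linear.has_vector_derivative[OF bounded_linear_Im dS]
    by (simp_all add: length_spectrum_def measure_spectrum_def has_real_derivative_iff_has_vector_derivative)

  have AdS: "((\<lambda>t. transl_length (hol (of_real c) (scale_lam t \<Lambda>) x\<^sub>0 \<gamma>)) has_real_derivative c * mink n W) (at 0 within {0..})"
    if c: "\<bar>c\<bar> = 1" for c :: real
  proof -
    obtain M where M: "\<And>t. t \<ge> 0 \<Longrightarrow> det (M t) = 1" "\<And>t. t \<ge> 0 \<Longrightarrow>
      hol (of_real c) (scale_lam t \<Lambda>) x\<^sub>0 \<gamma> = psl (M t)"
       "\<And>t. t \<ge> 0 \<Longrightarrow> real_entries (M t)" "trace (M 0) = of_real (2 * cosh (e / 2))"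
       "((\<lambda>t. trace (M t)) has_vector_derivative of_real (c * (sinh (e / 2) * mink n W))) (at 0 within {0..})"
      using family[of "of_real c"] c by auto
    have "((\<lambda>t. transl_length (psl (M t))) has_real_derivative c * (sinh (e / 2) * mink n W) / sinh (e / 2)) (at 0 within {0..})"
      by (rule transl_length_derivative[OF e M(1,3,4,5)])
    moreover have "c * (sinh (e / 2) * mink n W) / sinh (e / 2) = c * mink n W" using s by simp
    ultimately have "((\<lambda>t. transl_length (psl (M t))) has_real_derivative c * mink n W) (at 0 within {0..})"
      by simp
    then show ?thesis
      by (rule has_field_derivative_transform_within[OF _ zero_less_one]) (auto simp: M(2))
  qed
  have p: "((\<lambda>t. transl_length (hol_AdS_plus (scale_lam t \<Lambda>) x\<^sub>0 \<gamma>)) has_real_derivative mink n W) (at 0 within {0..})"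
    and m: "((\<lambda>t. transl_length (hol_AdS_minus (scale_lam t \<Lambda>) x\<^sub>0 \<gamma>)) has_real_derivative - mink n W) (at 0 within {0..})"
    using AdS[of 1] AdS[of "-1"] by simp_all
  have km: "((\<lambda>t. length_spectrum (- 1) (scale_lam t \<Lambda>) x\<^sub>0 \<gamma>) has_real_derivative 0) (at 0 within {0..})"
    "((\<lambda>t. measure_spectrum (- 1) (scale_lam t \<Lambda>) x\<^sub>0 \<gamma>) has_real_derivative mink n W) (at 0 within {0..})"
    using DERIV_cdivide[OF DERIV_add[OF m p], of 2] DERIV_cdivide[OF DERIV_diff[OF p m], of 2]
    by (simp_all add: length_spectrum_def measure_spectrum_def)

  have "((\<lambda>t. t * mink n W) has_real_derivative mink n W) (at 0 within {0..})"
    by (auto intro!: derivative_eq_intros)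
  then have "((\<lambda>t. measure_spectrum 0 (scale_lam t \<Lambda>) x\<^sub>0 \<gamma>) has_real_derivative mink n W) (at 0 within {0..})"
    by (rule has_field_derivative_transform_within[OF _ zero_less_one])
       (auto simp: measure_spectrum_def tp axis)
  moreover have "((\<lambda>t. length_spectrum 0 (scale_lam t \<Lambda>) x\<^sub>0 \<gamma>) has_real_derivative 0) (at 0 within {0..})"
    by (simp add: length_spectrum_def)
  ultimately show ?thesis using lox k1 km unfolding M0 by auto
qed

end
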